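(* Let $m\ge2$, let $i,j\in\{1,\dots,m\}$ with $i<j$, and let $\beta\in SB(i\ j)_m$ be a simple braid with cord $\gamma_\beta$. \begin{enumerate} \item[(1)] If $\beta$ is positive, then $f_i(\beta)=[\widetilde{\gamma_\beta}]+X_j$ and $f_j(\beta)=-[\widetilde{\gamma_\beta}]$. \item[(2)] If $\beta$ is negative, then $f_i(\beta)=[\widetilde{\gamma_\beta}]$ and $f_j(\beta)=-[\widetilde{\gamma_\beta}]-X_i$. \item[(3)] For $k\in\{1,\dots,m\}$ with $k\ne i,j$, \[ f_k(\beta)=\begin{cases}\big(([\widetilde{\gamma_\beta}]\cdot\zeta_k)-1\big)(X_i-X_j)&\text{if } i<k<j,\\ ([\widetilde{\gamma_\beta}]\cdot\zeta_k)\,(X_i-X_j)&\text{if } k<i\text{ or } j<k.\end{cases} \] \end{enumerate}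
   Context: Braids. $B_m$ is the braid group with standard generators $\sigma_1,\dots,\sigma_{m-1}$. Braids are drawn with starting points at the top and terminal points at the bottom; $\beta_1\beta_2$ is $\beta_1$ stacked above $\beta_2$. The $i$-th string is the one starting at position $i$ at the top. The generator $\sigma_i$ has one crossing, in which the string from top position $i+1$ to bottom position $i$ passes over the string from top position $i$ to bottom position $i+1$. A crossing is positive if its over-strand runs from upper right to lower left (as in $\sigma_i$), negative otherwise. The homomorphism $|\cdot|:B_m\to S_m$ (products in $S_m$ are compositions of functions) is defined by: the $|\beta|(j)$-th string of $\beta$ ends at position $j$. Crossing matrix. $C(\beta)$ is the $m\times m$ integer matrix with zero diagonal whose $(i,j)$ entry is the algebraic number (positive crossings $+1$, negative $-1$) of crossings in a diagram of $\beta$ at which the $i$-th string is over the $j$-th string. $H$ is the free abelian group with basis $X_1,\dots,X_m$, and $f_i(\beta)=\sum_{k=1}^m C(\beta)_{ki}X_k\in H$. Marked disk and cords. $D=[0,1]\times[0,1]$, $q_k=(k/(m+1),1/2)$, $Q_m=\{q_1,\dots,q_m\}$, $q_0=(1/2,0)\in\partial D$. $B_m$ is identified with the mapping class group of $(D,Q_m)$ relative to $\partial D$ (product is composition of functions), $\sigma_i$ corresponding to the $180^\circ$ counterclockwise twist of a small disk neighborhood of the segment $\overline{q_iq_{i+1}}$. For $i<j$, an $(i,j)$-cord is an embedding $\gamma:[0,1]\to(\mathrm{Int}\,D\setminus Q_m)\cup\{q_i,q_j\}$ with $\gamma(0)=q_i$, $\gamma(1)=q_j$; cords are considered up to ambient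 isotopy of $D$ fixing $Q_m$ and $\partial D$ pointwise. Simple braids. A positive (resp. negative) simple braid is an element of $B_m$ conjugate to some $\sigma_i$ (resp. $\sigma_i^{-1}$). $SB(i\ j)_m$ is the set of simple braids $\beta$ (positive or negative) with $|\beta|=(i\ j)$, the transposition of $i<j$. Each positive (resp. negative) $\beta\in SB(i\ j)_m$ corresponds to the isotopy class of the homeomorphism twisting a sufficiently small disk neighborhood of $\gamma_\beta([0,1])$ by $180^\circ$ counterclockwise (resp. clockwise), for an $(i,j)$-cord $\gamma_\beta$, unique up to isotopy, called the cord of $\beta$. Homology class of a cord. Let $D_k$ be a small closed disk centered at $q_k$, and $D_{i,j}=D\setminus\bigsqcup_{k\ne i,j}\mathrm{Int}\,D_k$. $H_1(D_{i,j})$ (integer coefficients) is free abelian on the classes $X_k$, $k\ne i,j$, of the clockwise loops along $\partial D_k$, and is thus viewed as a subgroup of $H$. Let $\alpha_k$ be the straight path from $q_0$ to $q_k$. For an $(i,j)$-cord $\gamma$ (isotoped to avoid the $D_k$, $k\neq i,j$), $\widetilde\gamma=\alpha_i\cdot\gamma\cdot\alpha_j^{-1}$ is a loop based at $q_0$ (paths are traversed from left to right), with class $[\widetilde\gamma]\in H_1(D_{i,j})$. Intersection numbers. For $k\ne i,j$, $\zeta_k$ is the intersection of the vertical segment $\{k/(m+1)\}\times[1/2,1]$ with $D_{i,j}$, oriented upwards, viewed as a class in $H_1(D_{i,j},\partial D_{i,j})$; $(\ \cdot\ ):H_1(D_{i,j})\times H_1(D_{i,j},\partial D_{i,j})\to\mathbb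 Z$ is the intersection pairing, with sign such that $[\widetilde{\gamma_\beta}]=\sum_{k\ne i,j}([\widetilde{\gamma_\beta}]\cdot\zeta_k)X_k$, i.e. $([\widetilde{\gamma_\beta}]\cdot\zeta_k)$ is the coefficient of $X_k$ in $[\widetilde{\gamma_\beta}]$. *)

theory Defs
  imports
    "HOL-Complex_Analysis.Complex_Analysis"
    "HOL-Homology.Homology"
    "HOL-Combinatorics.Transposition"
begin

hide_const (open) Finite_Cartesian_Product.transpose

section \<open>The braid group\<close>

text \<open>A letter \<open>(k, True)\<close> stands for the generator \<open>\<sigma> k\<close> and \<open>(k, False)\<close> for its inverse. A word is
  also a braid diagram, its first letter being the topmost crossing.\<close>

type_synonym braid_word = "(nat \<times> bool) list"

definition braid_words :: "nat \<Rightarrow> braid_word set"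
  where "braid_words m = lists ({1..<m} \<times> UNIV)"

inductive braid_eq :: "nat \<Rightarrow> braid_word \<Rightarrow> braid_word \<Rightarrow> bool" for m :: nat
  where
    refl: "u \<in> braid_words m \<Longrightarrow> braid_eq m u u"
  | sym: "braid_eq m u v \<Longrightarrow> braid_eq m v u"
  | trans: "braid_eq m u v \<Longrightarrow> braid_eq m v w \<Longrightarrow> braid_eq m u w"
  | subword: "braid_eq m u v \<Longrightarrow> x \<in> braid_words m \<Longrightarrow> y \<in> braid_words m \<Longrightarrow>
      braid_eq m (x @ u @ y) (x @ v @ y)"
  | cancel: "k \<in> {1..<m} \<Longrightarrow> braid_eq m [(k, s), (k, \<not> s)] []"
  | far: "k \<in> {1..<m} \<Longrightarrow> l \<in> {1..<m} \<Longrightarrow> k + 2 \<le> l \<Longrightarrow>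
      braid_eq m [(k, True), (l, True)] [(l, True), (k, True)]"
  | near: "k \<in> {1..<m} \<Longrightarrow> Suc k \<in> {1..<m} \<Longrightarrow>
      braid_eq m [(k, True), (Suc k, True), (k, True)] [(Suc k, True), (k, True), (Suc k, True)]"

type_synonym braid = "braid_word set"

definition braid_rel :: "nat \<Rightarrow> (braid_word \<times> braid_word) set"
  where "braid_rel m = {(u, v). braid_eq m u v}"

definition braid_class :: "nat \<Rightarrow> braid_word \<Rightarrow> braid"
  where "braid_class m w = braid_rel m `` {w}"

definition braid_group :: "nat \<Rightarrow> braid monoid"
  where "braid_group m =
    \<lparr>carrier = braid_words m // braid_rel m,
     monoid.mult = (\<lambda>\<beta>1 \<beta>2. \<Union>u\<in>\<beta>1. \<Union>v\<in>\<beta>2. braid_class m (u @ v)),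
     one = braid_class m []\<rparr>"

definition \<sigma> :: "nat \<Rightarrow> nat \<Rightarrow> braid"
  where "\<sigma> m k = braid_class m [(k, True)]"

text \<open>\<open>word_perm w q\<close> is the top position of the string that ends at bottom position \<open>q\<close>.\<close>

primrec word_perm :: "braid_word \<Rightarrow> nat \<Rightarrow> nat"
  where
    "word_perm [] = id"
  | "word_perm (c # w) = transpose (fst c) (Suc (fst c)) \<circ> word_perm w"

definition braid_perm :: "braid \<Rightarrow> nat \<Rightarrow> nat"
  where "braid_perm \<beta> = the_elem (word_perm ` \<beta>)"

text \<open>\<open>word_crossings p w a b\<close> is the algebraic number of crossings of \<open>w\<close> at which string \<open>a\<close> is over
  string \<open>b\<close>, if \<open>p q\<close> is the string entering \<open>w\<close> at position \<open>q\<close>. In a positive crossing at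
  positions \<open>k\<close>, \<open>k + 1\<close> the string coming from \<open>k + 1\<close> is over, in a negative one that coming from \<open>k\<close>.\<close>

primrec word_crossings :: "(nat \<Rightarrow> nat) \<Rightarrow> braid_word \<Rightarrow> nat \<Rightarrow> nat \<Rightarrow> int"
  where
    "word_crossings p [] a b = 0"
  | "word_crossings p (c # w) a b =
       (let k = fst c in
         (if snd c then of_bool (a = p (Suc k) \<and> b = p k)
          else - of_bool (a = p k \<and> b = p (Suc k)))
         + word_crossings (p \<circ> transpose k (Suc k)) w a b)"

definition crossing_matrix :: "braid \<Rightarrow> nat \<Rightarrow> nat \<Rightarrow> int"
  where "crossing_matrix \<beta> a b = the_elem ((\<lambda>w. word_crossings id w a b) ` \<beta>)"

text \<open>The group \<open>H\<close> is \<^term>\<open>free_Abelian_group {1..m}\<close>, written additively in the ambient type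
  \<^typ>\<open>nat \<Rightarrow>\<^sub>0 int\<close>.\<close>

abbreviation X :: "nat \<Rightarrow> (nat \<Rightarrow>\<^sub>0 int)"
  where "X k \<equiv> frag_of k"

definition crossing_vector :: "nat \<Rightarrow> braid \<Rightarrow> nat \<Rightarrow> (nat \<Rightarrow>\<^sub>0 int)"
  where "crossing_vector m \<beta> i = (\<Sum>k\<in>{1..m}. frag_cmul (crossing_matrix \<beta> k i) (X k))"

definition positive_simple :: "nat \<Rightarrow> braid \<Rightarrow> bool"
  where "positive_simple m \<beta> \<longleftrightarrow>
    (\<exists>\<tau>\<in>carrier (braid_group m). \<exists>k\<in>{1..<m}.
      \<beta> = \<tau> \<otimes>\<^bsub>braid_group m\<^esub> \<sigma> m k \<otimes>\<^bsub>braid_group m\<^esub> inv\<^bsub>braid_group m\<^esub> \<tau>)"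

definition negative_simple :: "nat \<Rightarrow> braid \<Rightarrow> bool"
  where "negative_simple m \<beta> \<longleftrightarrow>
    (\<exists>\<tau>\<in>carrier (braid_group m). \<exists>k\<in>{1..<m}.
      \<beta> = \<tau> \<otimes>\<^bsub>braid_group m\<^esub> inv\<^bsub>braid_group m\<^esub> (\<sigma> m k) \<otimes>\<^bsub>braid_group m\<^esub> inv\<^bsub>braid_group m\<^esub> \<tau>)"

definition SB :: "nat \<Rightarrow> nat \<Rightarrow> nat \<Rightarrow> braid set"
  where "SB m i j =
    {\<beta>. (positive_simple m \<beta> \<or> negative_simple m \<beta>) \<and> braid_perm \<beta> = transpose i j}"

subsection \<open>Independence of the representing word\<close>

lemma braid_words_simps [simp]:
  "[] \<in> braid_words m"
  "c # w \<in> braid_words m \<longleftrightarrow> fst c \<in> {1..<m} \<and> w \<in> braid_words m"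
  "u @ v \<in> braid_words m \<longleftrightarrow> u \<in> braid_words m \<and> v \<in> braid_words m"
  by (cases c; auto simp: braid_words_def)+

lemma braid_eq_words: "braid_eq m u v \<Longrightarrow> u \<in> braid_words m \<and> v \<in> braid_words m"
  by (induction rule: braid_eq.induct) auto

lemma equiv_braid_rel: "equiv (braid_words m) (braid_rel m)"
  unfolding braid_rel_def
  by (intro equivI refl_onI symI transI)
     (auto dest: braid_eq_words intro: braid_eq.refl braid_eq.sym braid_eq.trans)

lemma word_perm_append: "word_perm (u @ v) = word_perm u \<circ> word_perm v"
  by (induction u) auto

lemma word_crossings_append:
  "word_crossings p (u @ v) a b = word_crossings p u a b + word_crossings (p \<circ> word_perm u) v a b"
  by (induction u arbitrary: p) (auto simp: Let_def o_assoc)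

lemma word_perm_braid_eq: "braid_eq m u v \<Longrightarrow> word_perm u = word_perm v"
proof (induction rule: braid_eq.induct)
  case (far k l)
  have "transpose k (Suc k) (transpose l (Suc l) x) = transpose l (Suc l) (transpose k (Suc k) x)" for x
    using far(3)
    by (cases "x = k"; cases "x = Suc k"; cases "x = l"; cases "x = Suc l")
       (simp_all add: Transposition.transpose_def)
  then show ?case by (simp add: fun_eq_iff)
next
  case (near k)
  have "transpose k (Suc k) (transpose (Suc k) (Suc (Suc k)) (transpose k (Suc k) x)) =
      transpose (Suc k) (Suc (Suc k)) (transpose k (Suc k) (transpose (Suc k) (Suc (Suc k)) x))" for x
    by (cases "x = k"; cases "x = Suc k"; cases "x = Suc (Suc k)")
       (simp_all add: Transposition.transpose_def)
  then show ?case by (simp add: fun_eq_iff)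
qed (simp_all add: word_perm_append)

lemma word_crossings_braid_eq:
  "braid_eq m u v \<Longrightarrow> word_crossings p u a b = word_crossings p v a b"
proof (induction arbitrary: p rule: braid_eq.induct)
  case (subword u v x y)
  then show ?case
    by (simp only: word_crossings_append word_perm_braid_eq[OF subword(1)])
next
  case (cancel k s)
  show ?case
    by (cases s)
      (simp_all only: word_crossings.simps Let_def fst_conv snd_conv o_apply if_True if_False not_True_eq_False
        not_False_eq_True transpose_apply_first transpose_apply_second add_0_right
        right_minus left_minus)
next
  case (far k l)
  then have "transpose k (Suc k) l = l" "transpose k (Suc k) (Suc l) = Suc l"
    "transpose l (Suc l) k = k" "transpose l (Suc l) (Suc k) = Suc k"
    by (simp_all add: Transposition.transpose_def)
  then show ?case
    by (simp only: word_crossings.simps Let_def fst_conv snd_conv o_apply if_True add_0_right add.commute)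
next
  case (near k)
  have "transpose k (Suc k) (Suc (Suc k)) = Suc (Suc k)"
    "transpose (Suc k) (Suc (Suc k)) k = k"
    by (simp_all add: Transposition.transpose_def)
  then show ?case
    by (simp only: word_crossings.simps Let_def fst_conv snd_conv o_apply if_True add_0_right
        transpose_apply_first transpose_apply_second add.commute add.left_commute)
qed simp_all

lemma braid_perm_class: "w \<in> braid_words m \<Longrightarrow> braid_perm (braid_class m w) = word_perm w"
proof -
  assume "w \<in> braid_words m"
  then have "word_perm ` braid_class m w = {word_perm w}"
    by (auto simp: braid_class_def braid_rel_def image_iff
        intro!: bexI[of _ w] braid_eq.refl word_perm_braid_eq[symmetric])
  then show ?thesis by (simp add: braid_perm_def)
qed

lemma crossing_matrix_class:
  "w \<in> braid_words m \<Longrightarrow> crossing_matrix (braid_class m w) a b = word_crossings id w a b"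
proof -
  assume "w \<in> braid_words m"
  then have "(\<lambda>u. word_crossings id u a b) ` braid_class m w = {word_crossings id w a b}"
    by (auto simp: braid_class_def braid_rel_def image_iff
        intro!: bexI[of _ w] braid_eq.refl word_crossings_braid_eq[symmetric])
  then show ?thesis by (simp add: crossing_matrix_def)
qed

lemma braid_class_eq_iff:
  "u \<in> braid_words m \<Longrightarrow> v \<in> braid_words m \<Longrightarrow>
    braid_class m u = braid_class m v \<longleftrightarrow> braid_eq m u v"
  using eq_equiv_class_iff[OF equiv_braid_rel] by (auto simp: braid_class_def braid_rel_def)

lemma braid_class_mult:
  assumes "u \<in> braid_words m" "v \<in> braid_words m"
  shows "braid_class m u \<otimes>\<^bsub>braid_group m\<^esub> braid_class m v = braid_class m (u @ v)"
proof -
  have eq: "braid_class m (u' @ v') = braid_class m (u @ v)"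
    if "braid_eq m u u'" "braid_eq m v v'" for u' v'
  proof -
    have w: "u' \<in> braid_words m" "v' \<in> braid_words m"
      using that braid_eq_words by blast+
    have "braid_eq m (u' @ v') (u @ v')"
      using braid_eq.subword[OF braid_eq.sym[OF that(1)], of "[]" v'] w by simp
    moreover have "braid_eq m (u @ v') (u @ v)"
      using braid_eq.subword[OF braid_eq.sym[OF that(2)], of u "[]"] assms by simp
    ultimately show ?thesis
      using assms w by (simp add: braid_class_eq_iff braid_eq.trans[of m "u' @ v'" "u @ v'"])
  qed
  have "u \<in> braid_class m u" "v \<in> braid_class m v"
    using assms by (auto simp: braid_class_def braid_rel_def intro: braid_eq.refl)
  moreover have "braid_eq m w w'" if "w' \<in> braid_class m w" for w w'
    using that by (simp add: braid_class_def braid_rel_def)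
  ultimately have "(\<Union>x\<in>braid_class m u. \<Union>y\<in>braid_class m v. braid_class m (x @ y)) =
      braid_class m (u @ v)"
    using eq by blast
  then show ?thesis by (simp add: braid_group_def)
qed

lemma carrier_braid_group: "carrier (braid_group m) = braid_class m ` braid_words m"
  by (auto simp: braid_group_def braid_class_def quotient_def)

lemma one_braid_group: "\<one>\<^bsub>braid_group m\<^esub> = braid_class m []"
  by (simp add: braid_group_def)

lemma braid_eq_inverse_word:
  "w \<in> braid_words m \<Longrightarrow> braid_eq m (rev (map (apsnd Not) w) @ w) []"
proof (induction w)
  case (Cons c w)
  obtain k s where c: "c = (k, s)" by (cases c)
  have k: "k \<in> {1..<m}" and w: "w \<in> braid_words m" using Cons.prems c by auto
  let ?r = "rev (map (apsnd Not) w)"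
  have r: "?r \<in> braid_words m"
    using w by (induction w) auto
  have "braid_eq m (?r @ [(k, \<not> s), (k, s)] @ w) (?r @ [] @ w)"
    using braid_eq.subword[OF braid_eq.cancel[OF k, of "\<not> s"] r w] by simp
  then show ?case
    using braid_eq.trans[OF _ Cons.IH[OF w]] c by simp
qed (auto intro: braid_eq.refl)

lemma group_braid_group: "group (braid_group m)"
proof (rule groupI)
  fix x assume "x \<in> carrier (braid_group m)"
  then obtain w where w: "w \<in> braid_words m" "x = braid_class m w"
    by (auto simp: carrier_braid_group)
  have r: "rev (map (apsnd Not) w) \<in> braid_words m"
    using w(1) by (induction w) auto
  then have "braid_class m (rev (map (apsnd Not) w)) \<otimes>\<^bsub>braid_group m\<^esub> x = \<one>\<^bsub>braid_group m\<^esub>"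
    using w braid_eq_inverse_word[OF w(1)]
    by (simp add: braid_class_mult one_braid_group braid_class_eq_iff)
  then show "\<exists>y\<in>carrier (braid_group m). y \<otimes>\<^bsub>braid_group m\<^esub> x = \<one>\<^bsub>braid_group m\<^esub>"
    using r unfolding carrier_braid_group by blast
qed (auto simp: carrier_braid_group one_braid_group braid_class_mult)


section \<open>The marked disk, its mapping classes and cords\<close>

definition D :: "complex set"
  where "D = {z. 0 \<le> Re z \<and> Re z \<le> 1 \<and> 0 \<le> Im z \<and> Im z \<le> 1}"

definition q :: "nat \<Rightarrow> nat \<Rightarrow> complex"
  where "q m k = Complex (real k / real (m + 1)) (1/2)"

definition Q :: "nat \<Rightarrow> complex set"
  where "Q m = q m ` {1..m}"

definition q0 :: complex
  where "q0 = Complex (1/2) 0"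

definition is_homeo :: "nat \<Rightarrow> (complex \<Rightarrow> complex) \<Rightarrow> bool"
  where "is_homeo m h \<longleftrightarrow>
    (\<exists>g. homeomorphism D D h g) \<and> (\<forall>z\<in>frontier D. h z = z) \<and> h ` Q m = Q m"

definition isotopic :: "nat \<Rightarrow> (complex \<Rightarrow> complex) \<Rightarrow> (complex \<Rightarrow> complex) \<Rightarrow> bool"
  where "isotopic m = homotopic_with (is_homeo m) (top_of_set D) (top_of_set D)"

definition is_cord :: "nat \<Rightarrow> nat \<Rightarrow> nat \<Rightarrow> (real \<Rightarrow> complex) \<Rightarrow> bool"
  where "is_cord m i j \<gamma> \<longleftrightarrow>
    arc \<gamma> \<and> pathstart \<gamma> = q m i \<and> pathfinish \<gamma> = q m j \<and>
    path_image \<gamma> \<subseteq> (interior D - Q m) \<union> {q m i, q m j}"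

text \<open>The model half twist of the disk of radius 2 about the segment from \<open>-1\<close> to \<open>1\<close>: it turns the
  unit disk by 180 degrees, counterclockwise if \<open>s\<close> holds and clockwise otherwise, and is the
  identity on the boundary circle.\<close>

definition model_twist :: "bool \<Rightarrow> complex \<Rightarrow> complex"
  where "model_twist s z = cis ((if s then pi else - pi) * min 1 (2 - norm z)) * z"

text \<open>\<open>half_twist m s \<gamma> h\<close>: \<open>h\<close> is the half twist of some disk neighbourhood \<open>N\<close> of the arc \<open>\<gamma>\<close>. The
  winding number makes the chart \<open>\<phi>\<close> of \<open>N\<close> orientation preserving.\<close>

definition half_twist ::
    "nat \<Rightarrow> bool \<Rightarrow> (real \<Rightarrow> complex) \<Rightarrow> (complex \<Rightarrow> complex) \<Rightarrow> bool"
  where "half_twist m s \<gamma> h \<longleftrightarrow>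
    (\<exists>N \<phi> \<psi>. N \<subseteq> interior D \<and> N \<inter> Q m = {pathstart \<gamma>, pathfinish \<gamma>} \<and>
       homeomorphism (cball 0 2) N \<phi> \<psi> \<and>
       winding_number (\<phi> \<circ> circlepath 0 2) (\<phi> 0) = 1 \<and>
       \<phi> ` closed_segment (-1) 1 = path_image \<gamma> \<and>
       (\<forall>z\<in>N. h z = \<phi> (model_twist s (\<psi> z))) \<and>
       (\<forall>z. z \<notin> N \<longrightarrow> h z = z))"

text \<open>The identification of the braid group with the mapping class group: \<open>\<sigma> k\<close> is the
  counterclockwise half twist about the segment from \<open>q k\<close> to \<open>q (k + 1)\<close>, products are compositions.\<close>

primrec word_homeo :: "nat \<Rightarrow> braid_word \<Rightarrow> (complex \<Rightarrow> complex) \<Rightarrow> bool"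
  where
    "word_homeo m [] h \<longleftrightarrow> isotopic m id h"
  | "word_homeo m (c # w) h \<longleftrightarrow>
      (\<exists>f g. half_twist m (snd c) (linepath (q m (fst c)) (q m (Suc (fst c)))) f \<and>
         word_homeo m w g \<and> isotopic m (f \<circ> g) h)"

definition mapping_class :: "nat \<Rightarrow> braid \<Rightarrow> (complex \<Rightarrow> complex) set"
  where "mapping_class m \<beta> = {h. \<exists>w\<in>\<beta>. word_homeo m w h}"

definition is_cord_of :: "nat \<Rightarrow> nat \<Rightarrow> nat \<Rightarrow> braid \<Rightarrow> (real \<Rightarrow> complex) \<Rightarrow> bool"
  where "is_cord_of m i j \<beta> \<gamma> \<longleftrightarrow> is_cord m i j \<gamma> \<and>
    (positive_simple m \<beta> \<and> (\<exists>h\<in>mapping_class m \<beta>. half_twist m True \<gamma> h) \<or>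
     negative_simple m \<beta> \<and> (\<exists>h\<in>mapping_class m \<beta>. half_twist m False \<gamma> h))"


section \<open>The homology class of a cord and intersection numbers\<close>

text \<open>\<open>\<epsilon>\<close> is the common radius of the small disks removed around the marked points.\<close>

definition punctured_disk :: "nat \<Rightarrow> real \<Rightarrow> nat \<Rightarrow> nat \<Rightarrow> complex set"
  where "punctured_disk m \<epsilon> i j = D - (\<Union>k\<in>{1..m} - {i, j}. ball (q m k) \<epsilon>)"

definition path_chain :: "(real \<Rightarrow> complex) \<Rightarrow> complex chain"
  where "path_chain p = frag_of (restrict (\<lambda>x. p (x 1)) (standard_simplex 1))"

text \<open>The class of a cycle \<open>c\<close> in \<^term>\<open>homology_group 1 (top_of_set S)\<close>.\<close>

definition homology_class :: "complex set \<Rightarrow> complex chain \<Rightarrow> complex chain set"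
  where "homology_class S c = homologous_rel_set 1 (top_of_set S) {} c"

definition boundary_loop :: "nat \<Rightarrow> real \<Rightarrow> nat \<Rightarrow> real \<Rightarrow> complex"
  where "boundary_loop m \<epsilon> k = reversepath (circlepath (q m k) \<epsilon>)"

text \<open>The inclusion of the first homology group of \<^term>\<open>punctured_disk m \<epsilon> i j\<close> in \<open>H\<close>: that
  group is free abelian on the classes of the clockwise loops, which are identified with the \<open>X k\<close>.\<close>

definition to_H :: "nat \<Rightarrow> real \<Rightarrow> nat \<Rightarrow> nat \<Rightarrow> complex chain set \<Rightarrow> (nat \<Rightarrow>\<^sub>0 int)"
  where "to_H m \<epsilon> i j h =
    (THE v. v \<in> carrier (free_Abelian_group ({1..m} - {i, j})) \<and>
       h = homology_class (punctured_disk m \<epsilon> i j)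
             (\<Sum>k\<in>{1..m} - {i, j}. frag_cmul (Poly_Mapping.lookup v k) (path_chain (boundary_loop m \<epsilon> k))))"

definition closed_cord :: "nat \<Rightarrow> nat \<Rightarrow> nat \<Rightarrow> (real \<Rightarrow> complex) \<Rightarrow> real \<Rightarrow> complex"
  where "closed_cord m i j \<gamma> = linepath q0 (q m i) +++ \<gamma> +++ reversepath (linepath q0 (q m j))"

definition cord_class :: "nat \<Rightarrow> real \<Rightarrow> nat \<Rightarrow> nat \<Rightarrow> (real \<Rightarrow> complex) \<Rightarrow> complex chain set"
  where "cord_class m \<epsilon> i j \<gamma> =
    homology_class (punctured_disk m \<epsilon> i j) (path_chain (closed_cord m i j \<gamma>))"

definition \<zeta> :: "nat \<Rightarrow> real \<Rightarrow> nat \<Rightarrow> nat \<Rightarrow> nat \<Rightarrow> complex set"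
  where "\<zeta> m \<epsilon> i j k =
    closed_segment (q m k) (Complex (real k / real (m + 1)) 1) \<inter> punctured_disk m \<epsilon> i j"

definition crosses_rightwards :: "(real \<Rightarrow> complex) \<Rightarrow> real \<Rightarrow> bool"
  where "crosses_rightwards p t \<longleftrightarrow>
    (\<forall>\<^sub>F s in at_left t. Re (p s) < Re (p t)) \<and> (\<forall>\<^sub>F s in at_right t. Re (p s) > Re (p t))"

definition crosses_leftwards :: "(real \<Rightarrow> complex) \<Rightarrow> real \<Rightarrow> bool"
  where "crosses_leftwards p t \<longleftrightarrow>
    (\<forall>\<^sub>F s in at_left t. Re (p s) > Re (p t)) \<and> (\<forall>\<^sub>F s in at_right t. Re (p s) < Re (p t))"

definition transverse :: "(real \<Rightarrow> complex) \<Rightarrow> complex set \<Rightarrow> bool"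
  where "transverse p A \<longleftrightarrow>
    pathstart p \<notin> A \<and> pathfinish p \<notin> A \<and> finite {t \<in> {0..1}. p t \<in> A} \<and>
    (\<forall>t\<in>{0..1}. p t \<in> A \<longrightarrow> crosses_rightwards p t \<or> crosses_leftwards p t)"

text \<open>Algebraic number of intersections of a loop \<open>p\<close>, transverse to the vertical segment \<open>A\<close>, with \<open>A\<close>. The sign is
  such that the clockwise loop around \<open>q k\<close>, which passes above \<open>q k\<close> from left to right, meets
  \<open>\<zeta> k\<close> with sign \<open>+1\<close>.\<close>

definition signed_crossings :: "(real \<Rightarrow> complex) \<Rightarrow> complex set \<Rightarrow> int"
  where "signed_crossings p A =
    int (card {t \<in> {0..1}. p t \<in> A \<and> crosses_rightwards p t}) -
    int (card {t \<in> {0..1}. p t \<in> A \<and> crosses_leftwards p t})"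

text \<open>The intersection pairing of a homology class with \<open>\<zeta> k\<close>: the number of signed intersections
  of any transverse loop representing the class.\<close>

definition intersection_number ::
    "nat \<Rightarrow> real \<Rightarrow> nat \<Rightarrow> nat \<Rightarrow> complex chain set \<Rightarrow> nat \<Rightarrow> int"
  where "intersection_number m \<epsilon> i j h k =
    (THE n. \<exists>p. path p \<and> pathfinish p = pathstart p \<and>
       path_image p \<subseteq> punctured_disk m \<epsilon> i j \<and>
       h = homology_class (punctured_disk m \<epsilon> i j) (path_chain p) \<and>
       transverse p (\<zeta> m \<epsilon> i j k) \<and> n = signed_crossings p (\<zeta> m \<epsilon> i j k))"

end

(* Forgetting the marked points, a mapping class h of the disk is isotopic to the identity by the
   Alexander trick, and the change of log (y - x) along such an isotopy is a function L of pairs of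
   distinct points. It is additive under composition, depends at marked points only on the isotopy
   class, and for a generator it counts a single crossing. So for any braid word
   Im L (q a, q b) / pi is the total algebraic number of crossings of two strings; together with the
   permutation, which tells how over- and under-crossings alternate, it determines the crossing matrix.
   For the half twist h along a cord, L is computed directly: h is the identity off a disk containing
   the cord but not q k, so a logarithm of z - q k on this disk expresses L (q i, q k) by the winding
   number of the cord around q k, and the pair (q i, q j) turns by half a revolution. The winding numbers of
   the closed cord are its coordinates in the homology of the punctured disk, and they are also the
   signed counts of its crossings with vertical rays. *)

theory Submission
  imports Defs
begin

section \<open>Continuous logarithms of differences\<close>

text \<open>A cord is tied to its braid only by the existence of some word \<open>w\<close> and some
  homeomorphism \<open>h\<close>, so the link between them must be a quantity computable from
  \<open>w\<close> alone and from \<open>h\<close> alone. Following a pair of points through an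
  isotopy would depend on the chosen isotopy. \<open>L\<close> is instead characterised by
  \<open>h\<close> itself: two continuous logarithms of \<open>(h x - h y) / (x - y)\<close> on the
  connected space of distinct pairs differ by a constant, and the value at one pair outside the disk
  fixes it. An isotopy serves only to show that such a logarithm exists. Only the imaginary part
  counts turns; the real part records the change of distance. The open cord has in general no
  integral winding number around \<open>q k\<close>. The two spokes from \<open>q0\<close> that
  close it up end in opposite directions as seen from \<open>q k\<close> exactly if
  \<open>i < k < j\<close>, and then they contribute half a turn. This half turn, together with the
  change of order of the strings, is the origin of the -1 in part (3).\<close>

lemma continuous_log_unique:
  fixes g1 g2 :: "'a::topological_space \<Rightarrow> complex"
  assumes "connected S" "continuous_on S g1" "continuous_on S g2"
    and "\<And>x. x \<in> S \<Longrightarrow> exp (g1 x) = exp (g2 x)"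
    and "a \<in> S" "g1 a = g2 a" "x \<in> S"
  shows "g1 x = g2 x"
proof (rule covering_space_lift_unique[OF covering_space_exp_punctured_plane,
      where f = "\<lambda>x. exp (g1 x)" and T = S and a = a])
  show "continuous_on S (\<lambda>x. exp (g1 x))"
    by (intro continuous_intros assms)
qed (use assms in auto)

text \<open>The ordered configuration space of two points of the plane. It is not simply connected:
  a logarithm on it is determined by its value at one pair but need not exist, and existence is the
  purpose of the Alexander trick.\<close>

definition conf :: "(complex \<times> complex) set"
  where "conf = {(x, y). x \<noteq> y}"

lemma conf_iff [simp]: "(x, y) \<in> conf \<longleftrightarrow> x \<noteq> y"
  by (simp add: conf_def)

lemma continuous_on_conf_slices:
  assumes "continuous_on conf L"
  shows "continuous_on (U - {y}) (\<lambda>x. L (x, y))" "continuous_on (U - {x}) (\<lambda>y. L (x, y))"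
  by (rule continuous_on_compose2[OF assms]; force intro!: continuous_intros)+

text \<open>Pairs are moved one coordinate at a time: a connected open subset of the plane stays
  connected when a point is deleted, so the one-variable uniqueness applies to each move.\<close>

lemma conf_log_unique:
  fixes L1 L2 :: "complex \<times> complex \<Rightarrow> complex"
  assumes U: "open U" "connected U"
    and L: "continuous_on conf L1" "continuous_on conf L2"
    and e: "\<And>x y. x \<in> U \<Longrightarrow> y \<in> U \<Longrightarrow> x \<noteq> y \<Longrightarrow> exp (L1 (x, y)) = exp (L2 (x, y))"
    and a: "a \<in> U" "b \<in> U" "a \<noteq> b" "L1 (a, b) = L2 (a, b)"
    and x: "x \<in> U" "y \<in> U" "x \<noteq> y"
  shows "L1 (x, y) = L2 (x, y)"
proof -
  have con: "connected (U - {p})" for p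
    using U by (intro connected_open_delete) auto
  have h: "L1 (u, v) = L2 (u, v)"
    if "u' \<in> U" "u' \<noteq> v" "L1 (u', v) = L2 (u', v)" "u \<in> U" "v \<in> U" "u \<noteq> v" for u u' v
    by (rule continuous_log_unique[where ?g1.0 = "\<lambda>u. L1 (u, v)" and ?g2.0 = "\<lambda>u. L2 (u, v)" and a = u',
          OF con[of v] continuous_on_conf_slices(1)[OF L(1)] continuous_on_conf_slices(1)[OF L(2)]])
       (use that e in auto)
  have v: "L1 (u, v) = L2 (u, v)"
    if "v' \<in> U" "u \<noteq> v'" "L1 (u, v') = L2 (u, v')" "u \<in> U" "v \<in> U" "u \<noteq> v" for u v v'
    by (rule continuous_log_unique[where ?g1.0 = "\<lambda>v. L1 (u, v)" and ?g2.0 = "\<lambda>v. L2 (u, v)" and a = v',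
          OF con[of u] continuous_on_conf_slices(2)[OF L(1)] continuous_on_conf_slices(2)[OF L(2)]])
       (use that e in auto)
  have "infinite U"
    using U(1) a(1) interior_limit_point[of a U] islimpt_finite[of U a] by (auto simp: interior_open)
  \<comment> \<open>The spare point makes the route \<open>(a, b)\<close>, \<open>(z, b)\<close>,
    \<open>(z, y)\<close>, \<open>(x, y)\<close> avoid coinciding points.\<close>
  then obtain z where "z \<in> U" "z \<noteq> y" "z \<noteq> b"
    by (metis finite.emptyI finite_insert insertCI rev_finite_subset subsetI)
  then show ?thesis
    using h[of a b z] v[of b z y] h[of z y x] a x by auto
qed

text \<open>\<open>diff_log h L\<close>: \<open>L (x, y)\<close> is the change of the logarithm of \<open>y - x\<close> under an isotopy with compact
  support from the identity to \<open>h\<close>. The normalising points 2 and 4 lie outside of the disk.\<close>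

definition diff_log :: "(complex \<Rightarrow> complex) \<Rightarrow> (complex \<times> complex \<Rightarrow> complex) \<Rightarrow> bool"
  where "diff_log h L \<longleftrightarrow> continuous_on conf L \<and>
    (\<forall>x y. x \<noteq> y \<longrightarrow> exp (L (x, y)) = (h x - h y) / (x - y)) \<and> L (2, 4) = 0"

definition supported_homeo :: "(complex \<Rightarrow> complex) \<Rightarrow> bool"
  where "supported_homeo h \<longleftrightarrow> continuous_on UNIV h \<and> inj h \<and> (\<forall>z. z \<notin> D \<longrightarrow> h z = z)"

lemma D_cbox: "D = cbox 0 (Complex 1 1)"
  by (auto simp: D_def in_cbox_complex_iff)

lemma compact_D: "compact D" and closed_D: "closed D" and convex_D: "convex D"
  by (auto simp: D_cbox)

lemma numeral_notin_D [simp]: "2 \<notin> D" "4 \<notin> D"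
  by (auto simp: D_def)

lemma diff_log_unique:
  assumes "diff_log h L1" "diff_log h L2" "x \<noteq> y"
  shows "L1 (x, y) = L2 (x, y)"
  using conf_log_unique[of UNIV L1 L2 2 4 x y] assms by (auto simp: diff_log_def connected_UNIV)

text \<open>On \<open>U\<close> the constant 0 is another logarithm of the same quotient, with the
  right value at \<open>(2, 4)\<close>.\<close>

lemma diff_log_eq_0:
  assumes "diff_log h L" "open U" "connected U" "2 \<in> U" "4 \<in> U"
    and "\<And>z. z \<in> U \<Longrightarrow> h z = z" and "x \<in> U" "y \<in> U" "x \<noteq> y"
  shows "L (x, y) = 0"
  using conf_log_unique[of U L "\<lambda>_. 0" 2 4 x y] assms by (auto simp: diff_log_def)

lemma connected_compl_D: "connected (- D)"
  by (rule connected_complement_bounded_convex) (auto simp: D_cbox)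

text \<open>Exchanging the two points leaves the quotient unchanged but moves the normalisation to
  \<open>(4, 2)\<close>; there \<open>L\<close> vanishes because \<open>h\<close> is the identity on
  the connected complement of the disk.\<close>

lemma diff_log_commute:
  assumes h: "supported_homeo h" and L: "diff_log h L" and "x \<noteq> y"
  shows "L (x, y) = L (y, x)"
proof -
  have "L (4, 2) = 0"
    using h by (intro diff_log_eq_0[OF L _ connected_compl_D])
      (auto simp: supported_homeo_def closed_D)
  then have "diff_log h (\<lambda>(x, y). L (y, x))"
    using L unfolding diff_log_def split_def
    by (auto intro!: continuous_on_compose2[of conf L conf "\<lambda>p. (snd p, fst p)"] continuous_intros)
       (metis minus_diff_eq minus_divide_divide)
  from diff_log_unique[OF L this \<open>x \<noteq> y\<close>] show ?thesis by simp
qed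

lemma diff_log_id: "diff_log id (\<lambda>_. 0)"
  by (auto simp: diff_log_def)

text \<open>The difference quotient of the composite is that of \<open>f\<close> at the images under
  \<open>g\<close> times that of \<open>g\<close>. As \<open>g\<close> fixes 2 and 4, the
  normalisations add to 0.\<close>

lemma diff_log_compose:
  assumes f: "supported_homeo f" "diff_log f Lf" and g: "supported_homeo g" "diff_log g Lg"
  shows "diff_log (f \<circ> g) (\<lambda>(x, y). Lf (g x, g y) + Lg (x, y))"
proof -
  have inj: "g x = g y \<longleftrightarrow> x = y" for x y
    using g by (auto simp: supported_homeo_def inj_eq)
  have cont: "continuous_on S g" for S
    using g continuous_on_subset by (auto simp: supported_homeo_def)
  have "continuous_on conf (\<lambda>p. Lf (g (fst p), g (snd p)) + Lg p)"
    using f g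
    by (auto simp: diff_log_def inj intro!: continuous_intros
        continuous_on_compose2[of conf Lf conf "\<lambda>p. (g (fst p), g (snd p))"]
        continuous_on_compose2[of UNIV g conf fst] continuous_on_compose2[of UNIV g conf snd] cont)
  then show ?thesis
    using f g by (auto simp: diff_log_def supported_homeo_def exp_add inj split_def)
qed

text \<open>The Alexander trick: \<open>s * h (x / s)\<close> is an isotopy from the identity to \<open>h\<close>.\<close>

lemma continuous_on_rescaled:
  fixes B :: "real \<times> complex \<Rightarrow> complex"
  assumes B: "continuous_on ({0..1} \<times> UNIV) B" "\<And>t x. t \<in> {0..1} \<Longrightarrow> norm (B (t, x)) \<le> M"
  shows "continuous_on ({0..1} \<times> {0..1} \<times> UNIV) (\<lambda>(s, t, x). of_real s * B (t, x / of_real s))"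
    (is "continuous_on ?S ?F")
  unfolding continuous_on_eq_continuous_within
proof
  fix p :: "real \<times> real \<times> complex" assume p: "p \<in> ?S"
  obtain s t x where pe: "p = (s, t, x)" by (cases p)
  show "continuous (at p within ?S) ?F"
  proof (cases "s = 0")
    \<comment> \<open>At scale 0 the quotient by \<open>s\<close> carries no information; the bound
      by \<open>s * M\<close> alone forces the limit 0. This is why the bounded displacement is
      rescaled instead of the map.\<close>
    case True
    have "(?F \<longlongrightarrow> 0) (at p within ?S)"
    proof (rule Lim_null_comparison)
      show "\<forall>\<^sub>F q in at p within ?S. norm (?F q) \<le> fst q * M"
        unfolding eventually_at_filter
        by (rule always_eventually) (auto simp: norm_mult intro!: mult_left_mono B)
      have "((\<lambda>q. fst q * M) \<longlongrightarrow> fst p * M) (at p within ?S)"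
        by (intro tendsto_intros)
      then show "((\<lambda>q. fst q * M) \<longlongrightarrow> 0) (at p within ?S)"
        by (simp add: pe True)
    qed
    then show ?thesis by (simp add: continuous_within pe True)
  next
    case False
    let ?T = "({0<..1} \<times> {0..1} \<times> UNIV) :: (real \<times> real \<times> complex) set"
    have "continuous_on ?T (\<lambda>p. of_real (fst p) * B (fst (snd p), snd (snd p) / of_real (fst p)))"
      by (intro continuous_intros continuous_on_compose2[OF B(1)]) auto
    then have "continuous (at p within ?T) ?F"
      using p False by (auto simp: continuous_on_eq_continuous_within pe split_def)
    moreover have "at p within ?T = at p within ?S"
    proof (rule at_within_nhd[of _ "{0<..} \<times> UNIV"])
      show "p \<in> {0<..} \<times> UNIV" using p False by (auto simp: pe)
      show "open ({0::real<..} \<times> (UNIV :: (real \<times> complex) set))" by (intro open_Times) auto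
    qed auto
    ultimately show ?thesis by simp
  qed
qed

text \<open>Rescaling gives a homotopy \<open>K\<close>, through nonvanishing functions, from the
  constant 1 to the difference quotient, which therefore has a continuous logarithm. The parameter
  \<open>t\<close> is carried along so that the logarithm is also continuous along an
  isotopy.\<close>

lemma diff_log_family:
  fixes H :: "real \<times> complex \<Rightarrow> complex"
  assumes H: "continuous_on ({0..1} \<times> UNIV) H"
    and h: "\<And>t. t \<in> {0..1} \<Longrightarrow> supported_homeo (\<lambda>z. H (t, z))"
  obtains G where "continuous_on ({0..1} \<times> conf) G"
    "\<And>t. t \<in> {0..1} \<Longrightarrow> diff_log (\<lambda>z. H (t, z)) (\<lambda>p. G (t, p))"
proof -
  define B where "B = (\<lambda>(t, x). H (t, x) - x)"
  have contB: "continuous_on ({0..1} \<times> UNIV) B"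
    unfolding B_def split_def prod.collapse by (intro continuous_intros H)
  have "compact ({0..1::real} \<times> D)"
    by (simp add: compact_Times compact_D)
  moreover have "continuous_on ({0..1} \<times> D) B"
    by (rule continuous_on_subset[OF contB]) auto
  ultimately have "bounded (B ` ({0..1} \<times> D))"
    using compact_imp_bounded compact_continuous_image by blast
  then obtain M where M: "0 < M" "\<And>p. p \<in> {0..1} \<times> D \<Longrightarrow> norm (B p) \<le> M"
    unfolding bounded_pos by (meson imageI)
  have "norm (B (t, x)) \<le> M" if "t \<in> {0..1}" for t x
  proof (cases "x \<in> D")
    case True
    then show ?thesis using that by (intro M) auto
  next
    case False
    then have "B (t, x) = 0" using h[OF that] by (simp add: B_def supported_homeo_def)
    then show ?thesis using M by simp
  qed
  note cont0 = continuous_on_rescaled[OF contB this]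
  define A where "A = (\<lambda>s t x. x + of_real s * B (t, x / of_real s))"
  have A: "A s t x = of_real s * H (t, x / of_real s)" if "s \<noteq> 0" for s t x
    using that by (simp add: A_def B_def algebra_simps)
  have A0: "A 0 t x = x" for t x by (simp add: A_def)
  \<comment> \<open>\<open>A 0 t\<close> is the identity, so 1 is the value at scale 0 that keeps
    the quotient continuous on distinct pairs.\<close>
  define K where "K = (\<lambda>(s, t, x, y). if s = 0 then 1 else (A s t x - A s t y) / (x - y))"
  have K1: "K (1, t, x, y) = (H (t, x) - H (t, y)) / (x - y)" for t x y
    by (simp add: K_def A)
  have contA: "continuous_on ({0..1} \<times> {0..1} \<times> conf) (\<lambda>p. A (fst p) (fst (snd p)) (f (snd (snd p))))"
    if "continuous_on conf f" for f
  proof -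
    have f: "continuous_on ({0..1} \<times> {0..1} \<times> conf) (\<lambda>p::real \<times> real \<times> complex \<times> complex. f (snd (snd p)))"
      by (rule continuous_on_compose2[OF that]) (auto intro!: continuous_intros)
    show ?thesis unfolding A_def
      by (intro continuous_on_add f)
         (rule continuous_on_compose2[OF cont0, of _ "\<lambda>p. (fst p, fst (snd p), f (snd (snd p)))",
            unfolded split_def fst_conv snd_conv], auto intro!: continuous_intros f)
  qed
  have "continuous_on ({0..1} \<times> {0..1} \<times> conf) (\<lambda>p. (A (fst p) (fst (snd p)) (fst (snd (snd p)))
      - A (fst p) (fst (snd p)) (snd (snd (snd p)))) / (fst (snd (snd p)) - snd (snd (snd p))))"
    by (intro continuous_intros contA) auto
  then have contK: "continuous_on ({0..1} \<times> {0..1} \<times> conf) K"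
    by (rule continuous_on_eq) (auto simp: K_def A0)
  have Knz: "K p \<noteq> 0" if "p \<in> {0..1} \<times> {0..1} \<times> conf" for p
  proof -
    obtain s t x y where p: "p = (s, t, x, y)" by (cases p)
    have p': "t \<in> {0..1}" "x \<noteq> y" using that by (auto simp: p)
    have inj: "inj (\<lambda>z. H (t, z))" using h[OF p'(1)] by (simp add: supported_homeo_def)
    show ?thesis
    proof (cases "s = 0")
      case False
      then have "x / of_real s \<noteq> y / of_real s" using p'(2) by simp
      then have "H (t, x / of_real s) \<noteq> H (t, y / of_real s)"
        using inj_eq[OF inj] by simp
      then show ?thesis using False p' by (simp add: p K_def A)
    qed (simp add: p K_def)
  qed
  have "homotopic_with_canon (\<lambda>h. True) ({0..1} \<times> conf) (- {0}) (\<lambda>p. 1) (\<lambda>p. K (1, p))"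
    unfolding homotopic_with_def
    by (rule exI[of _ K]) (use contK Knz in \<open>auto simp: K_def\<close>)
  then have "\<exists>g. continuous_on ({0..1} \<times> conf) g \<and> (\<forall>p\<in>{0..1} \<times> conf. K (1, p) = exp (g p))"
    by (subst inessential_eq_continuous_logarithm[symmetric]) (blast intro: homotopic_with_symD)
  then obtain g where g: "continuous_on ({0..1} \<times> conf) g"
    "\<And>p. p \<in> {0..1} \<times> conf \<Longrightarrow> K (1, p) = exp (g p)" by blast
  have g24: "exp (g (t, 2, 4)) = 1" if "t \<in> {0..1}" for t
    using g(2)[of "(t, 2, 4)"] h[OF that] that by (simp add: K1 supported_homeo_def)
  \<comment> \<open>The subtracted term is a logarithm of 1 that depends on \<open>t\<close> only;
    removing it normalises every stage and preserves continuity.\<close>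
  let ?G = "\<lambda>p. g p - g (fst p, 2, 4)"
  show thesis
  proof
    show contG: "continuous_on ({0..1} \<times> conf) ?G"
      by (intro continuous_intros g continuous_on_compose2[OF g(1), of _ "\<lambda>p. (fst p, 2, 4)"]) auto
    fix t :: real assume t: "t \<in> {0..1}"
    have "continuous_on conf (\<lambda>p. ?G (t, p))"
      by (rule continuous_on_compose2[OF contG, of _ "\<lambda>p. (t, p)"]) (use t in \<open>auto intro!: continuous_intros\<close>)
    moreover have "exp (?G (t, x, y)) = (H (t, x) - H (t, y)) / (x - y)" if "x \<noteq> y" for x y
      using g(2)[of "(t, x, y)"] t that by (simp add: exp_diff g24[OF t] K1)
    ultimately show "diff_log (\<lambda>z. H (t, z)) (\<lambda>p. ?G (t, p))"
      by (simp add: diff_log_def)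
  qed
qed

lemma diff_log_exists:
  assumes "supported_homeo h"
  obtains L where "diff_log h L"
proof -
  have "continuous_on ({0..1::real} \<times> UNIV) (\<lambda>p. h (snd p))"
    using assms by (auto simp: supported_homeo_def intro!: continuous_on_compose2[of UNIV h] continuous_intros)
  then show thesis
  proof (rule diff_log_family, goal_cases)
    case (2 G)
    show ?case using that[of "\<lambda>p. G (0, p)"] 2(2)[of 0] by simp
  qed (use assms in simp)
qed

text \<open>Homeomorphisms of \<^term>\<open>D\<close> are only meaningful on \<^term>\<open>D\<close>; elsewhere they are replaced by
  the identity.\<close>

definition extend_by_id :: "(complex \<Rightarrow> complex) \<Rightarrow> complex \<Rightarrow> complex"
  where "extend_by_id h z = (if z \<in> D then h z else z)"

lemma supported_homeo_extend_by_id: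
  assumes "is_homeo m h"
  shows "supported_homeo (extend_by_id h)"
proof -
  from assms obtain g where g: "homeomorphism D D h g" and fr: "\<And>z. z \<in> frontier D \<Longrightarrow> h z = z"
    by (auto simp: is_homeo_def)
  have "continuous_on (D \<union> closure (- D)) (\<lambda>z. if z \<in> D then h z else z)"
    using g fr closed_D
    by (intro continuous_on_cases) (auto simp: homeomorphism_def frontier_def interior_closure)
  moreover have "D \<union> closure (- D) = UNIV"
    using closure_subset[of "- D"] by blast
  ultimately have "continuous_on UNIV (extend_by_id h)"
    by (simp add: extend_by_id_def[abs_def])
  moreover have "inj (extend_by_id h)"
    using g by (auto simp: inj_def extend_by_id_def homeomorphism_def split: if_splits) metis+
  ultimately show ?thesis by (auto simp: supported_homeo_def extend_by_id_def)
qed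

text \<open>\<open>isotopic\<close> asks each stage only to preserve \<open>Q m\<close> as a set.
  The track of a marked point is a continuous path in a finite set, hence constant.\<close>

lemma isotopic_family:
  assumes iso: "isotopic m f h" and QD: "Q m \<subseteq> D"
  obtains K :: "real \<times> complex \<Rightarrow> complex" where "continuous_on ({0..1} \<times> D) K"
    "\<And>x. K (0, x) = f x" "\<And>x. K (1, x) = h x"
    "\<And>t. t \<in> {0..1} \<Longrightarrow> is_homeo m (\<lambda>x. K (t, x))"
    "\<And>t z. t \<in> {0..1} \<Longrightarrow> z \<in> Q m \<Longrightarrow> K (t, z) = f z"
proof -
  from iso obtain K :: "real \<times> complex \<Rightarrow> complex"
    where contK': "continuous_map (prod_topology (top_of_set {0..1}) (top_of_set D)) (top_of_set D) K"
    and K01: "\<And>x. K (0, x) = f x" "\<And>x. K (1, x) = h x"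
    and Kh: "\<And>t. t \<in> {0..1} \<Longrightarrow> is_homeo m (\<lambda>x. K (t, x))"
    unfolding isotopic_def homotopic_with_def by blast
  from contK' have contK: "continuous_on ({0..1} \<times> D) K" by simp
  have finQ: "finite (Q m)" by (simp add: Q_def)
  have "K (t, z) = K (0, z)" if "t \<in> {0..1}" "z \<in> Q m" for t z
  proof -
    have "(\<lambda>t. K (t, z)) constant_on {0..1}"
    proof (rule continuous_finite_range_constant)
      show "continuous_on {0..1} (\<lambda>t. K (t, z))"
        by (rule continuous_on_compose2[OF contK]) (use that QD in \<open>auto intro!: continuous_intros\<close>)
      have "(\<lambda>t. K (t, z)) ` {0..1} \<subseteq> Q m"
        using that(2) Kh unfolding is_homeo_def by blast
      then show "finite ((\<lambda>t. K (t, z)) ` {0..1})" using finQ finite_subset by blast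
    qed simp
    then show ?thesis using that by (auto simp: constant_on_def)
  qed
  then show thesis using that[OF contK K01 Kh] by (simp add: K01)
qed

lemma isotopic_eq_on_Q:
  assumes "isotopic m f h" "Q m \<subseteq> D" "x \<in> Q m"
  shows "f x = h x"
  using isotopic_family[OF assms(1,2)] assms(3) by (metis atLeastAtMost_iff order_refl zero_le_one)

text \<open>A marked pair has the same image at all stages, so its difference quotient is constant
  in \<open>t\<close>, and a logarithm continuous in \<open>t\<close> cannot jump by a multiple of 2
  pi i.\<close>

lemma isotopic_diff_log:
  assumes iso: "isotopic m f h" and Lf: "diff_log (extend_by_id f) Lf" and Lh: "diff_log (extend_by_id h) Lh"
    and x: "x \<in> Q m" "y \<in> Q m" "x \<noteq> y" and QD: "Q m \<subseteq> D"
  shows "Lf (x, y) = Lh (x, y)"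
proof -
  obtain K :: "real \<times> complex \<Rightarrow> complex" where contK: "continuous_on ({0..1} \<times> D) K"
    and K01: "\<And>x. K (0, x) = f x" "\<And>x. K (1, x) = h x"
    and Kh: "\<And>t. t \<in> {0..1} \<Longrightarrow> is_homeo m (\<lambda>x. K (t, x))"
    and fixed: "\<And>t z. t \<in> {0..1} \<Longrightarrow> z \<in> Q m \<Longrightarrow> K (t, z) = f z"
    using isotopic_family[OF iso QD] by blast
  define H where "H = (\<lambda>p. if p \<in> {0..1} \<times> D then K p else snd p)"
  have agree: "K p = snd p" if "p \<in> {0..1} \<times> D" "p \<in> {0..1} \<times> closure (- D)" for p
  proof -
    have "snd p \<in> frontier D" using that closed_D by (auto simp: frontier_def interior_closure)
    then show ?thesis using Kh[of "fst p"] that by (cases p) (auto simp: is_homeo_def)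
  qed
  have "continuous_on ({0..1} \<times> D \<union> {0..1} \<times> closure (- D)) H"
    unfolding H_def using agree contK closed_D
    by (intro continuous_on_cases) (auto intro!: closed_Times continuous_intros)
  moreover have "{0..1::real} \<times> D \<union> {0..1} \<times> closure (- D) = {0..1} \<times> UNIV"
    using closure_subset[of "- D"] by blast
  ultimately have contH: "continuous_on ({0..1} \<times> UNIV) H" by simp
  have He: "(\<lambda>z. H (t, z)) = extend_by_id (\<lambda>z. K (t, z))" if "t \<in> {0..1}" for t
    using that by (auto simp: H_def extend_by_id_def)
  obtain G where G: "continuous_on ({0..1} \<times> conf) G"
    "\<And>t. t \<in> {0..1} \<Longrightarrow> diff_log (\<lambda>z. H (t, z)) (\<lambda>p. G (t, p))"
    using diff_log_family[OF contH] supported_homeo_extend_by_id[OF Kh] He by metis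
  have "G (1, (x, y)) = G (0, (x, y))"
  proof (rule continuous_log_unique[of "{0..1::real}" "\<lambda>t. G (t, (x, y))" "\<lambda>_. G (0, (x, y))" 0 1])
    show "continuous_on {0..1} (\<lambda>t. G (t, (x, y)))"
      by (rule continuous_on_compose2[OF G(1)]) (use x in \<open>auto intro!: continuous_intros\<close>)
    fix t :: real assume t: "t \<in> {0..1}"
    have "H (t, x) = H (0, x)" "H (t, y) = H (0, y)"
      using t x QD by (auto simp: H_def fixed)
    then show "exp (G (t, x, y)) = exp (G (0, x, y))"
      using G(2)[OF t] G(2)[of 0] x by (simp add: diff_log_def)
  qed auto
  moreover have "Lf (x, y) = G (0, (x, y))" "Lh (x, y) = G (1, (x, y))"
    using diff_log_unique[OF Lf _ x(3), of "\<lambda>p. G (0, p)"] diff_log_unique[OF Lh _ x(3), of "\<lambda>p. G (1, p)"]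
      G(2)[of 0] G(2)[of 1] He[of 0] He[of 1] by (simp_all add: K01)
  ultimately show ?thesis by simp
qed

section \<open>Half twists\<close>

text \<open>The path need not be closed. For an open path the winding number is a complex number
  whose real part measures the turning, and this formula is how it is evaluated below.\<close>

lemma winding_number_continuous_log:
  assumes "path p" "continuous_on {0..1} l" "\<And>t. t \<in> {0..1} \<Longrightarrow> p t - z = exp (l t)"
  shows "2 * pi * \<i> * winding_number p z = l 1 - l 0"
proof -
  have "winding_number p z = winding_number (\<lambda>t. p t - z) 0"
    by (rule winding_number_offset)
  also have "\<dots> = winding_number (exp \<circ> l) 0"
    by (rule winding_number_cong) (simp add: assms(3))
  also have "\<dots> = (l 1 - l 0) / (2 * pi * \<i>)"
    using assms(2) by (subst winding_number_compose_exp) (simp_all add: path_def pathstart_def pathfinish_def)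
  finally show ?thesis by simp
qed

lemma continuous_on_eq_0_closure:
  fixes f :: "complex \<Rightarrow> complex"
  assumes "open V" "continuous_on V f" "\<And>y. y \<in> S \<Longrightarrow> y \<in> V \<Longrightarrow> f y = 0" "y \<in> closure S" "y \<in> V"
  shows "f y = 0"
proof (rule ccontr)
  assume nz: "f y \<noteq> 0"
  have "open (V \<inter> f -` (- {0}))"
    using assms by (intro continuous_open_preimage) auto
  then have "V \<inter> f -` (- {0}) \<inter> closure S = {}"
    using assms(3) by (subst open_Int_closure_eq_empty) auto
  then show False using nz assms by auto
qed

text \<open>An inner value \<open>f 0\<close> would be taken between the parameters of -1 and 1. By
  injectivity the parameter 0 would lie there, and being the least element of the domain it would be
  one of the two.\<close>

lemma inj_interval_start:
  fixes f :: "real \<Rightarrow> real"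
  assumes f: "continuous_on {0..1} f" "inj_on f {0..1}" "f ` {0..1} = {-1..1}"
  shows "f 0 \<in> {-1, 1}"
proof (rule ccontr)
  assume "f 0 \<notin> {-1, 1}"
  moreover have "f 0 \<in> {-1..1}" using f(3) by auto
  ultimately have f0: "-1 < f 0" "f 0 < 1" by auto
  have "-1 \<in> f ` {0..1}" "1 \<in> f ` {0..1}" by (auto simp: f(3))
  then obtain t u where t: "t \<in> {0..1}" "f t = -1" and u: "u \<in> {0..1}" "f u = 1" by force
  have "connected (f ` {min t u..max t u})"
    using t u by (intro connected_continuous_image continuous_on_subset[OF f(1)]) auto
  moreover have "f t \<in> f ` {min t u..max t u}" "f u \<in> f ` {min t u..max t u}" by auto
  ultimately have "f 0 \<in> f ` {min t u..max t u}"
    by (rule connectedD_interval[of _ "f t" "f u"]) (use f0 t u in auto)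
  then obtain v where v: "v \<in> {min t u..max t u}" "f v = f 0" by auto
  have "v = 0" by (rule inj_onD[OF f(2)]) (use v t u in auto)
  then show False using v t u f0 by (auto simp: min_def split: if_splits)
qed

text \<open>\<open>half_twist\<close> identifies the core segment with the cord only as sets.
  Applied to the cord in the chart, this shows that ends correspond to ends.\<close>

lemma inj_interval_ends:
  fixes f :: "real \<Rightarrow> real"
  assumes f: "continuous_on {0..1} f" "inj_on f {0..1}" "f ` {0..1} = {-1..1}"
  shows "f 0 \<in> {-1, 1}" "f 1 = - f 0"
proof -
  have r: "(\<lambda>t. 1 - t) ` {0..1} = {0..1::real}" by (auto simp: image_iff intro!: bexI[of _ "1 - _"])
  have "continuous_on {0..1} (f \<circ> (\<lambda>t. 1 - t))" "inj_on (f \<circ> (\<lambda>t. 1 - t)) {0..1}"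
    by (intro continuous_on_compose comp_inj_on continuous_intros; use f in \<open>simp add: r inj_on_def\<close>)+
  moreover have "(f \<circ> (\<lambda>t. 1 - t)) ` {0..1} = {-1..1}"
    by (simp only: image_comp[symmetric] r f(3))
  ultimately have "f 1 \<in> {-1, 1}" using inj_interval_start by fastforce
  moreover show f0: "f 0 \<in> {-1, 1}" using inj_interval_start[OF f] .
  moreover have "f 0 \<noteq> f 1" using inj_onD[OF f(2), of 0 1] by auto
  ultimately show "f 1 = - f 0" by auto
qed

section \<open>The half twist in a chart\<close>

lemma model_twist_simps:
  "norm (model_twist s z) = norm z"
  "model_twist s (- z) = - model_twist s z"
  "model_twist (\<not> s) (model_twist s z) = z"
  "norm z = 2 \<Longrightarrow> model_twist s z = z"
  "norm z \<le> 1 \<Longrightarrow> model_twist s z = - z"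
proof -
  show norm: "norm (model_twist s z) = norm z" by (simp add: model_twist_def norm_mult)
  have "cis (- u) * (cis u * z) = z" for u
    by (simp add: mult.assoc[symmetric] cis_mult)
  from this[of "pi * min 1 (2 - norm z)"] this[of "- pi * min 1 (2 - norm z)"]
  show "model_twist (\<not> s) (model_twist s z) = z"
    unfolding model_twist_def[of "\<not> s"] norm by (simp add: model_twist_def)
  have "cis (- pi) = - 1" by (simp add: complex_eq_iff)
  then show "norm z \<le> 1 \<Longrightarrow> model_twist s z = - z" by (simp add: model_twist_def min_def)
qed (simp_all add: model_twist_def)

lemma continuous_on_model_twist: "continuous_on S (model_twist s)"
  unfolding model_twist_def cis_conv_exp by (intro continuous_intros)

lemma model_twist_polar:
  assumes "1 \<le> r" "r \<le> 2"
  shows "model_twist s (of_real r) = of_real r * cis ((if s then pi else - pi) * (2 - r))"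
  using assms by (simp add: model_twist_def min_def mult.commute)

text \<open>The clauses of \<open>half_twist\<close> in which neither the cord nor the marked points
  occur.\<close>

locale disk_twist =
  fixes N :: "complex set" and \<phi> \<psi> h :: "complex \<Rightarrow> complex" and s :: bool
  assumes N: "N \<subseteq> interior D"
    and hom: "homeomorphism (cball 0 2) N \<phi> \<psi>"
    and wind: "winding_number (\<phi> \<circ> circlepath 0 2) (\<phi> 0) = 1"
    and hN: "\<And>z. z \<in> N \<Longrightarrow> h z = \<phi> (model_twist s (\<psi> z))"
    and hC: "\<And>z. z \<notin> N \<Longrightarrow> h z = z"
begin

lemma chart:
  shows "w \<in> cball 0 2 \<Longrightarrow> \<psi> (\<phi> w) = w" "w \<in> cball 0 2 \<Longrightarrow> \<phi> w \<in> N"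
    "z \<in> N \<Longrightarrow> \<phi> (\<psi> z) = z" "z \<in> N \<Longrightarrow> \<psi> z \<in> cball 0 2"
    "continuous_on (cball 0 2) \<phi>" "continuous_on N \<psi>" "\<phi> ` cball 0 2 = N"
  using hom by (auto simp: homeomorphism_def)

lemma inj_chart: "w \<in> cball 0 2 \<Longrightarrow> w' \<in> cball 0 2 \<Longrightarrow> \<phi> w = \<phi> w' \<longleftrightarrow> w = w'"
  using chart(1) by metis

lemma h_chart: "w \<in> cball 0 2 \<Longrightarrow> h (\<phi> w) = \<phi> (model_twist s w)"
  by (simp add: hN chart)

lemma compact_N: "compact N"
  using chart(5,7) compact_continuous_image compact_cball by metis

lemma closed_N: "closed N"
  by (simp add: compact_N compact_imp_closed)

lemma open_inner: "open (\<phi> ` ball 0 2)"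
proof (rule invariance_of_domain)
  show "continuous_on (ball 0 2) \<phi>" by (rule continuous_on_subset[OF chart(5)]) auto
  show "inj_on \<phi> (ball 0 2)" by (auto simp: inj_on_def inj_chart)
qed auto

text \<open>The two formulas for \<open>h\<close> are glued along closed sets, \<open>N\<close> and
  the complement of the chart image of the open disk. That image is open by invariance of domain,
  and on the overlap the model twist is the identity.\<close>

lemma supported: "supported_homeo h"
  unfolding supported_homeo_def
proof (intro conjI allI impI)
  have mt: "model_twist s (\<psi> z) \<in> cball 0 2" if "z \<in> N" for z
    using chart(4)[OF that] by (simp add: model_twist_simps)
  have "continuous_on N (\<lambda>z. \<phi> (model_twist s (\<psi> z)))"
    by (rule continuous_on_compose2[OF chart(5)],
        rule continuous_on_compose2[OF continuous_on_model_twist[of UNIV] chart(6)])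
       (use mt in auto)
  moreover have "\<phi> (model_twist s (\<psi> z)) = z" if "z \<in> N" "z \<notin> \<phi> ` ball 0 2" for z
  proof -
    have "norm (\<psi> z) = 2"
      using that(2) chart(3,4)[OF that(1)] image_eqI[of z \<phi> "\<psi> z" "ball 0 2"]
      by (cases "norm (\<psi> z) < 2") auto
    then show ?thesis using that chart(3) by (simp add: model_twist_simps)
  qed
  ultimately have "continuous_on (N \<union> - \<phi> ` ball 0 2) (\<lambda>z. if z \<in> N then \<phi> (model_twist s (\<psi> z)) else z)"
    using closed_N open_inner by (intro continuous_on_cases) (auto simp: closed_Compl)
  moreover have "N \<union> - \<phi> ` ball 0 2 = UNIV" using chart(2) by auto
  moreover have "h = (\<lambda>z. if z \<in> N then \<phi> (model_twist s (\<psi> z)) else z)"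
    using hN hC by auto
  ultimately show "continuous_on UNIV h" by metis
  show "inj h"
  proof (rule injI)
    fix x y assume eq: "h x = h y"
    have hin: "h z \<in> N" if "z \<in> N" for z using mt[OF that] that by (simp add: hN chart)
    show "x = y"
    proof (cases "x \<in> N")
      case True
      then have y: "y \<in> N" using eq hin hC by metis
      with eq True have "\<phi> (model_twist s (\<psi> x)) = \<phi> (model_twist s (\<psi> y))" by (simp add: hN)
      then have "model_twist s (\<psi> x) = model_twist s (\<psi> y)"
        using mt[OF True] mt[OF y] inj_chart by blast
      then show ?thesis using chart(3)[OF True] chart(3)[OF y] model_twist_simps(3) by metis
    next
      case False
      then show ?thesis using eq hin hC by metis
    qed
  qed
  fix z assume "z \<notin> D"
  then show "h z = z" using hC N interior_subset by blast
qed

lemma connected_outer: "connected (- N)"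
proof (rule connected_complement_homeomorphic_convex_compact)
  show "N homeomorphic (cball 0 2 :: complex set)"
    using homeomorphism_symD[OF hom] unfolding homeomorphic_def by (intro exI)
qed auto

text \<open>Invariance of domain for \<open>\<psi>\<close>: an interior point of \<open>N\<close>
  has its coordinate in the open disk. At these boundary points logarithms on the chart are compared
  with the value 0 outside.\<close>

lemma boundary_in_closure:
  assumes "norm w = 2"
  shows "\<phi> w \<in> closure (- N)"
proof (rule ccontr)
  assume "\<phi> w \<notin> closure (- N)"
  then have w: "\<phi> w \<in> interior N" by (simp add: closure_complement)
  have "open (\<psi> ` interior N)"
  proof (rule invariance_of_domain)
    show "continuous_on (interior N) \<psi>" using chart(6) continuous_on_subset interior_subset by blast
    show "inj_on \<psi> (interior N)" using chart(3) interior_subset by (metis inj_onI subsetD)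
  qed auto
  moreover have "\<psi> ` interior N \<subseteq> cball 0 2" using chart(4) interior_subset by blast
  ultimately have "\<psi> ` interior N \<subseteq> interior (cball 0 2)" by (rule interior_maximal[rotated])
  moreover have "w \<in> \<psi> ` interior N" using w chart(1)[of w] assms by force
  ultimately show False using assms by auto
qed

context
  fixes L
  assumes L: "diff_log h L"
begin

lemma continuous_L: "continuous_on conf L"
  using L by (simp add: diff_log_def)

text \<open>Off \<open>N\<close> the map is the identity, so \<open>L\<close> vanishes there;
  continuity in each variable separately carries this to the closure, and so to the boundary circle
  of the chart.\<close>

lemma log_outer:
  assumes "x \<in> closure (- N)" "y \<in> closure (- N)" "x \<noteq> y"
  shows "L (x, y) = 0"
proof -
  note slices = continuous_on_conf_slices[OF continuous_L]
  have zero: "L (x, y) = 0" if "x \<notin> N" "y \<notin> N" "x \<noteq> y" for x y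
  proof (rule diff_log_eq_0[OF L _ connected_outer])
    show "open (- N)" using closed_N by (rule open_Compl)
    show "2 \<in> - N" "4 \<in> - N" using N interior_subset[of D] numeral_notin_D by blast+
  qed (use that hC in auto)
  have "L (x, y) = 0" if "y \<notin> N" "x \<in> closure (- N)" "x \<noteq> y" for x y
    by (rule continuous_on_eq_0_closure[OF _ slices(1)[of UNIV y], of "- N" x]) (use that zero in auto)
  then show ?thesis
    by (intro continuous_on_eq_0_closure[OF _ slices(2)[of UNIV x], of "- N" y]) (use assms in auto)
qed

text \<open>With \<open>z\<close> fixed by \<open>h\<close>, only the first point moves, and
  \<open>\<phi> w - z\<close> has a single-valued logarithm because the chart disk is
  contractible.\<close>

lemma log_inner_outer:
  assumes z: "z \<notin> N"
  obtains g where "continuous_on (cball 0 2) g"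
    "\<And>w. w \<in> cball 0 2 \<Longrightarrow> \<phi> w - z = exp (g w)"
    "\<And>w. w \<in> cball 0 2 \<Longrightarrow> L (\<phi> w, z) = g (model_twist s w) - g w"
proof -
  have nz: "\<phi> w \<noteq> z" if "w \<in> cball 0 2" for w using chart(2)[OF that] z by auto
  obtain g where g: "continuous_on (cball 0 2) g" "\<And>w. w \<in> cball 0 2 \<Longrightarrow> \<phi> w - z = exp (g w)"
  proof (rule continuous_logarithm_on_contractible[of "cball 0 2" "\<lambda>w. \<phi> w - z"])
    show "continuous_on (cball 0 2) (\<lambda>w. \<phi> w - z)" by (intro continuous_intros chart)
  qed (use nz convex_imp_contractible in auto)
  have "L (\<phi> w, z) = g (model_twist s w) - g w" if "w \<in> cball 0 2" for w
  proof (rule continuous_log_unique[of "cball 0 2" "\<lambda>w. L (\<phi> w, z)" _ 2])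
    show "continuous_on (cball 0 2) (\<lambda>w. L (\<phi> w, z))"
      by (rule continuous_on_compose2[OF continuous_L]) (use nz chart in \<open>auto intro!: continuous_intros\<close>)
    show "continuous_on (cball 0 2) (\<lambda>w. g (model_twist s w) - g w)"
      by (intro continuous_intros g continuous_on_compose2[OF g(1) continuous_on_model_twist])
         (auto simp: model_twist_simps)
    show "exp (L (\<phi> w, z)) = exp (g (model_twist s w) - g w)" if "w \<in> cball 0 2" for w
      using L nz[OF that] g(2)[OF that] g(2)[of "model_twist s w"] that
      by (simp add: diff_log_def exp_diff h_chart hC[OF z] model_twist_simps)
    \<comment> \<open>Both sides vanish at the boundary point 2, which the twist fixes; this pins
      down the constant.\<close>
    have "L (\<phi> 2, z) = 0"
      using z nz[of 2] closure_subset[of "- N"] by (intro log_outer boundary_in_closure) auto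
    then show "L (\<phi> 2, z) = g (model_twist s 2) - g 2" by (simp add: model_twist_simps)
  qed (use that in auto)
  with g show thesis using that by blast
qed

text \<open>The chart turns the vector between the images of opposite points by a half turn, because the odd
  function \<open>\<phi> w - \<phi> (- w)\<close> has winding number 1.\<close>

lemma log_core: "L (\<phi> 1, \<phi> (- 1)) = (if s then 1 else - 1) * \<i> * pi"
proof -
  define G where "G = (\<lambda>w. \<phi> w - \<phi> (- w))"
  \<comment> \<open>Polar coordinates on the outer annulus. The strip \<open>S\<close> is
    contractible, so \<open>G\<close> has a logarithm there, while on the annulus itself it has
    none.\<close>
  define E where "E = (\<lambda>p. of_real (fst p) * cis (snd p))"
  define S where "S = {1..2::real} \<times> (UNIV :: real set)"
  have E: "E p \<in> cball 0 2" "E p \<noteq> 0" if "p \<in> S" for p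
  proof -
    have "norm (E p) = fst p" using that by (auto simp: E_def S_def norm_mult)
    then show "E p \<in> cball 0 2" "E p \<noteq> 0" using that by (auto simp: S_def)
  qed
  have contE: "continuous_on T E" for T
    unfolding E_def cis_conv_exp by (intro continuous_intros)
  have Gnz: "G w \<noteq> 0" if "w \<in> cball 0 2" "w \<noteq> 0" for w
    using that inj_chart[of w "- w"] by (auto simp: G_def)
  have contG: "continuous_on (cball 0 2) G"
    unfolding G_def by (intro continuous_intros chart continuous_on_compose2[OF chart(5)]) auto
  have "convex S" unfolding S_def by (intro convex_Times) auto
  have "\<exists>K. continuous_on S K \<and> (\<forall>p\<in>S. G (E p) = exp (K p))"
  proof (rule continuous_logarithm_on_contractible)
    show "continuous_on S (\<lambda>p. G (E p))"
      by (rule continuous_on_compose2[OF contG contE]) (use E in auto)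
    show "contractible S" using \<open>convex S\<close> by (rule convex_imp_contractible)
    show "G (E p) \<noteq> 0" if "p \<in> S" for p using E[OF that] by (rule Gnz)
  qed blast
  then obtain K where K: "continuous_on S K" "\<And>p. p \<in> S \<Longrightarrow> G (E p) = exp (K p)"
    by blast
  have conS: "connected S" using \<open>convex S\<close> convex_connected by blast
  define c where "c = K (2, pi) - K (2, 0)"
  \<comment> \<open>\<open>G\<close> is odd, so shifting the angle by pi changes its sign; hence the
    increment of \<open>K\<close> is constant on the connected strip. A full turn is two such
    increments, and the winding number 1 then gives \<open>c\<close>.\<close>
  have turn: "K (r, t + pi) - K (r, t) = c" if "r \<in> {1..2}" for r t
  proof -
    have "K (r, t + pi) = K (r, t) + c"
    proof (rule continuous_log_unique[of S "\<lambda>p. K (fst p, snd p + pi)" "\<lambda>p. K p + c" "(2, 0)" "(r, t)",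
          unfolded fst_conv snd_conv])
      show "continuous_on S (\<lambda>p. K (fst p, snd p + pi))"
        by (rule continuous_on_compose2[OF K(1)]) (auto intro!: continuous_intros simp: S_def)
      have "G (E (2, pi)) = - G (E (2, 0))" by (simp add: E_def G_def)
      then have ec: "exp c = - 1"
        using K(2)[of "(2, pi)"] K(2)[of "(2, 0)"] by (simp add: c_def exp_diff S_def)
      fix p assume p: "p \<in> S"
      then have p': "(fst p, snd p + pi) \<in> S" by (auto simp: S_def)
      have "E (fst p, snd p + pi) = - E p" by (simp add: E_def cis_mult[symmetric])
      then have "G (E (fst p, snd p + pi)) = - G (E p)" by (simp add: G_def)
      then show "exp (K (fst p, snd p + pi)) = exp (K p + c)"
        using K(2)[OF p] K(2)[OF p'] by (simp add: exp_add ec)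
    qed (use that conS K(1) in \<open>auto intro!: continuous_intros simp: c_def S_def\<close>)
    then show ?thesis by simp
  qed
  have "2 * pi * \<i> * winding_number (G \<circ> circlepath 0 2) 0 = K (2, 2 * pi * 1) - K (2, 2 * pi * 0)"
  proof (rule winding_number_continuous_log)
    show "path (G \<circ> circlepath 0 2)"
      by (rule path_continuous_image) (auto intro!: continuous_on_subset[OF contG])
    show "continuous_on {0..1} (\<lambda>t. K (2, 2 * pi * t))"
      by (rule continuous_on_compose2[OF K(1)]) (auto intro!: continuous_intros simp: S_def)
    fix t :: real
    have "circlepath 0 2 t = E (2, 2 * pi * t)"
      by (simp add: circlepath E_def cis_conv_exp mult_ac)
    then show "(G \<circ> circlepath 0 2) t - 0 = exp (K (2, 2 * pi * t))"
      using K(2)[of "(2, 2 * pi * t)"] by (simp add: S_def)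
  qed
  also have "\<dots> = 2 * c"
    using turn[of 2 0] turn[of 2 pi] by (simp add: algebra_simps)
  also have "winding_number (G \<circ> circlepath 0 2) 0 = 1"
  proof -
    have "winding_number (\<lambda>t. \<phi> (circlepath 0 2 t) - \<phi> 0) 0 = 1"
      using wind by (subst (asm) winding_number_offset) (simp add: comp_def)
    \<comment> \<open>The homotopy moves the second point from the centre to the antipode of the
      first; injectivity of the chart keeps the difference nonzero.\<close>
    moreover have "homotopic_loops (- {0}) (\<lambda>t. \<phi> (circlepath 0 2 t) - \<phi> 0) (G \<circ> circlepath 0 2)"
      unfolding homotopic_loops
    proof (intro exI[of _ "\<lambda>p. \<phi> (circlepath 0 2 (snd p)) - \<phi> (- of_real (fst p) * circlepath 0 2 (snd p))"] conjI ballI)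
      have n: "norm (circlepath 0 2 t) = 2" for t by (simp add: circlepath norm_mult)
      have c: "continuous_on T (circlepath 0 2)" for T unfolding circlepath by (intro continuous_intros)
      have le: "\<bar>r\<bar> * 2 \<le> 2" if "0 \<le> r" "r \<le> 1" for r :: real using that by simp
      show "continuous_on ({0..1} \<times> {0..1}) (\<lambda>p. \<phi> (circlepath 0 2 (snd p)) - \<phi> (- of_real (fst p) * circlepath 0 2 (snd p)))"
        by (intro continuous_intros continuous_on_compose2[OF chart(5)] continuous_on_compose2[OF c[of UNIV]])
           (auto simp: n norm_mult le)
      show "(\<lambda>p. \<phi> (circlepath 0 2 (snd p)) - \<phi> (- of_real (fst p) * circlepath 0 2 (snd p))) \<in> {0..1} \<times> {0..1} \<rightarrow> - {0}"
      proof (clarsimp)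
        fix r t :: real assume r: "0 \<le> r" "r \<le> 1"
          and "\<phi> (circlepath 0 2 t) = \<phi> (- (of_real r * circlepath 0 2 t))"
        then have "circlepath 0 2 t = - of_real r * circlepath 0 2 t"
          using inj_chart[of "circlepath 0 2 t" "- of_real r * circlepath 0 2 t"] by (simp add: n norm_mult le)
        then have "(1 + of_real r) * circlepath 0 2 t = 0" by (simp add: algebra_simps eq_neg_iff_add_eq_0)
        moreover have "circlepath 0 2 t \<noteq> 0" using n[of t] by auto
        moreover have "(1 + of_real r :: complex) \<noteq> 0"
          using r by (metis add_pos_nonneg less_irrefl of_real_1 of_real_add of_real_eq_0_iff zero_less_one)
        ultimately show False by simp
      qed
    qed (auto simp: G_def pathstart_def pathfinish_def circlepath)
    ultimately show ?thesis using winding_number_homotopic_loops by metis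
  qed
  finally have c: "c = \<i> * pi" by (simp add: mult.commute)
  define u where "u = (if s then pi else - pi)"
  \<comment> \<open>The antipodal pair is followed inwards from the boundary, where \<open>L\<close>
    vanishes, to radius 1, where the model twist has turned it by \<open>u\<close>.\<close>
  have "L (\<phi> (of_real 1), \<phi> (- of_real 1)) = K (1, u * (2 - 1)) - K (1, 0)"
  proof (rule continuous_log_unique[of "{1..2}" "\<lambda>r. L (\<phi> (of_real r), \<phi> (- of_real r))" "\<lambda>r. K (r, u * (2 - r)) - K (r, 0)" 2 1])
    show "continuous_on {1..2} (\<lambda>r. L (\<phi> (of_real r), \<phi> (- of_real r)))"
      by (intro continuous_on_compose2[OF continuous_L] continuous_intros continuous_on_compose2[OF chart(5)])
         (auto simp: inj_chart)
    show "continuous_on {1..2} (\<lambda>r. K (r, u * (2 - r)) - K (r, 0))"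
      by (intro continuous_intros continuous_on_compose2[OF K(1)]) (auto simp: S_def)
    fix r :: real assume r: "r \<in> {1..2}"
    let ?r = "complex_of_real r"
    have in2: "?r \<in> cball 0 2" "- ?r \<in> cball 0 2" "?r \<noteq> - ?r" using r by auto
    have "exp (L (\<phi> ?r, \<phi> (- ?r))) = G (model_twist s ?r) / G ?r"
      using L in2 by (simp add: diff_log_def inj_chart h_chart model_twist_simps G_def)
    also have "\<dots> = G (E (r, u * (2 - r))) / G (E (r, 0))"
      using r by (simp add: E_def model_twist_polar u_def)
    finally show "exp (L (\<phi> ?r, \<phi> (- ?r))) = exp (K (r, u * (2 - r)) - K (r, 0))"
      using r by (simp add: K(2) S_def exp_diff)
  next
    have "L (\<phi> 2, \<phi> (- 2)) = 0"
      by (intro log_outer boundary_in_closure) (auto simp: inj_chart)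
    then show "L (\<phi> (of_real 2), \<phi> (- of_real 2)) = K (2, u * (2 - 2)) - K (2, 0)" by simp
  qed auto
  then show ?thesis
    using turn[of 1 0] turn[of 1 "- pi"] by (auto simp: u_def c algebra_simps eq_neg_iff_add_eq_0)
qed

end

end

text \<open>The twist exchanges the two ends of the cord, so the logarithms at \<open>a\<close> and
  \<open>b\<close> relative to a third marked point are increments along the cord in opposite
  directions. The other marked points lie off the twisted disk and do not interact.\<close>

lemma half_twist_diff_log:
  assumes tw: "half_twist m s \<gamma> h" and arc: "arc \<gamma>"
  defines "a \<equiv> pathstart \<gamma>" and "b \<equiv> pathfinish \<gamma>"
  shows "supported_homeo h" and "h a = b" and "h b = a"
    and "\<And>z. z \<in> Q m - {a, b} \<Longrightarrow> h z = z"
    and "\<And>z L. diff_log h L \<Longrightarrow> z \<in> Q m - {a, b} \<Longrightarrow> L (a, z) = 2 * pi * \<i> * winding_number \<gamma> z"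
    and "\<And>z L. diff_log h L \<Longrightarrow> z \<in> Q m - {a, b} \<Longrightarrow> L (b, z) = - (2 * pi * \<i> * winding_number \<gamma> z)"
    and "\<And>z z' L. diff_log h L \<Longrightarrow> z \<in> Q m - {a, b} \<Longrightarrow> z' \<in> Q m - {a, b} \<Longrightarrow> z \<noteq> z' \<Longrightarrow> L (z, z') = 0"
    and "\<And>L. diff_log h L \<Longrightarrow> L (a, b) = (if s then 1 else - 1) * \<i> * pi"
proof -
  obtain N \<phi> \<psi> where "N \<subseteq> interior D" and NQ: "N \<inter> Q m = {a, b}"
    and "homeomorphism (cball 0 2) N \<phi> \<psi>" "winding_number (\<phi> \<circ> circlepath 0 2) (\<phi> 0) = 1"
    and im: "\<phi> ` closed_segment (-1) 1 = path_image \<gamma>"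
    and h: "\<forall>z\<in>N. h z = \<phi> (model_twist s (\<psi> z))" "\<forall>z. z \<notin> N \<longrightarrow> h z = z"
    using tw unfolding half_twist_def a_def b_def
  proof (elim exE conjE, goal_cases)
    case (1 N \<phi> \<psi>)
    show ?case by (rule 1(1)[OF 1(2-8)])
  qed
  then interpret disk_twist N \<phi> \<psi> h s
    by (intro disk_twist.intro) simp_all
  have seg: "closed_segment (-1) 1 \<subseteq> (cball 0 2 :: complex set)"
    by (intro closed_segment_subset) auto
  have \<gamma>N: "\<gamma> t \<in> N" if "t \<in> {0..1}" for t
  proof -
    have "path_image \<gamma> \<subseteq> N" unfolding im[symmetric] chart(7)[symmetric] using seg by (rule image_mono)
    then show ?thesis using that by (auto simp: path_image_def)
  qed
  have \<psi>\<gamma>: "\<psi> (\<gamma> t) \<in> closed_segment (-1) 1" if "t \<in> {0..1}" for t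
  proof -
    have "\<gamma> t \<in> \<phi> ` closed_segment (-1) 1" unfolding im using that by (simp add: path_image_def)
    then obtain w where w: "w \<in> closed_segment (-1) 1" "\<gamma> t = \<phi> w" by blast
    moreover have "w \<in> cball 0 2" using w seg by blast
    ultimately show ?thesis using chart(1) by simp
  qed
  have cont\<gamma>: "continuous_on {0..1} \<gamma>" and inj\<gamma>: "inj_on \<gamma> {0..1}"
    using arc by (auto simp: arc_def path_def)
  have cont: "continuous_on {0..1} (\<lambda>t. \<psi> (\<gamma> t))"
    by (rule continuous_on_compose2[OF chart(6) cont\<gamma>]) (use \<gamma>N in auto)
  have seg_real: "closed_segment (-1) 1 = complex_of_real ` {-1..1}"
    using closed_segment_of_real[of "-1" 1, where ?'a = complex] by (simp add: closed_segment_eq_real_ivl)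
  have Re\<gamma>: "\<psi> (\<gamma> t) = of_real (Re (\<psi> (\<gamma> t)))" if "t \<in> {0..1}" for t
    using \<psi>\<gamma>[OF that] by (auto simp: seg_real)
  have inj: "inj_on (\<lambda>t. Re (\<psi> (\<gamma> t))) {0..1}"
  proof (rule inj_onI)
    fix t u :: real assume t: "t \<in> {0..1}" "u \<in> {0..1}" "Re (\<psi> (\<gamma> t)) = Re (\<psi> (\<gamma> u))"
    then have "\<psi> (\<gamma> t) = \<psi> (\<gamma> u)" using Re\<gamma> by metis
    then have "\<gamma> t = \<gamma> u" using \<gamma>N t chart(3) by metis
    then show "t = u" using inj\<gamma> t by (auto dest: inj_onD)
  qed
  have "(\<lambda>t. Re (\<psi> (\<gamma> t))) ` {0..1} = {-1..1}"
  proof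
    show "(\<lambda>t. Re (\<psi> (\<gamma> t))) ` {0..1} \<subseteq> {-1..1}" using \<psi>\<gamma> by (force simp: seg_real)
    show "{-1..1} \<subseteq> (\<lambda>t. Re (\<psi> (\<gamma> t))) ` {0..1}"
    proof
      fix x :: real assume "x \<in> {-1..1}"
      then have x: "of_real x \<in> closed_segment (-1) (1::complex)" by (simp add: seg_real)
      then have "\<phi> (of_real x) \<in> path_image \<gamma>" using im by blast
      then obtain t where t: "t \<in> {0..1}" "\<phi> (of_real x) = \<gamma> t" by (auto simp: path_image_def)
      then have "\<psi> (\<gamma> t) = of_real x" using x seg chart(1) by (metis subsetD)
      then show "x \<in> (\<lambda>t. Re (\<psi> (\<gamma> t))) ` {0..1}" using t by force
    qed
  qed
  note ends = inj_interval_ends[OF continuous_on_Re[OF cont] inj this]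
  have \<psi>a: "\<psi> a \<in> {-1, 1}" and \<psi>b: "\<psi> b = - \<psi> a"
    using ends Re\<gamma>[of 0] Re\<gamma>[of 1] by (auto simp: a_def b_def pathstart_def pathfinish_def)
  have ab: "a \<in> N" "b \<in> N" using NQ by auto
  have mt: "model_twist s (\<psi> a) = \<psi> b" "model_twist s (\<psi> b) = \<psi> a"
    using \<psi>a by (auto simp: \<psi>b model_twist_simps)
  show "supported_homeo h" by (rule supported)
  show "h a = b" "h b = a" using ab by (auto simp: hN mt chart)
  show "h z = z" if "z \<in> Q m - {a, b}" for z using that NQ hC by auto
  fix L assume L: "diff_log h L"
  have *: "L (a, z) = 2 * pi * \<i> * winding_number \<gamma> z \<and> L (b, z) = - (2 * pi * \<i> * winding_number \<gamma> z)"
    if z: "z \<in> Q m - {a, b}" for z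
  proof -
    have "z \<notin> N" using z NQ by auto
    then obtain g where g: "continuous_on (cball 0 2) g"
      "\<And>w. w \<in> cball 0 2 \<Longrightarrow> \<phi> w - z = exp (g w)"
      "\<And>w. w \<in> cball 0 2 \<Longrightarrow> L (\<phi> w, z) = g (model_twist s w) - g w"
      using log_inner_outer[OF L] by metis
    have "2 * pi * \<i> * winding_number \<gamma> z = g (\<psi> (\<gamma> 1)) - g (\<psi> (\<gamma> 0))"
    proof (rule winding_number_continuous_log)
      show "path \<gamma>" using arc by (simp add: arc_def)
      show "continuous_on {0..1} (\<lambda>t. g (\<psi> (\<gamma> t)))"
        by (rule continuous_on_compose2[OF g(1) cont]) (use \<gamma>N chart(4) in auto)
      show "\<gamma> t - z = exp (g (\<psi> (\<gamma> t)))" if "t \<in> {0..1}" for t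
        using g(2)[OF chart(4)[OF \<gamma>N[OF that]]] chart(3)[OF \<gamma>N[OF that]] by simp
    qed
    also have "\<dots> = g (\<psi> b) - g (\<psi> a)" by (simp add: a_def b_def pathstart_def pathfinish_def)
    finally show ?thesis
      using g(3)[OF chart(4)[OF ab(1)]] g(3)[OF chart(4)[OF ab(2)]] ab by (simp add: chart mt)
  qed
  show "L (a, z) = 2 * pi * \<i> * winding_number \<gamma> z" if "z \<in> Q m - {a, b}" for z
    using *[OF that] by simp
  show "L (b, z) = - (2 * pi * \<i> * winding_number \<gamma> z)" if "z \<in> Q m - {a, b}" for z
    using *[OF that] by simp
  show "L (z, z') = 0" if "z \<in> Q m - {a, b}" "z' \<in> Q m - {a, b}" "z \<noteq> z'" for z z'
    using that NQ closure_subset[of "- N"] by (intro log_outer[OF L]) auto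
  \<comment> \<open>\<open>half_twist\<close> leaves open which end corresponds to 1; both choices
    agree by the symmetry of \<open>L\<close>.\<close>
  have "L (a, b) = L (\<phi> 1, \<phi> (- 1))"
  proof (cases "\<psi> a = 1")
    case True
    then show ?thesis using chart(3)[OF ab(1)] chart(3)[OF ab(2)] \<psi>b by simp
  next
    case False
    then have "\<phi> (- 1) = a" "\<phi> 1 = b"
      using chart(3)[OF ab(1)] chart(3)[OF ab(2)] \<psi>a \<psi>b by auto
    moreover have "a \<noteq> b" using \<psi>a \<psi>b by auto
    ultimately show ?thesis using diff_log_commute[OF supported L] by metis
  qed
  then show "L (a, b) = (if s then 1 else - 1) * \<i> * pi" using log_core[OF L] by simp
qed

section \<open>Crossing numbers of words\<close>

text \<open>The abelianization of the braid group, here the invariant that separates positive from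
  negative simple braids.\<close>

definition exponent_sum :: "braid_word \<Rightarrow> int"
  where "exponent_sum w = (\<Sum>c\<leftarrow>w. if snd c then 1 else - 1)"

lemma exponent_sum_append: "exponent_sum (u @ v) = exponent_sum u + exponent_sum v"
  by (simp add: exponent_sum_def)

lemma exponent_sum_braid_eq: "braid_eq m u v \<Longrightarrow> exponent_sum u = exponent_sum v"
proof (induction rule: braid_eq.induct)
  case (cancel k s)
  then show ?case by (cases s) (simp_all add: exponent_sum_def)
qed (simp_all add: exponent_sum_append exponent_sum_def)

lemma inv_braid_class:
  assumes "w \<in> braid_words m"
  shows "rev (map (apsnd Not) w) \<in> braid_words m"
    and "inv\<^bsub>braid_group m\<^esub> (braid_class m w) = braid_class m (rev (map (apsnd Not) w))"
proof -
  interpret group "braid_group m" by (rule group_braid_group)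
  show r: "rev (map (apsnd Not) w) \<in> braid_words m"
    using assms by (induction w) auto
  show "inv\<^bsub>braid_group m\<^esub> (braid_class m w) = braid_class m (rev (map (apsnd Not) w))"
    by (rule inv_equality)
       (use assms r braid_eq_inverse_word[OF assms] in
        \<open>auto simp: carrier_braid_group one_braid_group braid_class_mult braid_class_eq_iff\<close>)
qed

lemma exponent_sum_inverse: "exponent_sum (rev (map (apsnd Not) w)) = - exponent_sum w"
  by (induction w) (simp_all add: exponent_sum_def)

lemma positive_simple_exponent_sum:
  assumes "positive_simple m (braid_class m w)" "w \<in> braid_words m"
  shows "exponent_sum w = 1"
proof -
  obtain t k where t: "t \<in> braid_words m" "k \<in> {1..<m}"
    and w: "braid_class m w = braid_class m t \<otimes>\<^bsub>braid_group m\<^esub> \<sigma> m k \<otimes>\<^bsub>braid_group m\<^esub> inv\<^bsub>braid_group m\<^esub> (braid_class m t)"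
    using assms(1) unfolding positive_simple_def carrier_braid_group by blast
  have "braid_class m w = braid_class m ((t @ [(k, True)]) @ rev (map (apsnd Not) t))"
    using t inv_braid_class[OF t(1)] unfolding w \<sigma>_def by (simp add: braid_class_mult)
  then have "braid_eq m w ((t @ [(k, True)]) @ rev (map (apsnd Not) t))"
    using assms(2) t inv_braid_class[OF t(1)] by (subst (asm) braid_class_eq_iff) auto
  from exponent_sum_braid_eq[OF this] show ?thesis
    unfolding exponent_sum_append exponent_sum_inverse by (simp add: exponent_sum_def)
qed

lemma negative_simple_exponent_sum:
  assumes "negative_simple m (braid_class m w)" "w \<in> braid_words m"
  shows "exponent_sum w = - 1"
proof -
  obtain t k where t: "t \<in> braid_words m" "k \<in> {1..<m}"
    and w: "braid_class m w = braid_class m t \<otimes>\<^bsub>braid_group m\<^esub> inv\<^bsub>braid_group m\<^esub> (\<sigma> m k) \<otimes>\<^bsub>braid_group m\<^esub> inv\<^bsub>braid_group m\<^esub> (braid_class m t)"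
    using assms(1) unfolding negative_simple_def carrier_braid_group by blast
  have "braid_class m w = braid_class m ((t @ [(k, False)]) @ rev (map (apsnd Not) t))"
    using t inv_braid_class[OF t(1)] inv_braid_class(2)[of "[(k, True)]" m]
    unfolding w \<sigma>_def by (simp add: braid_class_mult)
  then have "braid_eq m w ((t @ [(k, False)]) @ rev (map (apsnd Not) t))"
    using assms(2) t inv_braid_class[OF t(1)] by (subst (asm) braid_class_eq_iff) auto
  from exponent_sum_braid_eq[OF this] show ?thesis
    unfolding exponent_sum_append exponent_sum_inverse by (simp add: exponent_sum_def)
qed

text \<open>\<open>is_cord_of\<close> chooses the sign of the half twist by a disjunction.
  Exclusiveness identifies that sign with the one in the clause of the theorem.\<close>

lemma not_positive_and_negative_simple:
  assumes "w \<in> braid_words m"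
  shows "\<not> (positive_simple m (braid_class m w) \<and> negative_simple m (braid_class m w))"
  using positive_simple_exponent_sum[of m w] negative_simple_exponent_sum[of m w] assms by auto

text \<open>The logarithm is symmetric in the pair and does not see which string is over, so only
  this symmetrised entry can be read off from it.\<close>

definition total_crossings :: "braid_word \<Rightarrow> nat \<Rightarrow> nat \<Rightarrow> int"
  where "total_crossings w a b = word_crossings id w a b + word_crossings id w b a"

lemma bij_word_perm: "bij (word_perm w)"
proof (induction w)
  case (Cons c w)
  have "bij (transpose (fst c) (Suc (fst c)))" by simp
  with Cons.IH show ?case unfolding word_perm.simps by (rule bij_comp)
qed (simp only: word_perm.simps bij_id)

lemma word_crossings_relabel:
  "bij p \<Longrightarrow> word_crossings (p \<circ> r) w (p a) (p b) = word_crossings r w a b"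
proof (induction w arbitrary: r)
  case (Cons c w)
  have "inj p" using Cons.prems by (simp add: bij_is_inj)
  then show ?case
    by (simp only: word_crossings.simps Let_def o_assoc[symmetric] Cons.IH[OF Cons.prems])
       (simp add: inj_eq)
qed simp

lemma total_crossings_Nil: "total_crossings [] a b = 0"
  by (simp add: total_crossings_def)

text \<open>The string that enters \<open>w\<close> at position \<open>a\<close> starts at position
  \<open>t a\<close> of the longer word, hence the arguments on the left;
  \<open>word_crossings_relabel\<close> changes the labels back.\<close>

lemma total_crossings_Cons:
  fixes k :: nat
  defines "t \<equiv> transpose k (Suc k)"
  shows "total_crossings ((k, s) # w) (t a) (t b) =
    (if s then 1 else - 1) * of_bool ({a, b} = {k, Suc k}) + total_crossings w a b"
proof -
  have "bij t" by (simp add: t_def)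
  from word_crossings_relabel[OF this, of id w]
  have *: "word_crossings t w (t a) (t b) = word_crossings id w a b" for a b by simp
  have t: "t x = k \<longleftrightarrow> x = Suc k" "t x = Suc k \<longleftrightarrow> x = k" for x
    by (auto simp: t_def Transposition.transpose_def)
  show ?thesis
    unfolding total_crossings_def
    by (simp add: Let_def * t flip: t_def) (auto simp: doubleton_eq_iff)
qed

text \<open>Between two strings the over-crossings alternate: whenever \<open>a\<close> passes from the left of \<open>b\<close> to its
  right, the crossing is either positive with \<open>b\<close> over or negative with \<open>a\<close> over.\<close>

lemma word_crossings_diff:
  assumes "inj p" "x \<noteq> y"
  shows "word_crossings p w (p y) (p x) - word_crossings p w (p x) (p y)
     = of_bool (x < y) - of_bool (inv_into UNIV (word_perm w) x < inv_into UNIV (word_perm w) y)"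
  using assms
proof (induction w arbitrary: p x y)
  case Nil
  then show ?case by simp
next
  case (Cons c w)
  obtain k s where c: "c = (k, s)" by (cases c)
  define t where "t = transpose k (Suc k)"
  have t: "bij t" "t (t z) = z" for z by (simp_all add: t_def)
  have inj: "inj (p \<circ> t)" using Cons.prems t by (simp add: bij_is_inj inj_compose)
  have ne: "t x \<noteq> t y" using Cons.prems by (simp add: inj_eq[OF bij_is_inj[OF t(1)]])
  have IH: "word_crossings (p \<circ> t) w (p y) (p x) - word_crossings (p \<circ> t) w (p x) (p y)
     = of_bool (t x < t y) - of_bool (inv_into UNIV (word_perm w) (t x) < inv_into UNIV (word_perm w) (t y))"
    using Cons.IH[OF inj ne] by (simp only: o_def t(2))
  have i: "inv_into UNIV (word_perm (c # w)) z = inv_into UNIV (word_perm w) (t z)" for z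
    using bij_word_perm[of w] t
    by (simp add: c flip: t_def) (simp add: o_inv_distrib t_def)
  \<comment> \<open>A crossing of either sign contributes exactly the change of order that it
    causes, and the tail contributes the later changes, so the order terms telescope.\<close>
  have "word_crossings p (c # w) (p y) (p x) - word_crossings p (c # w) (p x) (p y)
    = of_bool (x < y) - of_bool (t x < t y)
      + (word_crossings (p \<circ> t) w (p y) (p x) - word_crossings (p \<circ> t) w (p x) (p y))"
    using Cons.prems
    by (simp add: c Let_def inj_eq[OF Cons.prems(1)] flip: t_def)
       (auto simp: t_def Transposition.transpose_def)
  then show ?case unfolding IH i by linarith
qed

text \<open>Adding the total and the difference from \<open>word_crossings_diff\<close> isolates one
  entry, with a factor 2.\<close>

lemma word_crossings_eq_total:
  assumes "x \<noteq> y"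
  shows "2 * word_crossings id w y x =
    total_crossings w x y + of_bool (x < y) - of_bool (inv_into UNIV (word_perm w) x < inv_into UNIV (word_perm w) y)"
  using word_crossings_diff[of id x y w] assms by (simp add: total_crossings_def)

lemma word_crossings_same: "inj p \<Longrightarrow> word_crossings p w a a = 0"
proof (induction w arbitrary: p)
  case (Cons c w)
  have "inj (p \<circ> transpose (fst c) (Suc (fst c)))"
    using Cons.prems by (simp add: inj_compose)
  with Cons show ?case by (auto simp: Let_def inj_eq)
qed simp

section \<open>Marked points and the mapping classes of words\<close>

lemma q_inject: "q m a = q m b \<longleftrightarrow> a = b"
  by (simp add: q_def field_simps)

lemma q_diff: "q m a - q m b = of_real ((real a - real b) / real (m + 1))"
  by (simp add: q_def complex_eq_iff diff_divide_distrib)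

lemma Q_subset_interior: "Q m \<subseteq> interior D"
proof -
  have "interior D = box 0 (Complex 1 1)" by (simp add: D_cbox interior_cbox)
  moreover have "q m k \<in> box 0 (Complex 1 1)" if "k \<in> {1..m}" for k
    using that by (simp add: q_def in_box_complex_iff)
  ultimately show ?thesis unfolding Q_def by blast
qed

lemma Q_subset_D: "Q m \<subseteq> D"
  using Q_subset_interior interior_subset by blast

text \<open>Along a ray from \<open>z\<close> only the modulus of \<open>p t - z\<close> changes,
  and it enters the imaginary part of the winding number.\<close>

lemma Re_winding_number_ray:
  assumes "path p" "c \<noteq> 0" "continuous_on {0..1} r" "\<And>t. t \<in> {0..1} \<Longrightarrow> 0 < r t"
    and p: "\<And>t. t \<in> {0..1} \<Longrightarrow> p t - z = c * of_real (r t)"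
  shows "Re (winding_number p z) = 0"
proof -
  have "2 * pi * \<i> * winding_number p z = (Ln c + of_real (ln (r 1))) - (Ln c + of_real (ln (r 0)))"
  proof (rule winding_number_continuous_log[OF assms(1)])
    show "continuous_on {0..1} (\<lambda>t. Ln c + of_real (ln (r t)))"
      using assms(3,4) by (intro continuous_intros) force+
    show "p t - z = exp (Ln c + of_real (ln (r t)))" if "t \<in> {0..1}" for t
      using p[OF that] assms(4)[OF that] \<open>c \<noteq> 0\<close> by (simp add: exp_add exp_of_real)
  qed
  then have "Im (2 * pi * \<i> * winding_number p z) = 0" by simp
  then show ?thesis by simp
qed

lemma Re_winding_number_generator:
  assumes "y \<noteq> k" "y \<noteq> Suc k"
  shows "Re (winding_number (linepath (q m k) (q m (Suc k))) (q m y)) = 0"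
proof (rule Re_winding_number_ray)
  define c :: real where "c = (if y < k then 1 else - 1)"
  define r where "r = (\<lambda>t. c * (real k + t - real y) / real (m + 1))"
  show "complex_of_real c \<noteq> 0" by (simp add: c_def)
  show "continuous_on {0..1} r" unfolding r_def by (intro continuous_intros) auto
  fix t :: real assume t: "t \<in> {0..1}"
  have "0 < c * (real k + t - real y)" using assms t by (auto simp: c_def)
  then show "0 < r t" by (simp add: r_def)
  have "c * r t = (real k + t - real y) / real (m + 1)" by (simp add: r_def c_def)
  moreover have "linepath (q m k) (q m (Suc k)) t - q m y = of_real ((real k + t - real y) / real (m + 1))"
  proof -
    have "linepath (q m k) (q m (Suc k)) t - q m y = (q m k - q m y) + of_real t * (q m (Suc k) - q m k)"
      by (simp add: linepath_def scaleR_conv_of_real algebra_simps)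
    then show ?thesis
      by (simp only: q_diff flip: of_real_add of_real_mult) (simp add: diff_divide_distrib add_divide_distrib)
  qed
  ultimately show "linepath (q m k) (q m (Suc k)) t - q m y = of_real c * of_real (r t)"
    by (metis of_real_mult)
qed auto

lemma word_perm_permutes: "w \<in> braid_words m \<Longrightarrow> a \<in> {1..m} \<Longrightarrow> word_perm w a \<in> {1..m}"
  by (induction w) (auto simp: Transposition.transpose_def)

lemma isotopic_is_homeo: "isotopic m f h \<Longrightarrow> is_homeo m f \<and> is_homeo m h"
  unfolding isotopic_def using homotopic_with_imp_property by blast

lemma word_homeo_is_homeo: "word_homeo m w h \<Longrightarrow> is_homeo m h"
  using isotopic_is_homeo by (cases w) auto

text \<open>The marked points lie on one line, so from a third one the segment of a generator is
  seen in a constant direction. Hence only the exchanged pair contributes.\<close>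

lemma generator_diff_log:
  assumes tw: "half_twist m s (linepath (q m k) (q m (Suc k))) f" and k: "k \<in> {1..<m}"
  shows "supported_homeo f"
    and "x \<in> {1..m} \<Longrightarrow> f (q m x) = q m (transpose k (Suc k) x)"
    and "diff_log f L \<Longrightarrow> x \<in> {1..m} \<Longrightarrow> y \<in> {1..m} \<Longrightarrow> x \<noteq> y \<Longrightarrow>
      Im (L (q m x, q m y)) = pi * ((if s then 1 else - 1) * of_bool ({x, y} = {k, Suc k}))"
proof -
  have arc: "arc (linepath (q m k) (q m (Suc k)))" by (simp add: q_inject)
  note ht = half_twist_diff_log[OF tw arc, unfolded pathstart_linepath pathfinish_linepath]
  have inQ: "q m x \<in> Q m - {q m k, q m (Suc k)}" if "x \<in> {1..m}" "x \<noteq> k" "x \<noteq> Suc k" for x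
    using that by (auto simp: Q_def q_inject)
  show supp: "supported_homeo f" by (rule ht(1))
  show "f (q m x) = q m (transpose k (Suc k) x)" if "x \<in> {1..m}" for x
    using ht(2,3) ht(4)[OF inQ[OF that]] by (auto simp: Transposition.transpose_def)
  assume L: "diff_log f L" and x: "x \<in> {1..m}" and y: "y \<in> {1..m}" and ne: "x \<noteq> y"
  have sym: "L (q m x, q m y) = L (q m y, q m x)" for x y
    using diff_log_commute[OF supp L, of "q m x" "q m y"] by (cases "q m x = q m y") auto
  have 0: "Im (L (q m u, q m v)) = 0" if "u \<in> {k, Suc k}" "v \<in> {1..m}" "v \<notin> {k, Suc k}" for u v
    using that ht(5)[OF L inQ[of v]] ht(6)[OF L inQ[of v]] Re_winding_number_generator[of v k m] by auto
  consider "{x, y} = {k, Suc k}" | "x \<in> {k, Suc k}" "y \<notin> {k, Suc k}"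
    | "x \<notin> {k, Suc k}" "y \<in> {k, Suc k}" | "x \<notin> {k, Suc k}" "y \<notin> {k, Suc k}"
    using ne by auto
  then show "Im (L (q m x, q m y)) = pi * ((if s then 1 else - 1) * of_bool ({x, y} = {k, Suc k}))"
  proof cases
    case 1
    then have "L (q m x, q m y) = L (q m k, q m (Suc k))"
      using sym by (auto simp: doubleton_eq_iff)
    then show ?thesis using ht(8)[OF L] 1 by simp
  next
    case 2
    then have "{x, y} \<noteq> {k, Suc k}" by auto
    then show ?thesis using 2 0[of x y] y by simp
  next
    case 3
    then have "{x, y} \<noteq> {k, Suc k}" by auto
    then show ?thesis using 3 0[of y x] x sym[of x y] by simp
  next
    case 4
    then have "{x, y} \<noteq> {k, Suc k}" by auto
    then show ?thesis using ht(7)[OF L inQ[of x] inQ[of y]] 4 x y ne by (simp add: q_inject)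
  qed
qed

lemma q_in_Q: "a \<in> {1..m} \<Longrightarrow> q m a \<in> Q m"
  by (simp add: Q_def)

lemma word_homeo_q:
  assumes "word_homeo m w h" "w \<in> braid_words m" "a \<in> {1..m}"
  shows "h (q m a) = q m (word_perm w a)"
  using assms(1,2)
proof (induction w arbitrary: h)
  case Nil
  then have "isotopic m id h" by simp
  from isotopic_eq_on_Q[OF this Q_subset_D q_in_Q[OF assms(3)]] show ?case by simp
next
  case (Cons c w)
  obtain k s where c: "c = (k, s)" by (cases c)
  from Cons.prems c obtain f g where fg: "half_twist m s (linepath (q m k) (q m (Suc k))) f"
    "word_homeo m w g" "isotopic m (f \<circ> g) h" and k: "k \<in> {1..<m}" and w: "w \<in> braid_words m"
    by auto
  have "h (q m a) = f (g (q m a))"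
    using isotopic_eq_on_Q[OF fg(3) Q_subset_D q_in_Q[OF assms(3)]] by simp
  also have "\<dots> = q m (word_perm (c # w) a)"
    using Cons.IH[OF fg(2) w] generator_diff_log(2)[OF fg(1) k word_perm_permutes[OF w assms(3)]]
    by (simp add: c)
  finally show ?case .
qed

text \<open>The logarithm of a generator counts its crossing, and composition of mapping classes corresponds
  to stacking of diagrams, so the logarithm of a braid is its total crossing number. As \<^term>\<open>h\<close>
  carries bottom to top positions, it belongs to the strings ending at \<open>a\<close> and \<open>b\<close>.\<close>

lemma word_homeo_diff_log:
  assumes "word_homeo m w h" "w \<in> braid_words m" "diff_log (extend_by_id h) L"
    and ab: "a \<in> {1..m}" "b \<in> {1..m}" "a \<noteq> b"
  shows "Im (L (q m a, q m b)) = pi * total_crossings w (word_perm w a) (word_perm w b)"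
  using assms(1-3)
proof (induction w arbitrary: h L)
  case Nil
  have "extend_by_id id = id" by (auto simp: extend_by_id_def)
  then have "diff_log (extend_by_id id) (\<lambda>_. 0)" by (simp add: diff_log_id)
  from isotopic_diff_log[OF _ this Nil.prems(3) q_in_Q[OF ab(1)] q_in_Q[OF ab(2)] _ Q_subset_D] Nil.prems
  have "0 = L (q m a, q m b)" using ab(3) by (simp add: q_inject)
  then show ?case by (simp add: total_crossings_Nil flip: \<open>0 = _\<close>)
next
  case (Cons c w)
  obtain k s where c: "c = (k, s)" by (cases c)
  from Cons.prems c obtain f g where fg: "half_twist m s (linepath (q m k) (q m (Suc k))) f"
    "word_homeo m w g" "isotopic m (f \<circ> g) h" and k: "k \<in> {1..<m}" and w: "w \<in> braid_words m"
    by auto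
  let ?a = "word_perm w a" and ?b = "word_perm w b"
  have pq: "?a \<in> {1..m}" "?b \<in> {1..m}" "?a \<noteq> ?b"
    using word_perm_permutes[OF w] ab bij_word_perm[of w] by (auto dest: bij_is_inj injD)
  note gen = generator_diff_log[OF fg(1) k]
  have suppg: "supported_homeo (extend_by_id g)"
    using supported_homeo_extend_by_id[OF word_homeo_is_homeo[OF fg(2)]] .
  obtain Lf Lg where Lf: "diff_log f Lf" and Lg: "diff_log (extend_by_id g) Lg"
    using diff_log_exists[OF gen(1)] diff_log_exists[OF suppg] by metis
  \<comment> \<open>A half twist is the identity off the disk, so only \<open>g\<close> has to be
    extended.\<close>
  have "extend_by_id (f \<circ> g) = f \<circ> extend_by_id g"
    using gen(1) by (auto simp: extend_by_id_def supported_homeo_def)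
  with diff_log_compose[OF gen(1) Lf suppg Lg]
  have "diff_log (extend_by_id (f \<circ> g)) (\<lambda>(x, y). Lf (extend_by_id g x, extend_by_id g y) + Lg (x, y))" by simp
  from isotopic_diff_log[OF fg(3) this Cons.prems(3) q_in_Q[OF ab(1)] q_in_Q[OF ab(2)] _ Q_subset_D]
  have "L (q m a, q m b) = Lf (extend_by_id g (q m a), extend_by_id g (q m b)) + Lg (q m a, q m b)"
    using ab(3) by (simp add: q_inject)
  also have "extend_by_id g (q m a) = q m ?a"
    using word_homeo_q[OF fg(2) w ab(1)] q_in_Q[OF ab(1)] Q_subset_D[of m] by (auto simp: extend_by_id_def)
  also have "extend_by_id g (q m b) = q m ?b"
    using word_homeo_q[OF fg(2) w ab(2)] q_in_Q[OF ab(2)] Q_subset_D[of m] by (auto simp: extend_by_id_def)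
  finally have "Im (L (q m a, q m b)) =
      pi * ((if s then 1 else - 1) * of_bool ({?a, ?b} = {k, Suc k})) + pi * total_crossings w ?a ?b"
    using Cons.IH[OF fg(2) w Lg] gen(3)[OF Lf pq] by simp
  also have "\<dots> = pi * total_crossings (c # w) (word_perm (c # w) a) (word_perm (c # w) b)"
    by (simp add: c total_crossings_Cons algebra_simps)
  finally show ?case .
qed

text \<open>The logarithm of \<open>\<i> * z\<close> has its cut along the upward ray, where the segments from \<^term>\<open>q0\<close> never
  go.\<close>

lemma winding_number_spoke:
  assumes "i \<noteq> k"
  shows "q m k \<notin> path_image (linepath q0 (q m i))"
    and "2 * pi * Re (winding_number (linepath q0 (q m i)) (q m k)) =
      (if k < i then pi / 2 else - pi / 2) - Im (Ln (\<i> * (q0 - q m k)))"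
proof -
  let ?p = "linepath q0 (q m i)"
  \<comment> \<open>The spoke stays strictly below the line of marked points until its end.
    Multiplication by \<open>\<i>\<close> puts it into the right half plane, except for the end,
    which is treated separately.\<close>
  have Im: "Im (?p t - q m k) = (t - 1) / 2" for t
    by (simp add: linepath_def q0_def q_def algebra_simps)
  have p1: "?p 1 - q m k = of_real ((real i - real k) / real (m + 1))"
    using q_diff[of m i k] by (simp add: linepath_def)
  have ik: "(real i - real k) / real (m + 1) \<noteq> 0" using assms by simp
  have cut: "\<i> * (?p t - q m k) \<notin> \<real>\<^sub>\<le>\<^sub>0" if "t \<in> {0..1}" for t
  proof (cases "t = 1")
    case True
    then show ?thesis using ik unfolding True p1 by (simp add: complex_nonpos_Reals_iff)
  next
    case False
    then have "Re (\<i> * (?p t - q m k)) > 0" using that Im[of t] by simp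
    then show ?thesis unfolding complex_nonpos_Reals_iff by linarith
  qed
  then show "q m k \<notin> path_image ?p" by (force simp: path_image_def)
  have "2 * pi * \<i> * winding_number ?p (q m k) =
      (Ln (\<i> * (?p 1 - q m k)) - \<i> * (pi / 2)) - (Ln (\<i> * (?p 0 - q m k)) - \<i> * (pi / 2))"
  proof (rule winding_number_continuous_log)
    show "continuous_on {0..1} (\<lambda>t. Ln (\<i> * (?p t - q m k)) - \<i> * (pi / 2))"
      using cut by (intro continuous_intros) (auto intro: continuous_on_linepath)
    fix t :: real assume t: "t \<in> {0..1}"
    have "exp (\<i> * (pi / 2)) = \<i>" using cis_pi_half by (simp add: cis_conv_exp)
    moreover have "\<i> * (?p t - q m k) \<noteq> 0" using cut[OF t] by auto
    ultimately show "?p t - q m k = exp (Ln (\<i> * (?p t - q m k)) - \<i> * (pi / 2))"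
      by (simp add: exp_diff)
  qed auto
  then have "Im (2 * pi * \<i> * winding_number ?p (q m k)) =
      Im (Ln (\<i> * (?p 1 - q m k))) - Im (Ln (\<i> * (?p 0 - q m k)))"
    by simp
  also have "Im (Ln (\<i> * (?p 1 - q m k))) = (if k < i then pi / 2 else - pi / 2)"
  proof (cases "k < i")
    case True
    define r where "r = (real i - real k) / real (m + 1)"
    have "0 < r" using True by (simp add: r_def)
    then show ?thesis using True unfolding p1 r_def[symmetric] by (simp add: Ln_times_of_real Ln_times_simple mult.commute)
  next
    case False
    define r where "r = (real k - real i) / real (m + 1)"
    have "0 < r" using False assms by (simp add: r_def)
    have "\<i> * of_real ((real i - real k) / real (m + 1)) = of_real r * (- \<i>)"
      by (simp add: r_def diff_divide_distrib algebra_simps)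
    moreover have "Im (Ln (of_real r * (- \<i>))) = - pi / 2"
      using \<open>0 < r\<close> by (subst Ln_times_of_real) auto
    ultimately show ?thesis using False unfolding p1 by (simp only: if_False)
  qed
  \<comment> \<open>The subtracted term depends on \<open>k\<close> only and not on
    \<open>i\<close>, so it cancels in the difference of two spokes.\<close>
  finally show "2 * pi * Re (winding_number ?p (q m k)) =
      (if k < i then pi / 2 else - pi / 2) - Im (Ln (\<i> * (q0 - q m k)))"
    by (simp add: linepath_0')
qed

text \<open>The spokes have a common start, so their difference is governed by the directions in
  which their ends are seen from \<open>q m k\<close>. These are opposite exactly when
  \<open>k\<close> lies between \<open>i\<close> and \<open>j\<close>, which costs half a
  turn.\<close>

lemma closed_cord_winding:
  assumes c: "is_cord m i j \<gamma>" and ij: "i < j" and k: "k \<in> {1..m}" "k \<noteq> i" "k \<noteq> j"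
  shows "path (closed_cord m i j \<gamma>)"
    and "pathfinish (closed_cord m i j \<gamma>) = pathstart (closed_cord m i j \<gamma>)"
    and "q m k \<notin> path_image (closed_cord m i j \<gamma>)"
    and "2 * Re (winding_number (closed_cord m i j \<gamma>) (q m k)) =
      2 * Re (winding_number \<gamma> (q m k)) - of_bool (i < k \<and> k < j)"
proof -
  have \<gamma>: "path \<gamma>" "pathstart \<gamma> = q m i" "pathfinish \<gamma> = q m j"
    "path_image \<gamma> \<subseteq> (interior D - Q m) \<union> {q m i, q m j}"
    using c by (auto simp: is_cord_def arc_def)
  have "q m k \<notin> path_image \<gamma>"
    using \<gamma>(4) k q_in_Q[OF k(1)] by (auto simp: q_inject subset_iff)
  note avoid = winding_number_spoke(1)[OF k(2)[symmetric], of m]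
    winding_number_spoke(1)[OF k(3)[symmetric], of m] this
  show "path (closed_cord m i j \<gamma>)" "pathfinish (closed_cord m i j \<gamma>) = pathstart (closed_cord m i j \<gamma>)"
    using \<gamma> by (auto simp: closed_cord_def)
  show "q m k \<notin> path_image (closed_cord m i j \<gamma>)"
    using avoid \<gamma> by (simp add: closed_cord_def path_image_join closed_segment_commute[of "q m j" q0])
  have "winding_number (reversepath (linepath q0 (q m j))) (q m k) = - winding_number (linepath q0 (q m j)) (q m k)"
    using avoid(2) by (intro winding_number_reversepath) auto
  then have "winding_number (closed_cord m i j \<gamma>) (q m k) = winding_number (linepath q0 (q m i)) (q m k)
      + (winding_number \<gamma> (q m k) - winding_number (linepath q0 (q m j)) (q m k))"
    using avoid \<gamma> unfolding closed_cord_def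
    by (subst winding_number_join; simp add: winding_number_join path_image_join closed_segment_commute[of "q m j" q0])
  then have e: "Re (winding_number (closed_cord m i j \<gamma>) (q m k)) = Re (winding_number (linepath q0 (q m i)) (q m k))
      + (Re (winding_number \<gamma> (q m k)) - Re (winding_number (linepath q0 (q m j)) (q m k)))"
    by simp
  have "2 * pi * Re (winding_number (closed_cord m i j \<gamma>) (q m k)) =
      2 * pi * Re (winding_number (linepath q0 (q m i)) (q m k)) + 2 * pi * Re (winding_number \<gamma> (q m k))
      - 2 * pi * Re (winding_number (linepath q0 (q m j)) (q m k))"
    unfolding e by (simp add: algebra_simps)
  also have "\<dots> = pi * (2 * Re (winding_number \<gamma> (q m k)) - of_bool (i < k \<and> k < j))"
    unfolding winding_number_spoke(2)[OF k(2)[symmetric]] winding_number_spoke(2)[OF k(3)[symmetric]]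
    using ij k(2,3) by (auto simp: algebra_simps)
  finally have "pi * (2 * Re (winding_number (closed_cord m i j \<gamma>) (q m k))) =
      pi * (2 * Re (winding_number \<gamma> (q m k)) - of_bool (i < k \<and> k < j))"
    by (simp only: mult_ac)
  then show "2 * Re (winding_number (closed_cord m i j \<gamma>) (q m k)) =
      2 * Re (winding_number \<gamma> (q m k)) - of_bool (i < k \<and> k < j)"
    unfolding mult_left_cancel[OF pi_neq_zero] .
qed

lemma simple_word_crossings:
  assumes ij: "i \<in> {1..m}" "j \<in> {1..m}" "i < j"
    and w: "w \<in> braid_words m" "word_perm w = transpose i j"
    and h: "word_homeo m w h" "half_twist m s \<gamma> h" and c: "is_cord m i j \<gamma>"
  shows "word_crossings id w j i = (if s then 1 else 0)"
    and "word_crossings id w i j = (if s then 0 else - 1)"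
    and "k \<in> {1..m} - {i, j} \<Longrightarrow> l \<in> {1..m} - {i, j} \<Longrightarrow> word_crossings id w k l = 0"
    and "k \<in> {1..m} - {i, j} \<Longrightarrow> of_int (word_crossings id w k i) = - winding_number (closed_cord m i j \<gamma>) (q m k)"
    and "k \<in> {1..m} - {i, j} \<Longrightarrow> of_int (word_crossings id w k j) = winding_number (closed_cord m i j \<gamma>) (q m k)"
    and "k \<in> {1..m} - {i, j} \<Longrightarrow> word_crossings id w i k = word_crossings id w k i - of_bool (i < k \<and> k < j)"
    and "k \<in> {1..m} - {i, j} \<Longrightarrow> word_crossings id w j k = - word_crossings id w i k"
proof -
  have arc: "arc \<gamma>" and ends: "pathstart \<gamma> = q m i" "pathfinish \<gamma> = q m j"
    using c by (auto simp: is_cord_def)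
  note ht = half_twist_diff_log[OF h(2) arc, unfolded ends]
  have "extend_by_id h = h" using ht(1) by (auto simp: extend_by_id_def supported_homeo_def)
  obtain L where L: "diff_log h L" using diff_log_exists[OF ht(1)] .
  \<comment> \<open>The string ending at \<open>a\<close> starts at \<open>transpose i j a\<close>.
    Hence the swapped indices below: \<open>L (q m i, q m k)\<close> counts crossings of the strings
    \<open>j\<close> and \<open>k\<close>.\<close>
  have T: "Im (L (q m a, q m b)) = pi * total_crossings w (transpose i j a) (transpose i j b)"
    if "a \<in> {1..m}" "b \<in> {1..m}" "a \<noteq> b" for a b
    using word_homeo_diff_log[OF h(1) w(1), of L a b] L that by (simp add: \<open>extend_by_id h = h\<close> w(2))
  have inv: "inv_into UNIV (word_perm w) = transpose i j"
    unfolding w(2) by (rule inv_unique_comp) (simp_all add: fun_eq_iff)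
  note C = word_crossings_eq_total[of _ _ w, unfolded inv]
  have tij: "transpose i j i = j" "transpose i j j = i" by simp_all
  have tk: "transpose i j k = k" if "k \<in> {1..m} - {i, j}" for k
    using that by (simp add: Transposition.transpose_def)
  have inQ: "q m k \<in> Q m - {q m i, q m j}" if "k \<in> {1..m} - {i, j}" for k
    using that by (auto simp: Q_def q_inject)
  have "pi * real_of_int (total_crossings w j i) = pi * (if s then 1 else - 1)"
    using T[of i j] ij ht(8)[OF L] by (cases s) (simp_all add: tij)
  then have Tij: "total_crossings w j i = (if s then 1 else - 1)"
    unfolding mult_left_cancel[OF pi_neq_zero] by (cases s) auto
  have sym: "total_crossings w a b = total_crossings w b a" for a b
    by (simp add: total_crossings_def)
  show "word_crossings id w j i = (if s then 1 else 0)"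
    using C[of i j] Tij sym[of i j] ij tij by (cases s) auto
  show "word_crossings id w i j = (if s then 0 else - 1)"
    using C[of j i] Tij ij tij by (cases s) auto
  show "word_crossings id w k l = 0" if kl: "k \<in> {1..m} - {i, j}" "l \<in> {1..m} - {i, j}"
  proof (cases "k = l")
    case False
    have "pi * real_of_int (total_crossings w l k) = 0"
      using T[of l k] ht(7)[OF L inQ[OF kl(2)] inQ[OF kl(1)]] kl False by (simp add: tk q_inject)
    then have "total_crossings w l k = 0" by simp
    then show ?thesis using C[of l k] False kl by (simp add: tk)
  qed (simp add: word_crossings_same)
  assume k: "k \<in> {1..m} - {i, j}"
  then have k': "k \<in> {1..m}" "k \<noteq> i" "k \<noteq> j" by auto
  note cc = closed_cord_winding[OF c ij(3) k']
  \<comment> \<open>Closing up the cord makes the winding number an integer; for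
    \<open>i < k < j\<close> the real part for the open cord is only a half-integer.\<close>
  obtain W where W: "winding_number (closed_cord m i j \<gamma>) (q m k) = of_int W"
    using integer_winding_number[OF cc(1-3)] by (auto elim: Ints_cases)
  have wn: "2 * Re (winding_number \<gamma> (q m k)) = real_of_int (2 * W + of_bool (i < k \<and> k < j))"
    using cc(4) by (simp add: W)
  have "pi * real_of_int (total_crossings w j k) = pi * (2 * Re (winding_number \<gamma> (q m k)))"
    using T[of i k] ht(5)[OF L inQ[OF k]] ij k' by (simp add: tij tk[OF k])
  then have Tj: "total_crossings w j k = 2 * W + of_bool (i < k \<and> k < j)"
    unfolding mult_left_cancel[OF pi_neq_zero] wn of_int_eq_iff .
  have "pi * real_of_int (total_crossings w i k) = pi * (- (2 * Re (winding_number \<gamma> (q m k))))"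
    using T[of j k] ht(6)[OF L inQ[OF k]] ij k' by (simp add: tij tk[OF k])
  then have Ti: "total_crossings w i k = - (2 * W + of_bool (i < k \<and> k < j))"
    unfolding mult_left_cancel[OF pi_neq_zero] wn of_int_minus[symmetric] of_int_eq_iff .
  \<comment> \<open>The order terms cancel the half turn in the entries \<open>k i\<close> and
    \<open>k j\<close> and double it in \<open>i k\<close> and \<open>j k\<close>.\<close>
  have b: "of_bool (i < k) - of_bool (j < k) = (of_bool (i < k \<and> k < j) :: int)"
    "of_bool (k < j) - of_bool (k < i) = (of_bool (i < k \<and> k < j) :: int)"
    using k' ij by auto
  note C' = C[of i k, unfolded tij tk[OF k]] C[of j k, unfolded tij tk[OF k]]
    C[of k i, unfolded tij tk[OF k]] C[of k j, unfolded tij tk[OF k]]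
  have ki: "word_crossings id w k i = - W"
    using C'(1) k' Ti b by linarith
  have kj: "word_crossings id w k j = W"
    using C'(2) k' Tj b by linarith
  have ik: "word_crossings id w i k = - W - of_bool (i < k \<and> k < j)"
    using C'(3) k' Ti sym[of i k] b by linarith
  have jk: "word_crossings id w j k = W + of_bool (i < k \<and> k < j)"
    using C'(4) k' Tj sym[of j k] b by linarith
  show "of_int (word_crossings id w k i) = - winding_number (closed_cord m i j \<gamma>) (q m k)"
    "of_int (word_crossings id w k j) = winding_number (closed_cord m i j \<gamma>) (q m k)"
    by (simp_all add: W ki kj)
  show "word_crossings id w i k = word_crossings id w k i - of_bool (i < k \<and> k < j)"
    "word_crossings id w j k = - word_crossings id w i k"
    by (simp_all add: ki ik jk)
qed

section \<open>Chains of paths\<close>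

abbreviation homologous :: "complex set \<Rightarrow> complex chain \<Rightarrow> complex chain \<Rightarrow> bool"
  where "homologous S \<equiv> homologous_rel 1 (top_of_set S) {}"

lemma homology_class_eq_iff: "homology_class S a = homology_class S b \<longleftrightarrow> homologous S a b"
  unfolding homology_class_def by (rule homologous_rel_set_eq)

lemma homologous_mono: "homologous A a b \<Longrightarrow> A \<subseteq> B \<Longrightarrow> homologous B a b"
  unfolding homologous_rel_def by (rule singular_boundary_mono)

lemma homologous_cmul: "homologous S a b \<Longrightarrow> homologous S (frag_cmul n a) (frag_cmul n b)"
proof -
  assume "homologous S a b"
  moreover have "frag_cmul n (a - b) = frag_cmul n a - frag_cmul n b"
    by (rule poly_mapping_eqI) (simp add: lookup_minus right_diff_distrib)
  ultimately show ?thesis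
    unfolding homologous_rel_def using singular_relboundary_cmul by metis
qed

lemma homologous_minus: "homologous S a b \<Longrightarrow> homologous S (- a) (- b)"
  using homologous_cmul[of S a b "-1"] by simp

lemma standard_simplex_1D:
  assumes "x \<in> standard_simplex 1"
  shows "0 \<le> x 1" "x 1 \<le> 1" "x 0 = 1 - x 1"
  using assms by (auto simp: standard_simplex_def)

lemma singular_simplex_path:
  assumes "path p" "path_image p \<subseteq> S"
  shows "singular_simplex 1 (top_of_set S) (restrict (\<lambda>x. p (x 1)) (standard_simplex 1))"
proof -
  let ?X = "subtopology (powertop_real UNIV) (standard_simplex 1)"
  have "continuous_map ?X (top_of_set {0..1}) (\<lambda>x. x 1)"
    by (auto simp: continuous_map_in_subtopology standard_simplex_1D[unfolded One_nat_def]
        intro!: continuous_map_from_subtopology continuous_map_product_projection)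
  moreover have "continuous_map (top_of_set {0..1}) (top_of_set S) p"
    using assms by (auto simp: path_def path_image_def)
  ultimately have "continuous_map ?X (top_of_set S) (p \<circ> (\<lambda>x. x 1))"
    by (rule continuous_map_compose)
  then have "continuous_map ?X (top_of_set S) (restrict (\<lambda>x. p (x 1)) (standard_simplex 1))"
    by (rule continuous_map_eq) auto
  then show ?thesis by (simp add: singular_simplex_def)
qed

lemma singular_chain_path:
  "path p \<Longrightarrow> path_image p \<subseteq> S \<Longrightarrow> singular_chain 1 (top_of_set S) (path_chain p)"
  unfolding path_chain_def singular_chain_of by (rule singular_simplex_path)

definition point_chain :: "complex \<Rightarrow> complex chain"
  where "point_chain z = frag_of (restrict (\<lambda>_. z) (standard_simplex 0))"

lemma chain_boundary_path:
  "chain_boundary 1 (path_chain p) = point_chain (pathfinish p) - point_chain (pathstart p)"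
proof -
  let ?f = "\<lambda>x::nat \<Rightarrow> real. p (x 1)"
  have "singular_face 1 0 ?f = restrict (\<lambda>_. pathfinish p) (standard_simplex 0)"
    by (auto simp: singular_face_def simplical_face_def standard_simplex_0 pathfinish_def fun_eq_iff)
  moreover have "singular_face 1 1 ?f = restrict (\<lambda>_. pathstart p) (standard_simplex 0)"
    by (auto simp: singular_face_def simplical_face_def standard_simplex_0 pathstart_def fun_eq_iff)
  moreover have "{..1::nat} = {0, 1}" by auto
  ultimately show ?thesis
    unfolding path_chain_def point_chain_def chain_boundary_of
    by simp
qed

lemma path_chain_cong: "(\<And>t. t \<in> {0..1} \<Longrightarrow> p t = p' t) \<Longrightarrow> path_chain p = path_chain p'"
  unfolding path_chain_def by (intro arg_cong[of _ _ frag_of] restrict_ext) (simp add: standard_simplex_1D[unfolded One_nat_def])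

lemma chain_map_path: "chain_map 1 f (path_chain p) = path_chain (f \<circ> p)"
  unfolding path_chain_def chain_map_of simplex_map_def
  by (intro arg_cong[of _ _ frag_of] restrict_ext) auto

text \<open>The contraction carries the cycle into a single point, where a constant 1-simplex is the
  boundary of a constant 2-simplex.\<close>

lemma convex_cycle_null:
  fixes T :: "complex set"
  assumes T: "convex T" and c: "singular_chain 1 (top_of_set T) c" "chain_boundary 1 c = 0"
  shows "homologous T c 0"
proof -
  have "contractible_space (top_of_set T)"
    using T by (simp add: convex_imp_contractible)
  then obtain a where a: "homotopic_with (\<lambda>x. True) (top_of_set T) (top_of_set T) id (\<lambda>x. a)"
    unfolding contractible_space_def by blast
  have cyc: "singular_relcycle 1 (top_of_set T) {} c" using c by (simp add: singular_cycle)
  have "homologous T (chain_map 1 id c) (chain_map 1 (\<lambda>x. a) c)"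
    by (rule homotopic_imp_homologous_rel_chain_maps[OF _ cyc]) (use a in simp)
  moreover have "homologous T (chain_map 1 (\<lambda>x. a) c) 0"
  proof (cases "T = {}")
    case True
    then have "c = 0" using c by (simp add: singular_chain_empty)
    then show ?thesis by simp
  next
    case False
    then obtain x where "x \<in> T" by blast
    moreover have "(\<lambda>x. a) \<in> topspace (top_of_set T) \<rightarrow> topspace (top_of_set T)"
      using homotopic_with_imp_continuous_maps[OF a] by (intro continuous_map_funspace) (rule conjunct2)
    ultimately have aT: "a \<in> T" by (auto simp: Pi_iff)
    have "singular_chain 1 (top_of_set {a}) (chain_map 1 (\<lambda>x. a) c)"
      by (rule singular_chain_chain_map[OF c(1)]) auto
    then have "singular_relboundary 1 (top_of_set {a}) {} (chain_map 1 (\<lambda>x. a) c)"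
      by (subst singular_boundary_singleton) auto
    then show ?thesis
      using aT by (auto simp: homologous_rel_def intro: singular_boundary_mono)
  qed
  ultimately show ?thesis
    using chain_map_ident[OF c(1)] homologous_rel_trans by metis
qed

text \<open>The device behind the relations between path chains below: the paths are written as
  images of paths in a convex set, so that only a boundary computation is left and no 2-chain has to
  be exhibited.\<close>

lemma convex_image_cycle_null:
  fixes T S :: "complex set"
  assumes "convex T" "singular_chain 1 (top_of_set T) c" "chain_boundary 1 c = 0"
    and f: "continuous_on T f" "f ` T \<subseteq> S"
  shows "homologous S (chain_map 1 f c) 0"
proof -
  have "singular_relboundary 1 (top_of_set T) {} c"
    using convex_cycle_null[OF assms(1-3)] by (simp add: homologous_rel_def)
  then have "singular_relboundary 1 (top_of_set S) {} (chain_map 1 f c)"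
    by (rule singular_relboundary_chain_map) (use f in auto)
  then show ?thesis by (simp add: homologous_rel_def)
qed

text \<open>The image under \<open>p \<circ> Re\<close> of the degenerate triangle with vertices
  \<open>u\<close>, \<open>v\<close>, \<open>w\<close>.\<close>

lemma homologous_subpath:
  assumes p: "path p" "path_image p \<subseteq> S" and u: "u \<in> {0..1}" "v \<in> {0..1}" "w \<in> {0..1}"
  shows "homologous S (path_chain (subpath u v p) + path_chain (subpath v w p)) (path_chain (subpath u w p))"
proof -
  let ?T = "{z. Re z \<in> {0..1}}"
  have T: "convex ?T"
    using convex_Int[OF convex_halfspace_Re_ge[of 0] convex_halfspace_Re_le[of 1]]
    by (simp add: Int_def)
  let ?l = "\<lambda>x y. linepath (complex_of_real x) (complex_of_real y)"
  let ?c = "path_chain (?l u v) + path_chain (?l v w) - path_chain (?l u w)"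
  have l: "singular_chain 1 (top_of_set ?T) (path_chain (?l x y))" if "x \<in> {0..1}" "y \<in> {0..1}" for x y
    by (rule singular_chain_path) (use that closed_segment_subset[OF _ _ T, of "of_real x" "of_real y"] in auto)
  have m: "chain_map 1 (p \<circ> Re) (path_chain (?l x y)) = path_chain (subpath x y p)" for x y
    unfolding chain_map_path
    by (rule path_chain_cong) (simp add: subpath_def linepath_def algebra_simps)
  have "homologous S (chain_map 1 (p \<circ> Re) ?c) 0"
  proof (rule convex_image_cycle_null[OF T])
    show "singular_chain 1 (top_of_set ?T) ?c"
      by (intro singular_chain_add singular_chain_diff l u)
    show "chain_boundary 1 ?c = 0"
      unfolding chain_boundary_add chain_boundary_diff chain_boundary_path by simp
    show "continuous_on ?T (p \<circ> Re)"
      using p(1) by (intro continuous_on_compose continuous_intros) (auto simp: path_def elim: continuous_on_subset)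
    show "(p \<circ> Re) ` ?T \<subseteq> S" using p(2) by (auto simp: path_image_def)
  qed
  then show ?thesis
    unfolding chain_map_add chain_map_diff m by (simp add: homologous_rel_def)
qed

text \<open>Additivity for a trivial subdivision makes twice the chain homologous to the
  chain.\<close>

lemma homologous_const:
  assumes "z \<in> S"
  shows "homologous S (path_chain (\<lambda>_. z)) 0"
proof -
  have "homologous S (path_chain (subpath 0 0 (\<lambda>_. z)) + path_chain (subpath 0 0 (\<lambda>_. z))) (path_chain (subpath 0 0 (\<lambda>_. z)))"
    by (rule homologous_subpath) (use assms in \<open>auto simp: path_def path_image_def\<close>)
  then show ?thesis by (simp add: homologous_rel_def subpath_def)
qed

lemma homologous_join:
  assumes "path p" "path r" "pathfinish p = pathstart r" "path_image p \<subseteq> S" "path_image r \<subseteq> S"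
  shows "homologous S (path_chain (p +++ r)) (path_chain p + path_chain r)"
proof -
  have "path_chain (subpath 0 (1/2) (p +++ r)) = path_chain p"
    by (rule path_chain_cong) (auto simp: subpath_def joinpaths_def)
  moreover have "path_chain (subpath (1/2) 1 (p +++ r)) = path_chain r"
    using assms(3)
    by (intro path_chain_cong) (auto simp: subpath_def joinpaths_def field_simps pathfinish_def pathstart_def)
  moreover have "homologous S (path_chain (subpath 0 (1/2) (p +++ r)) + path_chain (subpath (1/2) 1 (p +++ r)))
      (path_chain (subpath 0 1 (p +++ r)))"
    by (rule homologous_subpath) (use assms in \<open>auto simp: path_image_join\<close>)
  ultimately show ?thesis by (simp add: homologous_rel_sym)
qed

lemma homologous_reversepath:
  assumes "path p" "path_image p \<subseteq> S"
  shows "homologous S (path_chain (reversepath p)) (- path_chain p)"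
proof -
  have "homologous S (path_chain (subpath 1 0 p) + path_chain (subpath 0 1 p)) (path_chain (subpath 1 1 p))"
    by (rule homologous_subpath) (use assms in auto)
  moreover have "subpath 1 1 p = (\<lambda>_. p 1)" by (simp add: subpath_def)
  moreover have "homologous S (path_chain (\<lambda>_. p 1)) 0"
    using assms by (intro homologous_const) (auto simp: path_image_def)
  ultimately have "homologous S (path_chain (reversepath p) + path_chain p) 0"
    using homologous_rel_trans by (metis reversepath_subpath subpath_trivial reversepath_def subpath_reversepath)
  then show ?thesis by (simp add: homologous_rel_def)
qed

text \<open>The image of the boundary of the unit square, with the homotopy parameter as real part.
  The two sides swept by the ends coincide, since every stage is a loop, and cancel.\<close>

lemma homologous_loops:
  assumes "homotopic_loops S p r"
  shows "homologous S (path_chain p) (path_chain r)"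
proof -
  from assms obtain h where h: "continuous_on ({0..1::real} \<times> {0..1}) h" "h \<in> {0..1} \<times> {0..1} \<rightarrow> S"
    "\<And>x. x \<in> {0..1} \<Longrightarrow> h (0, x) = p x" "\<And>x. x \<in> {0..1} \<Longrightarrow> h (1, x) = r x"
    "\<And>t. t \<in> {0..1} \<Longrightarrow> pathfinish (h \<circ> Pair t) = pathstart (h \<circ> Pair t)"
    unfolding homotopic_loops by blast
  let ?T = "cbox 0 (Complex 1 1)"
  have T: "z \<in> ?T \<longleftrightarrow> Re z \<in> {0..1} \<and> Im z \<in> {0..1}" for z by (auto simp: in_cbox_complex_iff)
  define f where "f = (\<lambda>z. h (Re z, Im z))"
  let ?c = "path_chain (linepath 0 \<i>) + path_chain (linepath \<i> (Complex 1 1))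
    - path_chain (linepath 1 (Complex 1 1)) - path_chain (linepath 0 1)"
  have l: "singular_chain 1 (top_of_set ?T) (path_chain (linepath x y))" if "x \<in> ?T" "y \<in> ?T" for x y
    by (rule singular_chain_path) (use that closed_segment_subset[of x ?T y] in auto)
  have "homologous S (chain_map 1 f ?c) 0"
  proof (rule convex_image_cycle_null)
    show "singular_chain 1 (top_of_set ?T) ?c"
      by (intro singular_chain_add singular_chain_diff l) (auto simp: in_cbox_complex_iff)
    show "chain_boundary 1 ?c = 0"
      unfolding chain_boundary_add chain_boundary_diff chain_boundary_path by simp
    show "continuous_on ?T f" unfolding f_def
      by (rule continuous_on_compose2[OF h(1)]) (auto intro!: continuous_intros simp: in_cbox_complex_iff)
    show "f ` ?T \<subseteq> S" using h(2) by (auto simp: f_def in_cbox_complex_iff)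
  qed auto
  moreover have "path_chain (f \<circ> linepath 0 \<i>) = path_chain p"
    by (rule path_chain_cong) (use h(3) in \<open>simp add: f_def linepath_def\<close>)
  moreover have "path_chain (f \<circ> linepath 1 (Complex 1 1)) = path_chain r"
    by (rule path_chain_cong) (use h(4) in \<open>simp add: f_def linepath_def\<close>)
  moreover have "path_chain (f \<circ> linepath \<i> (Complex 1 1)) = path_chain (f \<circ> linepath 0 1)"
    by (rule path_chain_cong) (use h(5) in \<open>simp add: f_def linepath_def pathfinish_def pathstart_def\<close>)
  ultimately show ?thesis
    unfolding chain_map_add chain_map_diff chain_map_path by (simp add: homologous_rel_def)
qed

section \<open>Winding numbers of chains\<close>

lemma chain_boundary_2:
  "chain_boundary 2 (frag_of f) =
    frag_of (singular_face 2 0 f) - frag_of (singular_face 2 1 f) + frag_of (singular_face 2 2 f)"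
proof -
  have "{..2::nat} = {0, 1, 2}" by auto
  then show ?thesis by (simp add: chain_boundary_of)
qed

text \<open>Reads a singular 1-simplex as a path, with the barycentric coordinate of vertex 1 as
  time; on the unit interval it undoes \<open>path_chain\<close>.\<close>

definition simplex_edge :: "((nat \<Rightarrow> real) \<Rightarrow> complex) \<Rightarrow> real \<Rightarrow> complex"
  where "simplex_edge f t = f (\<lambda>l. if l = 0 then 1 - t else if l = 1 then t else 0)"

text \<open>The linear extension of the winding number to all 1-chains, a cocycle on every set that
  omits \<open>z\<close>. It is used to tell homology classes apart.\<close>

definition chain_winding :: "complex \<Rightarrow> complex chain \<Rightarrow> complex"
  where "chain_winding z c =
    (\<Sum>f\<in>Poly_Mapping.keys c. of_int (Poly_Mapping.lookup c f) * winding_number (simplex_edge f) z)"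

lemma chain_winding_superset:
  assumes "finite A" "Poly_Mapping.keys c \<subseteq> A"
  shows "chain_winding z c = (\<Sum>f\<in>A. of_int (Poly_Mapping.lookup c f) * winding_number (simplex_edge f) z)"
  unfolding chain_winding_def
  by (rule sum.mono_neutral_left) (use assms in \<open>auto simp: in_keys_iff\<close>)

lemma chain_winding_add: "chain_winding z (a + b) = chain_winding z a + chain_winding z b"
proof -
  let ?A = "Poly_Mapping.keys a \<union> Poly_Mapping.keys b"
  have "chain_winding z c = (\<Sum>f\<in>?A. of_int (Poly_Mapping.lookup c f) * winding_number (simplex_edge f) z)"
    if "Poly_Mapping.keys c \<subseteq> ?A" for c
    by (rule chain_winding_superset) (use that in auto)
  from this[of a] this[of b] this[of "a + b"] show ?thesis
    using Poly_Mapping.keys_add[of a b] by (simp add: lookup_add distrib_right sum.distrib)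
qed

lemma chain_winding_cmul: "chain_winding z (frag_cmul n c) = of_int n * chain_winding z c"
proof -
  have "chain_winding z (frag_cmul n c) = (\<Sum>f\<in>Poly_Mapping.keys c.
      of_int (Poly_Mapping.lookup (frag_cmul n c) f) * winding_number (simplex_edge f) z)"
    by (rule chain_winding_superset) (auto simp: keys_cmul)
  then show ?thesis by (simp add: chain_winding_def sum_distrib_left mult.assoc)
qed

lemma chain_winding_0 [simp]: "chain_winding z 0 = 0"
  by (simp add: chain_winding_def)

lemma chain_winding_diff: "chain_winding z (a - b) = chain_winding z a - chain_winding z b"
proof -
  have "a - b = a + frag_cmul (- 1) b" by simp
  then show ?thesis by (simp only: chain_winding_add chain_winding_cmul) simp
qed

lemma chain_winding_sum: "chain_winding z (sum f A) = (\<Sum>x\<in>A. chain_winding z (f x))"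
  by (induction A rule: infinite_finite_induct) (simp_all add: chain_winding_add)

lemma chain_winding_of: "chain_winding z (frag_of f) = winding_number (simplex_edge f) z"
  by (simp add: chain_winding_def)

lemma chain_winding_path: "chain_winding z (path_chain p) = winding_number p z"
proof -
  have "simplex_edge (restrict (\<lambda>x. p (x 1)) (standard_simplex 1)) t = p t" if "t \<in> {0..1}" for t
    using that by (auto simp: simplex_edge_def standard_simplex_def)
  then show ?thesis
    unfolding path_chain_def chain_winding_of by (intro winding_number_cong) auto
qed

text \<open>The simplex is contractible, so \<open>f - z\<close> has a logarithm on it; the winding
  numbers of the three edges are its increments, and their alternating sum telescopes.\<close>

lemma chain_winding_boundary_simplex:
  assumes f: "singular_simplex 2 (top_of_set S) f" and z: "z \<notin> S"
  shows "chain_winding z (chain_boundary 2 (frag_of f)) = 0"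
proof -
  define T where "T = {p :: real \<times> real. 0 \<le> fst p \<and> 0 \<le> snd p \<and> fst p + snd p \<le> 1}"
  define e where "e = (\<lambda>(p :: real \<times> real) l::nat.
    if l = 0 then 1 - fst p - snd p else if l = 1 then fst p else if l = 2 then snd p else 0)"
  have T: "convex T"
  proof (rule convexI)
    fix x y :: "real \<times> real" and u v :: real
    assume *: "x \<in> T" "y \<in> T" "0 \<le> u" "0 \<le> v" "u + v = 1"
    have "u * (fst x + snd x) + v * (fst y + snd y) \<le> u * 1 + v * 1"
      using * by (intro add_mono mult_left_mono) (auto simp: T_def)
    then show "u *\<^sub>R x + v *\<^sub>R y \<in> T"
      using * by (simp add: T_def algebra_simps)
  qed
  have eT: "e p \<in> standard_simplex 2" if "p \<in> T" for p
    using that by (auto simp: e_def T_def standard_simplex_def numeral_2_eq_2)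
  have "continuous_on T (\<lambda>p. e p l)" for l
    by (cases "l = 0"; cases "l = 1"; cases "l = 2") (auto simp: e_def intro!: continuous_intros)
  then have "continuous_map (top_of_set T) (powertop_real UNIV) e"
    unfolding continuous_map_componentwise_UNIV by simp
  then have "continuous_map (top_of_set T) (subtopology (powertop_real UNIV) (standard_simplex 2)) e"
    using eT by (auto simp: continuous_map_in_subtopology)
  moreover have "continuous_map (subtopology (powertop_real UNIV) (standard_simplex 2)) (top_of_set S) f"
    using f by (simp add: singular_simplex_def)
  ultimately have "continuous_map (top_of_set T) (top_of_set S) (f \<circ> e)"
    by (rule continuous_map_compose)
  then have fe: "continuous_on T (\<lambda>p. f (e p))" "\<And>p. p \<in> T \<Longrightarrow> f (e p) \<in> S"
    by (auto simp: comp_def)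
  have "\<exists>g. continuous_on T g \<and> (\<forall>p\<in>T. f (e p) - z = exp (g p))"
  proof (rule continuous_logarithm_on_contractible)
    show "continuous_on T (\<lambda>p. f (e p) - z)" by (intro continuous_intros fe)
    show "contractible T" using T by (rule convex_imp_contractible)
    show "f (e p) - z \<noteq> 0" if "p \<in> T" for p using fe(2)[OF that] z by auto
  qed blast
  then obtain g where g: "continuous_on T g" "\<And>p. p \<in> T \<Longrightarrow> f (e p) - z = exp (g p)" by blast
  have edge: "2 * pi * \<i> * winding_number (simplex_edge (singular_face 2 k f)) z = g (b k 1) - g (b k 0)"
    if k: "\<And>t. t \<in> {0..1} \<Longrightarrow> simplex_edge (singular_face 2 k f) t = f (e (b k t))"
      "\<And>t. t \<in> {0..1} \<Longrightarrow> b k t \<in> T" "continuous_on {0..1} (b k)" for k and b :: "nat \<Rightarrow> real \<Rightarrow> real \<times> real"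
  proof (rule winding_number_continuous_log)
    have "continuous_on {0..1} (\<lambda>t. f (e (b k t)))"
      by (rule continuous_on_compose2[OF fe(1) k(3)]) (use k(2) in auto)
    then show "path (simplex_edge (singular_face 2 k f))"
      unfolding path_def by (rule continuous_on_eq) (use k(1) in auto)
    show "continuous_on {0..1} (\<lambda>t. g (b k t))"
      by (rule continuous_on_compose2[OF g(1) k(3)]) (use k(2) in auto)
    show "simplex_edge (singular_face 2 k f) t - z = exp (g (b k t))" if "t \<in> {0..1}" for t
      using k(1,2)[OF that] g(2) by simp
  qed
  have face: "simplex_edge (singular_face 2 k f) t =
      f (simplical_face k (\<lambda>l. if l = 0 then 1 - t else if l = 1 then t else 0))" if "t \<in> {0..1}" for k t
    using that by (auto simp: simplex_edge_def singular_face_def standard_simplex_def)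
  \<comment> \<open>The edge opposite vertex \<open>k\<close> in the planar coordinates of
    \<open>T\<close>, which omit the barycentric coordinate of vertex 0.\<close>
  define b :: "nat \<Rightarrow> real \<Rightarrow> real \<times> real"
    where "b = (\<lambda>k t. if k = 0 then (1 - t, t) else if k = 1 then (0, t) else (t, 0))"
  have "simplical_face k (\<lambda>l. if l = 0 then 1 - t else if l = 1 then t else 0) = e (b k t)"
    if "k \<in> {0, 1, 2}" for k t
    using that by (elim insertE emptyE) (auto simp: fun_eq_iff simplical_face_def e_def b_def)
  then have "2 * pi * \<i> * winding_number (simplex_edge (singular_face 2 k f)) z = g (b k 1) - g (b k 0)"
    if "k \<in> {0, 1, 2}" for k
    using that by (intro edge) (auto simp: face T_def b_def intro!: continuous_intros)
  from this[of 0] this[of 1] this[of 2]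
  have "2 * pi * \<i> * (winding_number (simplex_edge (singular_face 2 0 f)) z
      - winding_number (simplex_edge (singular_face 2 1 f)) z
      + winding_number (simplex_edge (singular_face 2 2 f)) z) = 0"
    by (simp add: distrib_left right_diff_distrib b_def)
  then show ?thesis
    unfolding chain_boundary_2 by (simp add: chain_winding_add chain_winding_diff chain_winding_of)
qed

lemma chain_winding_homologous:
  assumes "homologous S a b" "z \<notin> S"
  shows "chain_winding z a = chain_winding z b"
proof -
  from assms(1) obtain d where d: "singular_chain 2 (top_of_set S) d" "chain_boundary 2 d = a - b"
    by (auto simp: homologous_rel_def singular_boundary numeral_2_eq_2)
  from d(1) have "chain_winding z (chain_boundary 2 d) = 0"
    unfolding singular_chain_def
  proof (induction d rule: frag_induction)
    case (one f)
    then show ?case using chain_winding_boundary_simplex[OF _ assms(2)] by simp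
  qed (simp_all add: chain_boundary_diff chain_winding_diff)
  then show ?thesis by (simp add: d(2) chain_winding_diff)
qed

section \<open>The first homology of the punctured disk\<close>

definition span_class :: "complex set \<Rightarrow> 'k set \<Rightarrow> ('k \<Rightarrow> real \<Rightarrow> complex) \<Rightarrow> complex chain set"
  where "span_class S K l = {c. \<exists>v. homologous S c (\<Sum>k\<in>K. frag_cmul (v k) (path_chain (l k)))}"

text \<open>Testing loops is enough, because the classes evaluated later are classes of loops, and
  it allows an argument by cutting a loop into pieces.\<close>

definition spanned :: "complex set \<Rightarrow> 'k set \<Rightarrow> ('k \<Rightarrow> real \<Rightarrow> complex) \<Rightarrow> bool"
  where "spanned S K l \<longleftrightarrow> (\<forall>p. path p \<and> path_image p \<subseteq> S \<and> pathfinish p = pathstart p \<longrightarrow>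
    path_chain p \<in> span_class S K l)"

lemma span_class_add:
  assumes "a \<in> span_class S K l" "b \<in> span_class S K l"
  shows "a + b \<in> span_class S K l"
proof -
  from assms obtain v w where "homologous S a (\<Sum>k\<in>K. frag_cmul (v k) (path_chain (l k)))"
    "homologous S b (\<Sum>k\<in>K. frag_cmul (w k) (path_chain (l k)))"
    by (auto simp: span_class_def)
  from homologous_rel_add[OF this]
  have "homologous S (a + b) (\<Sum>k\<in>K. frag_cmul (v k + w k) (path_chain (l k)))"
    by (simp add: frag_cmul_distrib sum.distrib)
  then show ?thesis unfolding span_class_def by (intro CollectI exI)
qed

lemma span_class_homologous:
  assumes "a \<in> span_class S K l" "homologous S b a"
  shows "b \<in> span_class S K l"
proof -
  from assms(1) obtain v where "homologous S a (\<Sum>k\<in>K. frag_cmul (v k) (path_chain (l k)))"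
    by (auto simp: span_class_def)
  then have "homologous S b (\<Sum>k\<in>K. frag_cmul (v k) (path_chain (l k)))"
    using assms(2) by (rule homologous_rel_trans)
  then show ?thesis unfolding span_class_def by (intro CollectI exI)
qed

lemma span_class_mono:
  assumes a: "a \<in> span_class A K l" and "A \<subseteq> S" "K \<subseteq> K'" "finite K'"
  shows "a \<in> span_class S K' l"
proof -
  from a obtain v where "homologous A a (\<Sum>k\<in>K. frag_cmul (v k) (path_chain (l k)))"
    by (auto simp: span_class_def)
  moreover have "(\<Sum>k\<in>K. frag_cmul (v k) (path_chain (l k)))
      = (\<Sum>k\<in>K'. frag_cmul (if k \<in> K then v k else 0) (path_chain (l k)))"
    by (rule sum.mono_neutral_cong_left) (use assms in auto)
  ultimately have "homologous A a (\<Sum>k\<in>K'. frag_cmul (if k \<in> K then v k else 0) (path_chain (l k)))"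
    by (simp only:)
  from homologous_mono[OF this \<open>A \<subseteq> S\<close>]
  have "homologous S a (\<Sum>k\<in>K'. frag_cmul (if k \<in> K then v k else 0) (path_chain (l k)))" .
  then show ?thesis unfolding span_class_def by (intro CollectI exI)
qed

text \<open>A point of the intersection gets a connector inside the intersection. The same connector
  then serves a piece in \<open>A\<close> and an adjacent piece in \<open>B\<close>, so that its two
  occurrences cancel.\<close>

lemma connector_exists:
  assumes "path_connected A" "path_connected B" "path_connected (A \<inter> B)" "x0 \<in> A \<inter> B"
  obtains c where "\<And>x. x \<in> A \<union> B \<Longrightarrow> path (c x) \<and> pathstart (c x) = x0 \<and> pathfinish (c x) = x"
    "\<And>x. x \<in> A \<Longrightarrow> path_image (c x) \<subseteq> A" "\<And>x. x \<in> B \<Longrightarrow> path_image (c x) \<subseteq> B"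
proof -
  have "\<exists>g. path g \<and> pathstart g = x0 \<and> pathfinish g = x \<and>
      (x \<in> A \<longrightarrow> path_image g \<subseteq> A) \<and> (x \<in> B \<longrightarrow> path_image g \<subseteq> B)" if "x \<in> A \<union> B" for x
  proof -
    consider "x \<in> A \<inter> B" | "x \<in> A" "x \<notin> B" | "x \<in> B" "x \<notin> A" using \<open>x \<in> A \<union> B\<close> by blast
    then show ?thesis
    proof cases
      case 1
      then obtain g where "path g" "path_image g \<subseteq> A \<inter> B" "pathstart g = x0" "pathfinish g = x"
        using assms(3,4) unfolding path_connected_def by metis
      then show ?thesis by blast
    next
      case 2
      then obtain g where "path g" "path_image g \<subseteq> A" "pathstart g = x0" "pathfinish g = x"
        using assms(1,4) unfolding path_connected_def by (metis IntD1)
      then show ?thesis using 2 by blast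
    next
      case 3
      then obtain g where "path g" "path_image g \<subseteq> B" "pathstart g = x0" "pathfinish g = x"
        using assms(2,4) unfolding path_connected_def by (metis IntD2)
      then show ?thesis using 3 by blast
    qed
  qed
  then have "\<forall>x\<in>A \<union> B. \<exists>g. path g \<and> pathstart g = x0 \<and> pathfinish g = x \<and>
      (x \<in> A \<longrightarrow> path_image g \<subseteq> A) \<and> (x \<in> B \<longrightarrow> path_image g \<subseteq> B)" by (rule ballI)
  from bchoice[OF this] obtain c where c: "\<forall>x\<in>A \<union> B. path (c x) \<and> pathstart (c x) = x0 \<and> pathfinish (c x) = x \<and>
      (x \<in> A \<longrightarrow> path_image (c x) \<subseteq> A) \<and> (x \<in> B \<longrightarrow> path_image (c x) \<subseteq> B)" ..
  show thesis by (rule that[of c]) (use c in auto)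
qed

lemma local_subpath:
  fixes p :: "real \<Rightarrow> complex"
  assumes p: "path p" "path_image p \<subseteq> S" and A: "openin (top_of_set S) A" and x: "x \<in> {0..1}" "p x \<in> A"
  obtains d where "0 < d" "\<And>u v. u \<in> {0..1} \<Longrightarrow> v \<in> {0..1} \<Longrightarrow> u \<le> x \<Longrightarrow> x \<le> v \<Longrightarrow> v - u < d \<Longrightarrow>
    path_image (subpath u v p) \<subseteq> A"
proof -
  have "openin (top_of_set {0..1}) ({0..1} \<inter> p -` A)"
    using p A by (intro continuous_openin_preimage) (auto simp: path_def path_image_def)
  then obtain d where d: "0 < d" "\<And>y. y \<in> {0..1} \<Longrightarrow> dist y x < d \<Longrightarrow> p y \<in> A"
    using x unfolding openin_euclidean_subtopology_iff by blast
  show thesis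
  proof (rule that[OF d(1)])
    fix u v :: real assume uv: "u \<in> {0..1}" "v \<in> {0..1}" "u \<le> x" "x \<le> v" "v - u < d"
    then have "p y \<in> A" if "y \<in> {u..v}" for y
      using that by (intro d(2)) (auto simp: dist_real_def)
    then show "path_image (subpath u v p) \<subseteq> A"
      using uv by (auto simp: path_image_subpath)
  qed
qed

text \<open>A loop is cut into pieces lying in \<open>A\<close> or in \<open>B\<close>; each piece is closed up by connecting its ends with
  a base point of \<open>A \<inter> B\<close> within the same set, and the connectors cancel.\<close>

lemma spanned_Un:
  assumes A: "openin (top_of_set S) A" "path_connected A" "spanned A K l"
    and B: "openin (top_of_set S) B" "path_connected B" "spanned B K' l"
    and S: "S = A \<union> B" and AB: "path_connected (A \<inter> B)" "x0 \<in> A \<inter> B"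
    and fin: "finite K" "finite K'"
  shows "spanned S (K \<union> K') l"
  unfolding spanned_def
proof (intro allI impI, elim conjE)
  fix p assume p: "path p" "path_image p \<subseteq> S" "pathfinish p = pathstart p"
  obtain c where c: "\<And>x. x \<in> S \<Longrightarrow> path (c x) \<and> pathstart (c x) = x0 \<and> pathfinish (c x) = x"
    "\<And>x. x \<in> A \<Longrightarrow> path_image (c x) \<subseteq> A" "\<And>x. x \<in> B \<Longrightarrow> path_image (c x) \<subseteq> B"
    using connector_exists[OF A(2) B(2) AB] unfolding S by metis
  have cS: "path_image (c x) \<subseteq> S" if "x \<in> S" for x using c that S by blast
  have pS: "p u \<in> S" if "u \<in> {0..1}" for u using p that by (auto simp: path_image_def)
  let ?span = "span_class S (K \<union> K') l"
  \<comment> \<open>The connectors make each piece homologous to a loop and keep the pieces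
    additive, up to homology, over adjacent intervals.\<close>
  define piece where "piece = (\<lambda>u v. path_chain (c (p u)) + path_chain (subpath u v p) - path_chain (c (p v)))"
  have local: "piece u v \<in> ?span"
    if uv: "u \<in> {0..1}" "v \<in> {0..1}" and W: "W = A \<and> J = K \<or> W = B \<and> J = K'"
      and im: "path_image (subpath u v p) \<subseteq> W" for u v W J
  proof -
    have sp: "path (subpath u v p)" "pathstart (subpath u v p) = p u" "pathfinish (subpath u v p) = p v"
      using uv p by (simp_all add: path_subpath)
    have "p u \<in> W" "p v \<in> W" using im sp pathstart_in_path_image pathfinish_in_path_image by (metis subsetD)+
    then have cW: "path_image (c (p u)) \<subseteq> W" "path_image (c (p v)) \<subseteq> W" using W c(2,3) by blast+
    have WS: "W \<subseteq> S" "J \<subseteq> K \<union> K'" using W S by auto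
    note cu = c(1)[OF pS[OF uv(1)]] and cv = c(1)[OF pS[OF uv(2)]]
    let ?loop = "c (p u) +++ (subpath u v p +++ reversepath (c (p v)))"
    have 1: "homologous W (path_chain (subpath u v p +++ reversepath (c (p v))))
        (path_chain (subpath u v p) + path_chain (reversepath (c (p v))))"
      by (rule homologous_join) (use sp cu cv im cW in auto)
    have 2: "homologous W (path_chain ?loop)
        (path_chain (c (p u)) + path_chain (subpath u v p +++ reversepath (c (p v))))"
      by (rule homologous_join) (use sp cu cv im cW in \<open>auto simp: path_image_join\<close>)
    have 3: "homologous W (path_chain (reversepath (c (p v)))) (- path_chain (c (p v)))"
      by (rule homologous_reversepath) (use cv cW in auto)
    have "homologous W (path_chain ?loop) (path_chain (c (p u)) + (path_chain (subpath u v p) + (- path_chain (c (p v)))))"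
      by (rule homologous_rel_trans[OF homologous_rel_add[OF homologous_rel_refl homologous_rel_trans[OF
            homologous_rel_add[OF homologous_rel_refl 3] 1]] 2])
    then have "homologous W (piece u v) (path_chain ?loop)"
      by (simp add: piece_def homologous_rel_sym algebra_simps)
    moreover have "path_chain ?loop \<in> span_class W J l"
    proof -
      have "spanned W J l" using W A(3) B(3) by auto
      moreover have "path ?loop" "path_image ?loop \<subseteq> W" "pathfinish ?loop = pathstart ?loop"
        using sp cu cv im cW by (auto simp: path_image_join)
      ultimately show ?thesis by (simp add: spanned_def)
    qed
    ultimately have "piece u v \<in> span_class W J l" by (rule span_class_homologous[rotated])
    then show ?thesis by (rule span_class_mono) (use WS fin in auto)
  qed
  define P where "P = (\<lambda>u v. 0 \<le> u \<longrightarrow> v \<le> 1 \<longrightarrow> piece u v \<in> ?span)"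
  \<comment> \<open>Bisection: it suffices that \<open>P\<close> passes to unions of adjacent
    intervals and holds for all short intervals around each point.\<close>
  have "P 0 1"
  proof (rule Bolzano)
    show "(0::real) \<le> 1" by simp
    fix u v w assume t: "P u v" "P v w" "u \<le> v" "v \<le> w"
    show "P u w" unfolding P_def
    proof (intro impI)
      assume uw: "0 \<le> u" "w \<le> 1"
      then have "homologous S (path_chain (subpath u v p) + path_chain (subpath v w p)) (path_chain (subpath u w p))"
        using t p by (intro homologous_subpath) auto
      then have "homologous S (piece u v + piece v w) (piece u w)"
        by (simp add: piece_def homologous_rel_def algebra_simps)
      then have "homologous S (piece u w) (piece u v + piece v w)"
        by (simp only: homologous_rel_sym)
      moreover have "piece u v + piece v w \<in> ?span"
        by (rule span_class_add) (use t uw in \<open>auto simp: P_def\<close>)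
      ultimately show "piece u w \<in> ?span" by (rule span_class_homologous[rotated])
    qed
  next
    fix x :: real assume "0 \<le> x" "x \<le> 1"
    then have x: "x \<in> {0..1}" by simp
    obtain W J where W: "W = A \<and> J = K \<or> W = B \<and> J = K'" "p x \<in> W"
      using pS[OF x] S by blast
    then have "openin (top_of_set S) W" using A B by auto
    from local_subpath[OF p(1,2) this x W(2)] obtain d where d: "0 < d"
      "\<And>u v. u \<in> {0..1} \<Longrightarrow> v \<in> {0..1} \<Longrightarrow> u \<le> x \<Longrightarrow> x \<le> v \<Longrightarrow> v - u < d \<Longrightarrow> path_image (subpath u v p) \<subseteq> W"
      by metis
    have "P u v" if uv: "u \<le> x" "x \<le> v" "v - u < d" for u v
      unfolding P_def
    proof (intro impI)
      assume "0 \<le> u" "v \<le> 1"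
      then have "u \<in> {0..1}" "v \<in> {0..1}" using x uv by auto
      then show "piece u v \<in> ?span" using d(2) uv by (intro local[OF _ _ W(1)])
    qed
    then show "\<exists>d>0. \<forall>u v. u \<le> x \<and> x \<le> v \<and> v - u < d \<longrightarrow> P u v" using d(1) by blast
  qed
  then have "piece 0 1 \<in> ?span" by (simp add: P_def)
  \<comment> \<open>For the whole loop the two connectors are the same path and cancel.\<close>
  moreover have "p 0 = p 1" using p(3) by (simp add: pathstart_def pathfinish_def)
  ultimately show "path_chain p \<in> ?span" by (simp add: piece_def)
qed

section \<open>Convex sets with at most one round hole\<close>

lemma spanned_convex: "convex S \<Longrightarrow> spanned S {} l"
  unfolding spanned_def
proof (intro allI impI, elim conjE)
  fix p assume p: "convex S" "path p" "path_image p \<subseteq> S" "pathfinish p = pathstart p"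
  have "homologous S (path_chain p) 0"
  proof (rule convex_cycle_null[OF p(1) singular_chain_path[OF p(2,3)]])
    show "chain_boundary 1 (path_chain p) = 0" unfolding chain_boundary_path p(4) by simp
  qed
  then show "path_chain p \<in> span_class S {} l" by (simp add: span_class_def)
qed

text \<open>Along the segment the distance to \<open>z\<close> is a convex combination of
  \<open>norm (x - z)\<close> and \<epsilon>, both at least \<epsilon>.\<close>

lemma segment_radial:
  fixes V :: "complex set"
  assumes V: "convex V" "cball z \<epsilon> \<subseteq> V" "0 < \<epsilon>" and x: "x \<in> V - ball z \<epsilon>"
  shows "closed_segment x (z + of_real (\<epsilon> / norm (x - z)) * (x - z)) \<subseteq> V - ball z \<epsilon>"
proof
  fix y assume y: "y \<in> closed_segment x (z + of_real (\<epsilon> / norm (x - z)) * (x - z))"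
  define r where "r = norm (x - z)"
  have r: "\<epsilon> \<le> r" using x by (simp add: r_def dist_norm norm_minus_commute)
  let ?y = "z + of_real (\<epsilon> / r) * (x - z)"
  have "norm (of_real (\<epsilon> / r) * (x - z)) = \<epsilon>"
    unfolding norm_mult norm_of_real r_def[symmetric] using r V(3) by simp
  then have "?y \<in> V" using V(2) by (auto simp: dist_norm)
  then have "y \<in> V" using y x closed_segment_subset[OF _ _ V(1), of x ?y] by (auto simp: r_def)
  moreover from y obtain t where t: "0 \<le> t" "t \<le> 1" "y = (1 - t) *\<^sub>R x + t *\<^sub>R ?y"
    by (auto simp: in_segment r_def)
  have "y - z = of_real ((1 - t) + t * (\<epsilon> / r)) * (x - z)"
    unfolding t(3) by (simp add: scaleR_conv_of_real algebra_simps)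
  then have "norm (y - z) = \<bar>(1 - t) + t * (\<epsilon> / r)\<bar> * r"
    unfolding r_def by (simp only: norm_mult norm_of_real)
  moreover have "\<bar>(1 - t) + t * (\<epsilon> / r)\<bar> = (1 - t) + t * (\<epsilon> / r)"
    using t r V(3) by simp
  moreover have "((1 - t) + t * (\<epsilon> / r)) * r = (1 - t) * r + t * \<epsilon>"
    using r V(3) by (simp add: field_simps)
  moreover have "(1 - t) * \<epsilon> + t * \<epsilon> \<le> (1 - t) * r + t * \<epsilon>"
    using t r by (intro add_right_mono mult_left_mono) auto
  ultimately show "y \<in> V - ball z \<epsilon>"
    by (simp add: dist_norm norm_minus_commute algebra_simps)
qed

lemma path_connected_convex_diff_ball:
  fixes V :: "complex set"
  assumes V: "convex V" "cball z \<epsilon> \<subseteq> V" "0 < \<epsilon>"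
  shows "path_connected (V - ball z \<epsilon>)"
proof -
  have sph: "path_connected (sphere z \<epsilon>)" by (rule path_connected_sphere) auto
  have sub: "sphere z \<epsilon> \<subseteq> V - ball z \<epsilon>" using V by auto
  have to_sphere: "\<exists>y\<in>sphere z \<epsilon>. path_component (V - ball z \<epsilon>) x y" if x: "x \<in> V - ball z \<epsilon>" for x
  proof
    let ?y = "z + of_real (\<epsilon> / norm (x - z)) * (x - z)"
    have "\<epsilon> \<le> norm (x - z)" using x by (simp add: dist_norm norm_minus_commute)
    then have "0 < norm (x - z)" using V(3) by linarith
    then have "norm (of_real (\<epsilon> / norm (x - z)) * (x - z)) = \<epsilon>"
      unfolding norm_mult norm_of_real using V(3) by simp
    then show "?y \<in> sphere z \<epsilon>" by (simp add: dist_norm)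
    show "path_component (V - ball z \<epsilon>) x ?y"
      unfolding path_component_def
      by (rule exI[of _ "linepath x ?y"]) (use segment_radial[OF V x] in simp)
  qed
  show ?thesis
    unfolding path_connected_component
  proof (intro ballI)
    fix x y assume "x \<in> V - ball z \<epsilon>" "y \<in> V - ball z \<epsilon>"
    then obtain x' y' where x': "x' \<in> sphere z \<epsilon>" "path_component (V - ball z \<epsilon>) x x'"
      and y': "y' \<in> sphere z \<epsilon>" "path_component (V - ball z \<epsilon>) y y'" using to_sphere by metis
    have "path_component (V - ball z \<epsilon>) x' y'"
      using sph x' y' path_component_of_subset[OF sub] unfolding path_connected_component by blast
    then show "path_component (V - ball z \<epsilon>) x y"
      using x' y' path_component_trans path_component_sym by meson
  qed
qed

text \<open>The class of the chain of \<open>f\<close> along a segment is additive and invariant under translation by 1.\<close>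

lemma circle_multiples:
  fixes S :: "complex set" and f :: "complex \<Rightarrow> complex"
  assumes f: "continuous_on UNIV f" "range f \<subseteq> S" "\<And>w. f (w + 1) = f w"
  shows "homologous S (path_chain (f \<circ> linepath a (a + of_int n))) (frag_cmul n (path_chain (f \<circ> linepath 0 1)))"
proof -
  have l: "singular_chain 1 (top_of_set UNIV) (path_chain (linepath x y))" for x y :: complex
    by (rule singular_chain_path) auto
  define F where "F = (\<lambda>(x :: complex) (y :: complex). path_chain (f \<circ> linepath x y))"
  have F: "path_chain (f \<circ> linepath x y) = F x y" for x y
    by (simp only: F_def)
  have tri: "homologous S (F x w) (F x y + F y w)" for x y w
  proof -
    have "homologous S (chain_map 1 f (path_chain (linepath x w) - (path_chain (linepath x y) + path_chain (linepath y w)))) 0"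
    proof (rule convex_image_cycle_null[of UNIV])
      show "singular_chain 1 (top_of_set UNIV) (path_chain (linepath x w) - (path_chain (linepath x y) + path_chain (linepath y w)))"
        by (intro singular_chain_add singular_chain_diff l)
      show "chain_boundary 1 (path_chain (linepath x w) - (path_chain (linepath x y) + path_chain (linepath y w))) = 0"
        unfolding chain_boundary_add chain_boundary_diff chain_boundary_path by simp
    qed (use f in auto)
    then show ?thesis
      unfolding chain_map_add chain_map_diff chain_map_path F by (simp add: homologous_rel_def)
  qed
  have per_nat: "f (w + of_nat k) = f w" for w and k :: nat
    by (induction k) (simp_all add: f(3) add.assoc[symmetric] add.commute[of 1])
  have per: "f (w + of_int k) = f w" for w and k :: int
    using per_nat[of "w + of_int k" "nat (- k)"] per_nat[of w "nat k"] by (cases "0 \<le> k") auto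
  have shift: "F (x + of_int k) (y + of_int k) = F x y" for x y and k :: int
    unfolding F_def
  proof (rule path_chain_cong)
    fix t
    have "linepath (x + of_int k) (y + of_int k) t = linepath x y t + of_int k"
      by (simp add: linepath_def algebra_simps scaleR_conv_of_real)
    then show "(f \<circ> linepath (x + of_int k) (y + of_int k)) t = (f \<circ> linepath x y) t"
      by (simp add: per)
  qed
  have null: "homologous S (F x x) 0" for x
  proof -
    have "f \<circ> linepath x x = (\<lambda>_. f x)" by (simp add: fun_eq_iff)
    moreover have "f x \<in> S" using f(2) by auto
    ultimately show ?thesis using homologous_const unfolding F_def by simp
  qed
  have nat: "homologous S (F 0 (of_int (int k))) (frag_cmul (int k) (F 0 1))" for k :: nat
  proof (induction k)
    case 0
    then show ?case using null[of 0] by simp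
  next
    case (Suc k)
    have "F (of_nat k) (of_int (int (Suc k))) = F 0 1"
      using shift[of 0 "int k" 1] by (simp add: add.commute)
    then have "homologous S (F 0 (of_int (int (Suc k)))) (F 0 (of_int (int k)) + F 0 1)"
      using tri[of 0 "of_int (int (Suc k))" "of_nat k"] by simp
    then show ?case
      using homologous_rel_trans[OF homologous_rel_add[OF Suc homologous_rel_refl[of 1 "top_of_set S" "{}" "F 0 1"]]]
      by (simp add: frag_cmul_distrib add.commute)
  qed
  have int: "homologous S (F 0 (of_int n)) (frag_cmul n (F 0 1))"
  proof (cases "0 \<le> n")
    case True
    then show ?thesis using nat[of "nat n"] by simp
  next
    case False
    define k where "k = nat (- n)"
    have n: "n = - int k" using False by (simp add: k_def)
    have sh: "F (of_int n) 0 = F 0 (of_int (int k))"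
      using shift[of "of_int n" "int k" 0] by (simp add: n)
    have "homologous S (F 0 0) (F 0 (of_int n) + F 0 (of_int (int k)))"
      using tri[of 0 0 "of_int n"] unfolding sh .
    then have "homologous S (F 0 (of_int n) + F 0 (of_int (int k))) 0"
      using null[of 0] homologous_rel_trans homologous_rel_sym by metis
    then have "homologous S (F 0 (of_int n)) (- F 0 (of_int (int k)))"
      by (simp add: homologous_rel_def)
    then show ?thesis
      using homologous_rel_trans[OF homologous_minus[OF nat[of k]]] by (simp add: n)
  qed
  \<comment> \<open>Both sums join 0 to \<open>a + of_int n\<close>, one through \<open>a\<close>
    and one through \<open>of_int n\<close>; the last leg of the second is a translate of
    \<open>F 0 a\<close>.\<close>
  have "homologous S (F 0 a + F a (a + of_int n)) (F 0 (of_int n) + F 0 a)"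
  proof -
    have "homologous S (F 0 (a + of_int n)) (F 0 (of_int n) + F 0 a)"
      using tri[of 0 "a + of_int n" "of_int n"] shift[of 0 n a] by simp
    then show ?thesis
      using tri[of 0 "a + of_int n" a] homologous_rel_trans homologous_rel_sym by metis
  qed
  then have "homologous S (F a (a + of_int n)) (F 0 (of_int n))"
    by (simp add: homologous_rel_def algebra_simps)
  then show ?thesis using int homologous_rel_trans unfolding F_def by metis
qed

lemma lookup_sum_frag:
  assumes "finite A"
  shows "Poly_Mapping.lookup (\<Sum>k\<in>A. frag_cmul (f k) (frag_of k)) l = (if l \<in> A then f l else 0)"
proof -
  have "Poly_Mapping.lookup (\<Sum>k\<in>A. frag_cmul (f k) (frag_of k)) l = (\<Sum>k\<in>A. if l = k then f k else 0)"
    unfolding lookup_sum by (rule sum.cong) auto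
  then show ?thesis using assms by simp
qed

lemma homologous_image_straight:
  fixes r :: "real \<Rightarrow> complex" and f :: "complex \<Rightarrow> complex"
  assumes r: "path r" and f: "continuous_on UNIV f" "range f \<subseteq> S"
  shows "homologous S (path_chain (f \<circ> r)) (path_chain (f \<circ> linepath (pathstart r) (pathfinish r)))"
proof -
  let ?c = "path_chain r - path_chain (linepath (pathstart r) (pathfinish r))"
  have "homologous S (chain_map 1 f ?c) 0"
  proof (rule convex_image_cycle_null[of UNIV])
    show "singular_chain 1 (top_of_set UNIV) ?c"
      by (intro singular_chain_diff singular_chain_path r) auto
    show "chain_boundary 1 ?c = 0"
      unfolding chain_boundary_diff chain_boundary_path by simp
  qed (use f in auto)
  then show ?thesis
    unfolding chain_map_diff chain_map_path by (simp add: homologous_rel_def)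
qed

text \<open>Radial projection deforms the loop into the circle. There it is the image under a
  periodic map of a path in the line, which may be replaced by the straight segment between its
  ends, that is, by whole turns.\<close>

lemma spanned_convex_diff_ball:
  assumes V: "convex V" "cball z \<epsilon> \<subseteq> V" "0 < \<epsilon>" and l: "l k = reversepath (circlepath z \<epsilon>)"
  shows "spanned (V - ball z \<epsilon>) {k} l"
  unfolding spanned_def
proof (intro allI impI, elim conjE)
  let ?S = "V - ball z \<epsilon>"
  fix p assume p: "path p" "path_image p \<subseteq> ?S" "pathfinish p = pathstart p"
  have pS: "p t \<in> ?S" if "t \<in> {0..1}" for t using p(2) that unfolding path_image_def by blast
  have "\<exists>g. continuous_on {0..1} g \<and> (\<forall>t\<in>{0..1}. p t - z = exp (g t))"
  proof (rule continuous_logarithm_on_contractible)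
    show "continuous_on {0..1} (\<lambda>t. p t - z)" using p(1) by (intro continuous_intros) (simp add: path_def)
    show "contractible {0..1::real}" by (rule convex_imp_contractible) simp
    show "p t - z \<noteq> 0" if "t \<in> {0..1}" for t using pS[OF that] V(3) by auto
  qed blast
  then obtain g where g: "continuous_on {0..1} g" "\<And>t. t \<in> {0..1} \<Longrightarrow> p t - z = exp (g t)" by blast
  \<comment> \<open>\<open>f\<close> runs once clockwise around the circle per unit of
    \<open>Re w\<close>, and \<open>r\<close> below is the clockwise angle of \<open>p\<close>
    measured in turns.\<close>
  define f where "f = (\<lambda>w. z + of_real \<epsilon> * exp (of_real (- 2 * pi * Re w) * \<i>))"
  define r where "r = (\<lambda>t. complex_of_real (- Im (g t) / (2 * pi)))"
  have contr: "continuous_on {0..1} r" unfolding r_def by (intro continuous_intros g) auto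
  have r: "path r" using contr by (simp add: path_def)
  have contf: "continuous_on UNIV f" unfolding f_def by (intro continuous_intros)
  have "norm (of_real \<epsilon> * exp (of_real u * \<i>)) = \<epsilon>" for u
    using V(3) by (simp add: norm_mult norm_exp_i_times mult.commute[of _ \<i>])
  then have "norm (f w - z) = \<epsilon>" for w by (simp only: f_def add_diff_cancel_left')
  then have "f w \<in> cball z \<epsilon> - ball z \<epsilon>" for w by (simp add: dist_norm norm_minus_commute)
  then have rangef: "range f \<subseteq> ?S" using V(2) by blast
  have fr: "f (r t) = z + of_real (\<epsilon> / norm (p t - z)) * (p t - z)" if t: "t \<in> {0..1}" for t
  proof -
    have "exp (g t) = of_real (exp (Re (g t))) * exp (of_real (Im (g t)) * \<i>)"
      by (subst exp_eq_polar) (simp only: cis_conv_exp mult.commute[of \<i>])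
    moreover have "f (r t) = z + of_real \<epsilon> * exp (of_real (Im (g t)) * \<i>)"
      by (simp add: f_def r_def)
    ultimately show ?thesis unfolding g(2)[OF t] norm_exp_eq_Re by simp
  qed
  have p01: "p 0 = p 1" using p(3) by (simp add: pathstart_def pathfinish_def)
  have pr: "homologous ?S (path_chain p) (path_chain (f \<circ> r))"
  proof (rule homologous_loops, rule homotopic_loops_linear)
    show "path (f \<circ> r)" by (rule path_continuous_image[OF r]) (rule continuous_on_subset[OF contf], simp)
    show "pathfinish (f \<circ> r) = pathstart (f \<circ> r)"
      using fr[of 0] fr[of 1] by (simp add: pathstart_def pathfinish_def p01)
    show "closed_segment (p t) ((f \<circ> r) t) \<subseteq> ?S" if "t \<in> {0..1}" for t
      using segment_radial[OF V pS[OF that]] fr[OF that] by simp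
  qed (use p in auto)
  have "homologous ?S (path_chain (f \<circ> r)) (path_chain (f \<circ> linepath (r 0) (r 1)))"
    using homologous_image_straight[OF r contf rangef] by (simp add: pathstart_def pathfinish_def)
  from homologous_rel_trans[OF this pr]
  have *: "homologous ?S (path_chain p) (path_chain (f \<circ> linepath (r 0) (r 1)))" .
  have "exp (g 1) = exp (g 0)" using g(2)[of 0] g(2)[of 1] p01 by simp
  then obtain n :: int where n: "g 1 = g 0 + (of_int (2 * n) * pi) * \<i>" by (auto simp: exp_eq)
  \<comment> \<open>\<open>n\<close> counts counterclockwise turns, hence the sign.\<close>
  have r1: "r 1 = r 0 + of_int (- n)"
    by (simp add: r_def n complex_eq_iff add_divide_distrib diff_divide_distrib)
  have f1: "f (w + 1) = f w" for w
  proof -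
    have "of_real (- 2 * pi * Re (w + 1)) * \<i> = of_real (- 2 * pi * Re w) * \<i> + (of_int (2 * (- 1)) * pi) * \<i>"
      by (simp add: algebra_simps)
    then have "exp (of_real (- 2 * pi * Re (w + 1)) * \<i>) = exp (of_real (- 2 * pi * Re w) * \<i>)"
      unfolding exp_eq by blast
    then show ?thesis by (simp only: f_def)
  qed
  have "path_chain (f \<circ> linepath 0 1) = path_chain (l k)"
  proof (rule path_chain_cong)
    fix t :: real
    have "2 * of_real pi * \<i> * of_real (1 - t) = of_real (- 2 * pi * t) * \<i> + (of_int (2 * 1) * pi) * \<i>"
      by (simp add: algebra_simps)
    then have "exp (2 * of_real pi * \<i> * of_real (1 - t)) = exp (of_real (- 2 * pi * t) * \<i>)"
      unfolding exp_eq by blast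
    then show "(f \<circ> linepath 0 1) t = l k t"
      by (simp add: l f_def linepath_def reversepath_def circlepath)
  qed
  moreover have "homologous ?S (path_chain (f \<circ> linepath (r 0) (r 1))) (frag_cmul (- n) (path_chain (f \<circ> linepath 0 1)))"
    unfolding r1 by (rule circle_multiples[OF contf rangef f1])
  ultimately have "homologous ?S (path_chain p) (frag_cmul (- n) (path_chain (l k)))"
    using * homologous_rel_trans by metis
  then have "homologous ?S (path_chain p) (\<Sum>x\<in>{k}. frag_cmul (- n) (path_chain (l x)))" by simp
  then show "path_chain p \<in> span_class ?S {k} l" unfolding span_class_def by (intro CollectI exI)
qed

lemma ball_q_Re:
  assumes "z \<in> ball (q m k) \<epsilon>"
  shows "Re z < real k / real (m + 1) + \<epsilon>" "real k / real (m + 1) - \<epsilon> < Re z"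
proof -
  have "\<bar>Re (q m k - z)\<bar> \<le> norm (q m k - z)" by (rule abs_Re_le_cmod)
  also have "\<dots> < \<epsilon>" using assms by (simp add: dist_norm)
  finally show "Re z < real k / real (m + 1) + \<epsilon>" "real k / real (m + 1) - \<epsilon> < Re z"
    by (simp_all add: q_def abs_less_iff)
qed

lemma cball_q_bounds:
  assumes "z \<in> cball (q m k) \<epsilon>"
  shows "Re z \<le> real k / real (m + 1) + \<epsilon>" "real k / real (m + 1) - \<epsilon> \<le> Re z"
    "Im z \<le> 1 / 2 + \<epsilon>" "1 / 2 - \<epsilon> \<le> Im z"
proof -
  have "norm (q m k - z) \<le> \<epsilon>" using assms by (simp add: dist_norm)
  then have "\<bar>Re (q m k - z)\<bar> \<le> \<epsilon>" "\<bar>Im (q m k - z)\<bar> \<le> \<epsilon>"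
    using abs_Re_le_cmod[of "q m k - z"] abs_Im_le_cmod[of "q m k - z"] by linarith+
  then show "Re z \<le> real k / real (m + 1) + \<epsilon>" "real k / real (m + 1) - \<epsilon> \<le> Re z"
    "Im z \<le> 1 / 2 + \<epsilon>" "1 / 2 - \<epsilon> \<le> Im z"
    by (simp_all add: q_def abs_le_iff)
qed

text \<open>The disk is covered from left to right by overlapping vertical strips with at most one hole each.\<close>

lemma spanned_punctured_disk:
  assumes \<epsilon>: "0 < \<epsilon>" "\<epsilon> < 1 / (2 * real (m + 1))" and m: "1 \<le> m"
  shows "spanned (punctured_disk m \<epsilon> i j) ({1..m} - {i, j}) (boundary_loop m \<epsilon>)"
proof -
  let ?K = "{1..m} - {i, j}" and ?l = "boundary_loop m \<epsilon>"
  \<comment> \<open>Half the distance of neighbouring marked points; \<open>\<epsilon> < h\<close>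
    leaves a gap between consecutive holes.\<close>
  define h where "h = 1 / (2 * real (m + 1))"
  define c where "c = (\<lambda>k. real k / real (m + 1))"
  have cSuc: "c (Suc n) = c n + 2 * h" for n
  proof -
    have "2 * (1 / (2 * x)) = 1 / x" for x :: real by simp
    then have h2: "2 * h = 1 / real (m + 1)" unfolding h_def .
    show ?thesis unfolding h2 c_def by (simp add: add_divide_distrib)
  qed
  have cmono: "c k \<le> c n" if "k \<le> n" for k n using that by (simp add: c_def divide_right_mono)
  have h: "\<epsilon> < h" "0 < h" using \<epsilon> by (simp_all add: h_def)
  have h4: "h \<le> 1 / 4" using m by (simp add: h_def field_simps)
  have cm: "c (Suc m) = 1" by (simp add: c_def)
  have c0: "0 \<le> c n" for n by (simp add: c_def)
  have cdef: "real k / real (m + 1) = c k" for k by (simp add: c_def)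
  note ball_Re = ball_q_Re[of _ m _ \<epsilon>, unfolded cdef] and cball_b = cball_q_bounds[of _ m _ \<epsilon>, unfolded cdef]
  \<comment> \<open>\<open>R n\<close> ends just before the hole at \<open>n + 1\<close>, so only
    holes up to \<open>n\<close> have to be removed.\<close>
  define R where "R = (\<lambda>n. {z \<in> D. Re z < c (Suc n) - \<epsilon>} - (\<Union>k\<in>?K \<inter> {..n}. ball (q m k) \<epsilon>))"
  have "spanned (R n) (?K \<inter> {..n}) ?l \<and> path_connected (R n)" if "n \<le> Suc m" for n
    using that
  proof (induction n)
    case 0
    have "convex (D \<inter> {z. Re z < c (Suc 0) - \<epsilon>})"
      by (intro convex_Int convex_D convex_halfspace_Re_lt)
    moreover have "?K \<inter> {..0} = {}" by auto
    moreover have "R 0 = D \<inter> {z. Re z < c (Suc 0) - \<epsilon>}" by (auto simp: R_def)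
    ultimately show ?case by (simp add: spanned_convex convex_imp_path_connected)
  next
    case (Suc n)
    then have IH: "spanned (R n) (?K \<inter> {..n}) ?l" "path_connected (R n)" and n: "n \<le> m" by auto
    \<comment> \<open>The strip from just right of position \<open>n\<close> to just left of
      position \<open>n + 2\<close>; the hole at \<open>n + 1\<close> is the only one it can
      meet.\<close>
    define V where "V = D \<inter> {z. c n + \<epsilon> < Re z} \<inter> {z. Re z < c (Suc (Suc n)) - \<epsilon>}"
    define H where "H = (if Suc n \<in> ?K then ball (q m (Suc n)) \<epsilon> else {})"
    have V: "convex V"
      unfolding V_def by (intro convex_Int convex_D convex_halfspace_Re_lt convex_halfspace_Re_gt)
    have before: "Re z < c n + \<epsilon>" if "z \<in> ball (q m k) \<epsilon>" "k \<le> n" for z k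
      using ball_Re(1)[OF that(1)] cmono[OF that(2)] by linarith
    have H_Re: "c (Suc n) - \<epsilon> < Re z" "Re z < c (Suc n) + \<epsilon>" if "z \<in> H" for z
      using that ball_Re[of z "Suc n"] by (auto simp: H_def split: if_splits)
    have K: "?K \<inter> {..Suc n} = (?K \<inter> {..n}) \<union> (if Suc n \<in> ?K then {Suc n} else {})"
      by (auto simp: le_Suc_eq)
    have balls: "(\<Union>k\<in>?K \<inter> {..Suc n}. ball (q m k) \<epsilon>) = (\<Union>k\<in>?K \<inter> {..n}. ball (q m k) \<epsilon>) \<union> H"
      unfolding K by (auto simp: H_def)
    have A: "R n = R (Suc n) \<inter> {z. Re z < c (Suc n) - \<epsilon>}"
      unfolding R_def balls using H_Re(1) cSuc[of "Suc n"] h by fastforce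
    have B: "V - H = R (Suc n) \<inter> {z. c n + \<epsilon> < Re z}"
      unfolding R_def balls V_def using before by fastforce
    have Un: "R (Suc n) = R n \<union> (V - H)"
      unfolding A B using cSuc[of n] h by auto
    \<comment> \<open>The overlap is the gap between two consecutive positions. It contains no hole
      and is convex.\<close>
    have AB: "R n \<inter> (V - H) = D \<inter> {z. c n + \<epsilon> < Re z} \<inter> {z. Re z < c (Suc n) - \<epsilon>}"
      unfolding A B unfolding R_def balls using before H_Re(1) cSuc[of "Suc n"] h by fastforce
    have "convex (R n \<inter> (V - H))"
      unfolding AB by (intro convex_Int convex_D convex_halfspace_Re_lt convex_halfspace_Re_gt)
    then have pAB: "path_connected (R n \<inter> (V - H))" by (rule convex_imp_path_connected)
    have "c n + 2 * h \<le> 1" using cmono[of "Suc n" "Suc m"] n by (simp add: cSuc[symmetric] cm)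
    then have x0: "Complex (c n + h) (1 / 2) \<in> R n \<inter> (V - H)"
      unfolding AB using h c0[of n] \<epsilon> cSuc[of n] by (simp add: D_def)
    have BH: "spanned (V - H) (if Suc n \<in> ?K then {Suc n} else {}) ?l \<and> path_connected (V - H)"
    proof (cases "Suc n \<in> ?K")
      case True
      then have "Suc n \<le> m" by auto
      then have c1: "c (Suc n) + 2 * h \<le> 1"
        using cmono[of "Suc (Suc n)" "Suc m"] by (simp add: cSuc[symmetric] cm)
      have "cball (q m (Suc n)) \<epsilon> \<subseteq> V"
      proof
        fix z assume "z \<in> cball (q m (Suc n)) \<epsilon>"
        note b = cball_b[OF this]
        have "0 \<le> Re z" "Re z \<le> 1" "0 \<le> Im z" "Im z \<le> 1" "c n + \<epsilon> < Re z" "Re z < c (Suc (Suc n)) - \<epsilon>"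
          using b c1 h h4 \<epsilon>(1) cSuc[of n] cSuc[of "Suc n"] c0[of n] by linarith+
        then show "z \<in> V" by (simp add: V_def D_def)
      qed
      from spanned_convex_diff_ball[OF V this \<epsilon>(1), of ?l "Suc n"] path_connected_convex_diff_ball[OF V this \<epsilon>(1)]
      show ?thesis using True by (simp add: H_def boundary_loop_def)
    next
      case False
      then show ?thesis using V by (simp only: H_def if_False Diff_empty spanned_convex convex_imp_path_connected)
    qed
    have "spanned (R (Suc n)) ((?K \<inter> {..n}) \<union> (if Suc n \<in> ?K then {Suc n} else {})) ?l"
    proof (rule spanned_Un[OF _ IH(2,1) _ _ _ Un pAB x0])
      show "openin (top_of_set (R (Suc n))) (R n)"
        unfolding A by (intro openin_open_Int open_halfspace_Re_lt)
      show "openin (top_of_set (R (Suc n))) (V - H)"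
        unfolding B by (intro openin_open_Int open_halfspace_Re_gt)
    qed (use BH in auto)
    moreover have "path_connected (R (Suc n))"
      unfolding Un using IH(2) BH x0 by (intro path_connected_Un) auto
    ultimately show ?case unfolding K by blast
  qed
  \<comment> \<open>One step past the last marked point is needed: \<open>R m\<close> stops at
    \<open>1 - \<epsilon>\<close>, while the bound for \<open>R (Suc m)\<close> exceeds 1.\<close>
  from this[of "Suc m"] have "spanned (R (Suc m)) (?K \<inter> {..Suc m}) ?l" by simp
  moreover have "?K \<inter> {..Suc m} = ?K" by auto
  moreover have "R (Suc m) = punctured_disk m \<epsilon> i j"
  proof -
    have "Re z < c (Suc (Suc m)) - \<epsilon>" if "z \<in> D" for z
      using that cSuc[of "Suc m"] cm h by (simp add: D_def)
    then show ?thesis unfolding R_def punctured_disk_def \<open>?K \<inter> {..Suc m} = ?K\<close> by blast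
  qed
  ultimately show ?thesis by simp
qed

lemma winding_number_boundary_loop:
  assumes "0 < \<epsilon>" "\<epsilon> < 1 / (2 * real (m + 1))"
  shows "winding_number (boundary_loop m \<epsilon> l) (q m k) = (if l = k then - 1 else 0)"
proof (cases "l = k")
  case True
  then show ?thesis
    using assms winding_number_circlepath_centre[of \<epsilon> "q m k"]
    by (simp add: boundary_loop_def winding_number_reversepath)
next
  case False
  have "1 / real (m + 1) \<le> \<bar>real l - real k\<bar> / real (m + 1)"
    using False by (intro divide_right_mono) auto
  then have "\<epsilon> < \<bar>real l - real k\<bar> / real (m + 1)" using assms by (simp add: field_simps)
  also have "\<dots> = dist (q m l) (q m k)"
    unfolding dist_norm q_diff norm_of_real by simp
  finally have out: "q m k \<notin> cball (q m l) \<epsilon>" by simp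
  have "winding_number (circlepath (q m l) \<epsilon>) (q m k) = 0"
    by (rule winding_number_zero_outside[of _ "cball (q m l) \<epsilon>"]) (use out assms in auto)
  moreover have "q m k \<notin> path_image (circlepath (q m l) \<epsilon>)" using out assms by auto
  ultimately show ?thesis using False by (simp add: boundary_loop_def winding_number_reversepath)
qed

lemma q_notin_punctured_disk:
  assumes "0 < \<epsilon>" "k \<in> {1..m} - {i, j}"
  shows "q m k \<notin> punctured_disk m \<epsilon> i j"
proof -
  have "q m k \<in> ball (q m k) \<epsilon>" using assms(1) by simp
  then show ?thesis unfolding punctured_disk_def using assms(2) by blast
qed

lemma chain_winding_boundary_loops:
  assumes "0 < \<epsilon>" "\<epsilon> < 1 / (2 * real (m + 1))" "finite K" "k \<in> K"
  shows "chain_winding (q m k) (\<Sum>l\<in>K. frag_cmul (v l) (path_chain (boundary_loop m \<epsilon> l))) = - of_int (v k)"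
proof -
  have "chain_winding (q m k) (\<Sum>l\<in>K. frag_cmul (v l) (path_chain (boundary_loop m \<epsilon> l)))
      = (\<Sum>l\<in>K. if l = k then - of_int (v l) else 0)"
    unfolding chain_winding_sum chain_winding_cmul chain_winding_path winding_number_boundary_loop[OF assms(1,2)]
    by (rule sum.cong) auto
  then show ?thesis using assms(3,4) by simp
qed

text \<open>The spanning loops supply some coefficients and the winding numbers around the holes
  force them, which gives the existence and the uniqueness that \<open>THE\<close> in
  \<open>to_H\<close> requires. The sign is negative because \<open>X k\<close> stands for a
  clockwise loop.\<close>

lemma to_H_loop:
  assumes \<epsilon>: "0 < \<epsilon>" "\<epsilon> < 1 / (2 * real (m + 1))" and m: "1 \<le> m"
    and p: "path p" "pathfinish p = pathstart p" "path_image p \<subseteq> punctured_disk m \<epsilon> i j"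
    and v: "\<And>k. k \<in> {1..m} - {i, j} \<Longrightarrow> of_int (v k) = - winding_number p (q m k)"
  shows "to_H m \<epsilon> i j (homology_class (punctured_disk m \<epsilon> i j) (path_chain p)) =
    (\<Sum>k\<in>{1..m} - {i, j}. frag_cmul (v k) (X k))"
proof -
  let ?K = "{1..m} - {i, j}" and ?S = "punctured_disk m \<epsilon> i j"
  let ?comb = "\<lambda>w. \<Sum>k\<in>?K. frag_cmul (w k) (path_chain (boundary_loop m \<epsilon> k))"
  have unique: "w k = v k" if "homologous ?S (path_chain p) (?comb w)" "k \<in> ?K" for w k
  proof -
    have "winding_number p (q m k) = - of_int (w k)"
      using chain_winding_homologous[OF that(1) q_notin_punctured_disk[OF \<epsilon>(1) that(2)]]
        chain_winding_boundary_loops[OF \<epsilon> _ that(2), of w]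
      by (simp add: chain_winding_path)
    then have "(of_int (v k) :: complex) = of_int (w k)" using v[OF that(2)] by simp
    then show ?thesis unfolding of_int_eq_iff by simp
  qed
  from spanned_punctured_disk[OF \<epsilon> m, of i j] p obtain w where w: "homologous ?S (path_chain p) (?comb w)"
    unfolding spanned_def span_class_def by blast
  have "?comb w = ?comb v" by (rule sum.cong) (use unique[OF w] in auto)
  with w have hom: "homologous ?S (path_chain p) (?comb v)" by simp
  define u0 where "u0 = (\<Sum>k\<in>?K. frag_cmul (v k) (X k))"
  have lu: "Poly_Mapping.lookup u0 k = (if k \<in> ?K then v k else 0)" for k
    unfolding u0_def by (rule lookup_sum_frag) simp
  have "to_H m \<epsilon> i j (homology_class ?S (path_chain p)) = u0"
    unfolding to_H_def
  proof (rule the_equality, intro conjI)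
    have "k \<in> ?K" if "k \<in> Poly_Mapping.keys u0" for k
      using that unfolding in_keys_iff lu by (meson)
    then show "u0 \<in> carrier (free_Abelian_group ?K)"
      unfolding carrier_free_Abelian_group_iff by blast
    have "?comb (Poly_Mapping.lookup u0) = ?comb v" by (rule sum.cong) (simp_all add: lu)
    then show "homology_class ?S (path_chain p) = homology_class ?S (?comb (Poly_Mapping.lookup u0))"
      unfolding homology_class_eq_iff using hom by simp
  next
    fix u assume u: "u \<in> carrier (free_Abelian_group ?K) \<and>
      homology_class ?S (path_chain p) = homology_class ?S (?comb (Poly_Mapping.lookup u))"
    then have "homologous ?S (path_chain p) (?comb (Poly_Mapping.lookup u))"
      unfolding homology_class_eq_iff by blast
    note eq = unique[OF this]
    have "Poly_Mapping.lookup u k = 0" if "k \<notin> ?K" for k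
      using that u unfolding carrier_free_Abelian_group_iff in_keys_iff[symmetric, of u] 
      by (metis in_keys_iff subsetD)
    then show "u = u0"
      using eq by (intro poly_mapping_eqI) (metis lu)
  qed
  then show ?thesis by (simp only: u0_def)
qed

section \<open>Signed crossings with a ray\<close>

text \<open>Near \<open>t\<close> the values differ from \<open>F t\<close> by less than 1, and an
  integer of absolute value below 1 is 0.\<close>

lemma eventually_eq_of_integer_differences:
  fixes F :: "real \<Rightarrow> real"
  assumes "continuous (at t within A) F" "t \<in> A" "\<And>s. s \<in> A \<Longrightarrow> F s - F t \<in> \<int>"
  shows "\<forall>\<^sub>F s in at t within A. F s = F t"
proof -
  have "\<forall>\<^sub>F s in at t within A. dist (F s) (F t) < 1"
    using assms(1) unfolding continuous_within by (rule tendstoD) simp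
  moreover have "\<forall>\<^sub>F s in at t within A. s \<in> A"
    unfolding eventually_at_filter by simp
  ultimately show ?thesis
  proof eventually_elim
    case (elim s)
    then have "F s - F t = 0"
      by (intro Ints_nonzero_abs_less1 assms(3)) (simp_all add: dist_real_def)
    then show ?case by simp
  qed
qed

lemma eventually_at_sides:
  fixes t :: real
  assumes "\<forall>\<^sub>F s in at_left t. P s" "\<forall>\<^sub>F s in at_right t. P' s"
  shows "\<forall>\<^sub>F s in at t within A. (s < t \<longrightarrow> P s) \<and> (t < s \<longrightarrow> P' s)"
  using assms unfolding eventually_at_filter by eventually_elim auto

text \<open>\<open>x - a\<close> and \<open>y - b\<close> are both logarithms of \<open>c\<close>,
  so they differ by a multiple of 2 pi i.\<close>

lemma log_branch_integer:
  assumes "exp x = c * exp a" "exp y = c * exp b" "c \<noteq> 0"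
  shows "(Im x - Im a) / (2 * pi) - (Im y - Im b) / (2 * pi) \<in> \<int>"
proof -
  have "exp (x - a) = exp (y - b)" using assms by (simp add: exp_diff)
  then obtain n :: int where "x - a = y - b + (of_int (2 * n) * pi) * \<i>" by (auto simp: exp_eq)
  then have "Im (x - a) = Im (y - b + (of_int (2 * n) * pi) * \<i>)" by simp
  then have "(Im x - Im a) - (Im y - Im b) = 2 * pi * of_int n" by simp
  then have "((Im x - Im a) - (Im y - Im b)) / (2 * pi) = of_int n" by simp
  then show ?thesis by (simp add: diff_divide_distrib)
qed

text \<open>The branch of \<open>Ln (\<i> * (p t - z))\<close> jumps by \<open>2 * pi\<close> when \<open>p\<close> crosses the upward ray from \<open>z\<close>
  rightwards and by \<open>- 2 * pi\<close> when it crosses leftwards.\<close>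

lemma winding_number_ray_crossings:
  fixes p :: "real \<Rightarrow> complex" and z :: complex
  defines "T \<equiv> {t \<in> {0..1}. Re (p t) = Re z \<and> Im z \<le> Im (p t)}"
  assumes p: "path p" "pathfinish p = pathstart p" "z \<notin> path_image p"
    and T: "finite T" "0 \<notin> T" "1 \<notin> T"
    and cross: "\<And>t. t \<in> T \<Longrightarrow> crosses_rightwards p t \<or> crosses_leftwards p t"
  shows "winding_number p z =
    - of_int (int (card {t \<in> T. crosses_rightwards p t}) - int (card {t \<in> T. crosses_leftwards p t}))"
proof -
  let ?I = "{0..1::real}"
  have contp: "continuous_on ?I p" using p(1) by (simp add: path_def)
  have pz: "p t \<noteq> z" if "t \<in> ?I" for t using p(3) that unfolding path_image_def by blast
  have "\<exists>g. continuous_on ?I g \<and> (\<forall>t\<in>?I. p t - z = exp (g t))"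
  proof (rule continuous_logarithm_on_contractible)
    show "continuous_on ?I (\<lambda>t. p t - z)" by (intro continuous_intros contp)
    show "contractible ?I" by (rule convex_imp_contractible) simp
    show "p t - z \<noteq> 0" if "t \<in> ?I" for t using pz[OF that] by simp
  qed blast
  then obtain g where g: "continuous_on ?I g" "\<And>t. t \<in> ?I \<Longrightarrow> p t - z = exp (g t)" by blast
  \<comment> \<open>The factor \<open>\<i>\<close> turns the upward ray onto the cut of
    \<open>Ln\<close>.\<close>
  define w where "w = (\<lambda>t. \<i> * (p t - z))"
  have wnz: "w t \<noteq> 0" if "t \<in> ?I" for t using pz[OF that] by (simp add: w_def)
  have contw: "continuous_on ?I w" unfolding w_def by (intro continuous_intros contp)
  have Rew: "Re (w t) = Im z - Im (p t)" and Imw: "Im (w t) = Re (p t) - Re z" for t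
    by (simp_all add: w_def)
  have ray: "w t \<in> \<real>\<^sub>\<le>\<^sub>0 \<longleftrightarrow> t \<in> T" if "t \<in> ?I" for t
    using that by (auto simp: complex_nonpos_Reals_iff Rew Imw T_def)
  \<comment> \<open>\<open>f\<close> compares the principal branch with the continuous logarithm
    \<open>g\<close> and is locally constant off the ray; \<open>f'\<close> uses the opposite cut
    and is locally constant at the ray. They differ by 1/2, with a sign that tells the side.\<close>
  define f f' where "f = (\<lambda>t. (Im (Ln (w t)) - Im (g t)) / (2 * pi))"
    and "f' = (\<lambda>t. (Im (Ln (- w t)) - Im (g t)) / (2 * pi))"
  have fint: "f s - f t \<in> \<int>" "f' s - f' t \<in> \<int>" if "s \<in> ?I" "t \<in> ?I" for s t
  proof -
    show "f s - f t \<in> \<int>" unfolding f_def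
      by (rule log_branch_integer[of _ \<i>]) (use that wnz in \<open>simp_all add: w_def g(2)\<close>)
    show "f' s - f' t \<in> \<int>" unfolding f'_def
      by (rule log_branch_integer[of _ "- \<i>"]) (use that wnz in \<open>simp_all add: w_def g(2)\<close>)
  qed
  have ff'1: "f t = f' t + 1 / 2" if "t \<in> ?I" "Re z < Re (p t) \<or> t \<in> T" for t
  proof -
    have "\<not> (Im (w t) \<le> 0 \<and> \<not> (Re (w t) < 0 \<and> Im (w t) = 0))"
      using that ray[OF that(1)] wnz[OF that(1)] by (auto simp: Imw complex_nonpos_Reals_iff complex_eq_iff)
    then have "Ln (- w t) = Ln (w t) - \<i> * pi" using Ln_minus[OF wnz[OF that(1)]] by (simp only: if_False)
    then have "Im (Ln (- w t)) = Im (Ln (w t)) - pi" by simp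
    then show ?thesis by (simp add: f_def f'_def field_simps)
  qed
  have ff'2: "f t = f' t - 1 / 2" if "t \<in> ?I" "Re (p t) < Re z" for t
  proof -
    have "Im (w t) \<le> 0 \<and> \<not> (Re (w t) < 0 \<and> Im (w t) = 0)" using that by (auto simp: Imw)
    then have "Ln (- w t) = Ln (w t) + \<i> * pi" using Ln_minus[OF wnz[OF that(1)]] by (simp only: if_True simp_thms)
    then have "Im (Ln (- w t)) = Im (Ln (w t)) + pi" by simp
    then show ?thesis by (simp add: f_def f'_def field_simps)
  qed
  have cont_at: "continuous (at t within ?I) g" "continuous (at t within ?I) w" if "t \<in> ?I" for t
    using g(1) contw that by (auto simp: continuous_on_eq_continuous_within)
  have f_loc: "\<forall>\<^sub>F s in at t within ?I. f s = f t" if "t \<in> ?I" "t \<notin> T" for t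
  proof (rule eventually_eq_of_integer_differences)
    have "w t \<notin> \<real>\<^sub>\<le>\<^sub>0" using ray that by blast
    then have "continuous (at t within ?I) (\<lambda>t. Ln (w t))"
      using cont_at(2)[OF that(1)] by (intro continuous_within_compose3[OF continuous_at_Ln])
    then show "continuous (at t within ?I) f"
      unfolding f_def using cont_at(1)[OF that(1)] by (intro continuous_intros) auto
  qed (use that fint in auto)
  have f'_loc: "\<forall>\<^sub>F s in at t within ?I. f' s = f' t" if "t \<in> T" for t
  proof (rule eventually_eq_of_integer_differences)
    have tI: "t \<in> ?I" using that by (simp add: T_def)
    have "w t \<in> \<real>\<^sub>\<le>\<^sub>0" "w t \<noteq> 0" using ray[OF tI] that wnz[OF tI] by auto
    then have "- w t \<notin> \<real>\<^sub>\<le>\<^sub>0" by (auto simp: complex_nonpos_Reals_iff complex_eq_iff)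
    then have "continuous (at t within ?I) (\<lambda>t. Ln (- w t))"
      using cont_at(2)[OF tI] by (intro continuous_within_compose3[OF continuous_at_Ln] continuous_minus)
    then show "continuous (at t within ?I) f'"
      unfolding f'_def using cont_at(1)[OF tI] by (intro continuous_intros) auto
    show "t \<in> ?I" by (rule tI)
    show "f' s - f' t \<in> \<int>" if "s \<in> ?I" for s using fint(2)[OF that tI] .
  qed
  define R L where "R = {t \<in> T. crosses_rightwards p t}" and "L = {t \<in> T. crosses_leftwards p t}"
  have fin: "finite R" "finite L" using T(1) by (simp_all add: R_def L_def)
  \<comment> \<open>On its cut \<open>Ln\<close> continues the values from the right-hand side of
    the ray. So \<open>f\<close> jumps on arrival at a rightward crossing, counted with \<le>, and
    on departure from a leftward one, counted with <. The corrected function is locally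
    constant.\<close>
  define F where "F = (\<lambda>t. f t - real (card {\<tau> \<in> R. \<tau> \<le> t}) + real (card {\<tau> \<in> L. \<tau> < t}))"
  have "F 0 = F 1"
  proof (rule connected_local_const[where f = F and A = ?I])
    show "\<forall>t\<in>?I. \<forall>\<^sub>F s in at t within ?I. F t = F s"
    proof
      fix t assume t: "t \<in> ?I"
      obtain d where d: "0 < d" "\<And>\<tau>. \<tau> \<in> T \<Longrightarrow> \<tau> \<noteq> t \<Longrightarrow> d \<le> dist t \<tau>"
        using finite_set_avoid[OF T(1), of t] by blast
      have near: "\<forall>\<^sub>F s in at t within ?I. s \<in> ?I \<and> s \<noteq> t \<and> dist s t < d"
        unfolding eventually_at using d(1) by blast
      have ord: "\<tau> < s \<longleftrightarrow> \<tau> < t" "\<tau> \<le> s \<longleftrightarrow> \<tau> \<le> t"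
        if "\<tau> \<in> T" "\<tau> \<noteq> t" "dist s t < d" for \<tau> s
        using d(2)[OF that(1,2)] that by (auto simp: dist_real_def abs_if split: if_splits)
      show "\<forall>\<^sub>F s in at t within ?I. F t = F s"
      proof (cases "t \<in> T")
        case False
        from f_loc[OF t False] near show ?thesis
        proof eventually_elim
          case (elim s)
          have "{\<tau> \<in> R. \<tau> \<le> s} = {\<tau> \<in> R. \<tau> \<le> t}" "{\<tau> \<in> L. \<tau> < s} = {\<tau> \<in> L. \<tau> < t}"
            using ord False elim by (auto simp: R_def L_def)
          then show ?case using elim by (simp add: F_def)
        qed
      next
        case True
        have Ret: "Re (p t) = Re z" using True by (simp add: T_def)
        have f't: "f t = f' t + 1 / 2" using ff'1[OF t] True by blast
        show ?thesis
        proof (cases "crosses_rightwards p t")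
          case right: True
          then have ev: "\<forall>\<^sub>F s in at t within ?I. (s < t \<longrightarrow> Re (p s) < Re z) \<and> (t < s \<longrightarrow> Re z < Re (p s))"
            unfolding crosses_rightwards_def Ret by (elim conjE) (rule eventually_at_sides)
          have notleft: "t \<notin> L"
          proof
            assume "t \<in> L"
            then have "\<forall>\<^sub>F s in at_left t. Re (p s) > Re (p t)" by (simp add: L_def crosses_leftwards_def)
            moreover have "\<forall>\<^sub>F s in at_left t. Re (p s) < Re (p t)" using right by (simp add: crosses_rightwards_def)
            ultimately have "\<forall>\<^sub>F s in at_left t. False" by eventually_elim auto
            then show False by (simp add: trivial_limit_at_left_real)
          qed
          from f'_loc[OF True] ev near show ?thesis
          proof eventually_elim
            case (elim s)
            have L: "{\<tau> \<in> L. \<tau> < s} = {\<tau> \<in> L. \<tau> < t}"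
              using ord[of _ s] notleft elim by (auto simp: L_def)
            show ?case
            proof (cases "s < t")
              case True
              have "{\<tau> \<in> R. \<tau> \<le> t} = insert t {\<tau> \<in> R. \<tau> \<le> s}"
                using ord[of _ s] elim True \<open>t \<in> T\<close> right by (auto simp: R_def)
              moreover have "t \<notin> {\<tau> \<in> R. \<tau> \<le> s}" using True by simp
              ultimately have "card {\<tau> \<in> R. \<tau> \<le> t} = Suc (card {\<tau> \<in> R. \<tau> \<le> s})" using fin by simp
              moreover have "f s = f' s - 1 / 2" using elim True by (intro ff'2) auto
              ultimately show ?thesis using elim by (simp add: F_def L f't)
            next
              case False
              then have st: "t < s" using elim by auto
              have "{\<tau> \<in> R. \<tau> \<le> t} = {\<tau> \<in> R. \<tau> \<le> s}"
                using ord[of _ s] elim st by (auto simp: R_def)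
              moreover have "f s = f' s + 1 / 2" using elim st by (intro ff'1) auto
              ultimately show ?thesis using elim by (simp add: F_def L f't)
            qed
          qed
        next
          case False
          then have left: "crosses_leftwards p t" using cross[OF True] by blast
          then have ev: "\<forall>\<^sub>F s in at t within ?I. (s < t \<longrightarrow> Re z < Re (p s)) \<and> (t < s \<longrightarrow> Re (p s) < Re z)"
            unfolding crosses_leftwards_def Ret by (elim conjE) (rule eventually_at_sides)
          have notright: "t \<notin> R" using False by (simp add: R_def)
          from f'_loc[OF True] ev near show ?thesis
          proof eventually_elim
            case (elim s)
            have R: "{\<tau> \<in> R. \<tau> \<le> s} = {\<tau> \<in> R. \<tau> \<le> t}"
              using ord[of _ s] notright elim by (auto simp: R_def)
            show ?case
            proof (cases "s < t")
              case True
              have "{\<tau> \<in> L. \<tau> < s} = {\<tau> \<in> L. \<tau> < t}"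
                using ord[of _ s] elim True by (auto simp: L_def)
              moreover have "f s = f' s + 1 / 2" using elim True by (intro ff'1) auto
              ultimately show ?thesis using elim by (simp add: F_def R f't)
            next
              case False
              then have st: "t < s" using elim by auto
              have "{\<tau> \<in> L. \<tau> < s} = insert t {\<tau> \<in> L. \<tau> < t}"
                using ord[of _ s] elim st \<open>t \<in> T\<close> left by (auto simp: L_def)
              moreover have "t \<notin> {\<tau> \<in> L. \<tau> < t}" by simp
              ultimately have "card {\<tau> \<in> L. \<tau> < s} = Suc (card {\<tau> \<in> L. \<tau> < t})" using fin by simp
              moreover have "f s = f' s - 1 / 2" using elim st by (intro ff'2) auto
              ultimately show ?thesis using elim by (simp add: F_def R f't)
            qed
          qed
        qed
      qed
    qed
  qed auto
  moreover have "F 0 = f 0"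
  proof -
    have "{\<tau> \<in> R. \<tau> \<le> 0} = {}" "{\<tau> \<in> L. \<tau> < 0} = {}"
      using T(2) by (auto simp: R_def L_def T_def)
    then show ?thesis unfolding F_def by (simp only: card.empty)
  qed
  moreover have "F 1 = f 1 - real (card R) + real (card L)"
  proof -
    have "{\<tau> \<in> R. \<tau> \<le> 1} = R" by (auto simp: R_def T_def)
    moreover have "\<tau> < 1" if "\<tau> \<in> L" for \<tau>
      using that T(3) by (cases "\<tau> = 1") (auto simp: L_def T_def)
    then have "{\<tau> \<in> L. \<tau> < 1} = L" by blast
    ultimately show ?thesis by (simp add: F_def)
  qed
  moreover have p01: "p 0 = p 1" using p(2) by (simp add: pathstart_def pathfinish_def)
  moreover have "f 1 - f 0 = - ((Im (g 1) - Im (g 0)) / (2 * pi))"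
    by (simp add: f_def w_def p01 diff_divide_distrib)
  ultimately have Im: "(Im (g 1) - Im (g 0)) / (2 * pi) = - (real (card R) - real (card L))" by simp
  have "exp (g 1) = exp (g 0)" using g(2)[of 0] g(2)[of 1] p01 by simp
  then have "norm (exp (g 1)) = norm (exp (g 0))" by simp
  then have "Re (g 1) = Re (g 0)" by simp
  then have "g 1 - g 0 = \<i> * of_real (Im (g 1) - Im (g 0))" by (simp add: complex_eq_iff)
  then have "\<i> * (2 * pi * winding_number p z) = \<i> * of_real (Im (g 1) - Im (g 0))"
    using winding_number_continuous_log[OF p(1) g] by (simp add: mult_ac)
  then have "2 * pi * winding_number p z = of_real (Im (g 1) - Im (g 0))"
    by (rule mult_left_cancel[THEN iffD1, rotated]) simp
  then have "winding_number p z = of_real ((Im (g 1) - Im (g 0)) / (2 * pi))"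
    by (simp add: field_simps)
  also have "\<dots> = - of_int (int (card R) - int (card L))" unfolding Im by simp
  finally show ?thesis by (simp add: R_def L_def)
qed

section \<open>Transverse loops by polynomial approximation\<close>

lemma real_polynomial_function_poly:
  fixes f :: "real \<Rightarrow> real"
  assumes "real_polynomial_function f"
  obtains P where "f = poly P"
proof -
  obtain a n where "f = (\<lambda>x. \<Sum>i\<le>n. a i * x ^ i)"
    using assms unfolding real_polynomial_function_iff_sum by blast
  then have "f = poly (\<Sum>i\<le>n. Polynomial.monom (a i) i)" by (simp add: poly_sum poly_monom fun_eq_iff)
  then show thesis by (rule that)
qed

text \<open>An elementary case of Sard's theorem: a nonzero derivative has finitely many roots, and
  otherwise the polynomial is constant.\<close>

lemma finite_critical_values:
  fixes P :: "real poly"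
  shows "finite (poly P ` {t. poly (pderiv P) t = 0})"
proof (cases "pderiv P = 0")
  case True
  then have "degree P = 0" by (simp add: pderiv_eq_0_iff)
  then obtain a where "P = [:a:]" by (rule degree_eq_zeroE)
  then have "poly P ` {t. poly (pderiv P) t = 0} \<subseteq> {a}" by auto
  then show ?thesis by (rule finite_subset) simp
next
  case False
  then show ?thesis by (intro finite_imageI poly_roots_finite)
qed

lemma crosses_regular:
  fixes G :: "real \<Rightarrow> real"
  assumes d: "DERIV G t :> l" "l \<noteq> 0" and p: "\<And>s. Re (p s) = G s + c"
  shows "crosses_rightwards p t \<or> crosses_leftwards p t"
proof (cases "0 < l")
  case True
  obtain d1 d2 where d1: "0 < d1" "\<forall>h>0. h < d1 \<longrightarrow> G t < G (t + h)"
    and d2: "0 < d2" "\<forall>h>0. h < d2 \<longrightarrow> G (t - h) < G t"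
    using DERIV_pos_inc_right[OF d(1) True] DERIV_pos_inc_left[OF d(1) True] by blast
  have "\<forall>\<^sub>F s in at_right t. Re (p t) < Re (p s)"
    unfolding eventually_at_right_field
  proof (intro exI[of _ "t + d1"] conjI allI impI)
    fix s assume "t < s" "s < t + d1"
    then show "Re (p t) < Re (p s)" using d1(2)[rule_format, of "s - t"] by (simp add: p)
  qed (use d1 in simp)
  moreover have "\<forall>\<^sub>F s in at_left t. Re (p s) < Re (p t)"
    unfolding eventually_at_left_field
  proof (intro exI[of _ "t - d2"] conjI allI impI)
    fix s assume "t - d2 < s" "s < t"
    then show "Re (p s) < Re (p t)" using d2(2)[rule_format, of "t - s"] by (simp add: p)
  qed (use d2 in simp)
  ultimately show ?thesis by (simp add: crosses_rightwards_def)
next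
  case False
  then have neg: "l < 0" using d(2) by simp
  obtain d1 d2 where d1: "0 < d1" "\<forall>h>0. h < d1 \<longrightarrow> G t > G (t + h)"
    and d2: "0 < d2" "\<forall>h>0. h < d2 \<longrightarrow> G t < G (t - h)"
    using DERIV_neg_dec_right[OF d(1) neg] DERIV_neg_dec_left[OF d(1) neg] by blast
  have "\<forall>\<^sub>F s in at_right t. Re (p s) < Re (p t)"
    unfolding eventually_at_right_field
  proof (intro exI[of _ "t + d1"] conjI allI impI)
    fix s assume "t < s" "s < t + d1"
    then show "Re (p s) < Re (p t)" using d1(2)[rule_format, of "s - t"] by (simp add: p)
  qed (use d1 in simp)
  moreover have "\<forall>\<^sub>F s in at_left t. Re (p t) < Re (p s)"
    unfolding eventually_at_left_field
  proof (intro exI[of _ "t - d2"] conjI allI impI)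
    fix s assume "t - d2 < s" "s < t"
    then show "Re (p t) < Re (p s)" using d2(2)[rule_format, of "t - s"] by (simp add: p)
  qed (use d2 in simp)
  ultimately show ?thesis by (simp add: crosses_leftwards_def)
qed

text \<open>A polynomial approximation, translated horizontally such that the abscissa \<open>x0\<close> becomes a regular value.\<close>

lemma transverse_approximation:
  fixes p :: "real \<Rightarrow> complex"
  assumes p: "path p" "pathfinish p = pathstart p" and U: "open U" "path_image p \<subseteq> U"
  obtains r where "path r" "pathfinish r = pathstart r" "path_image r \<subseteq> U" "homotopic_loops U p r"
    "finite {t \<in> {0..1}. Re (r t) = x0}" "Re (pathstart r) \<noteq> x0"
    "\<And>t. Re (r t) = x0 \<Longrightarrow> crosses_rightwards r t \<or> crosses_leftwards r t"
proof -
  obtain e where e: "0 < e" "\<And>h. path h \<Longrightarrow> pathfinish h = pathstart h \<Longrightarrow>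
      (\<And>t. t \<in> {0..1} \<Longrightarrow> norm (h t - p t) < e) \<Longrightarrow> homotopic_loops U p h"
    using homotopic_nearby_loops[OF p(1) U p(2)] by blast
  have "0 < e / 2" using e(1) by simp
  then obtain g where g: "polynomial_function g" "pathstart g = pathstart p" "pathfinish g = pathfinish p"
    "\<And>t. t \<in> {0..1} \<Longrightarrow> norm (g t - p t) < e / 2"
    using path_approx_polynomial_function[OF p(1)] by blast
  have "real_polynomial_function (Re \<circ> g)"
    using g(1) bounded_linear_Re by (simp add: polynomial_function_def)
  then obtain P where P: "Re \<circ> g = poly P" by (rule real_polynomial_function_poly)
  have Pt: "Re (g t) = poly P t" for t using fun_cong[OF P, of t] by simp
  \<comment> \<open>Besides the critical values the initial value is excluded, since a transverse
    loop may not start on the segment it crosses.\<close>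
  define Bad where "Bad = insert (poly P 0) (poly P ` {t. poly (pderiv P) t = 0})"
  have "finite ((\<lambda>y. x0 - y) ` Bad)" unfolding Bad_def using finite_critical_values by simp
  moreover have "infinite {0<..<e / 2}" using e(1) by (simp add: infinite_Ioo)
  ultimately have "{0<..<e / 2} - (\<lambda>y. x0 - y) ` Bad \<noteq> {}"
    using Diff_infinite_finite infinite_imp_nonempty by blast
  then obtain \<delta> where "\<delta> \<in> {0<..<e / 2} - (\<lambda>y. x0 - y) ` Bad" by blast
  then have \<delta>: "0 < \<delta>" "\<delta> < e / 2" "\<delta> \<notin> (\<lambda>y. x0 - y) ` Bad"
    unfolding greaterThanLessThan_iff Diff_iff by blast+
  have bad: "x0 - \<delta> \<notin> Bad"
  proof
    assume "x0 - \<delta> \<in> Bad"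
    then have "x0 - (x0 - \<delta>) \<in> (\<lambda>y. x0 - y) ` Bad" by (rule imageI)
    then show False using \<delta>(3) by simp
  qed
  define r where "r = (\<lambda>t. g t + of_real \<delta>)"
  have Re_r: "Re (r t) = poly P t + \<delta>" for t by (simp add: r_def Pt)
  have level: "Re (r t) = x0 \<longleftrightarrow> poly P t = x0 - \<delta>" for t by (auto simp: Re_r)
  have contg: "continuous_on {0..1} g" using continuous_on_polymonial_function[OF g(1)] .
  have r: "path r" unfolding path_def r_def by (intro continuous_intros contg)
  have loop: "pathfinish r = pathstart r"
    using g(2,3) p(2) by (simp add: r_def pathfinish_def pathstart_def)
  have hom: "homotopic_loops U p r"
  proof (rule e(2)[OF r loop])
    fix t :: real assume "t \<in> {0..1}"
    then have "norm (g t - p t) < e / 2" by (rule g(4))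
    moreover have "norm (r t - p t) \<le> norm (g t - p t) + norm (complex_of_real \<delta>)"
      unfolding r_def by (metis add_diff_eq add.commute diff_add_eq norm_triangle_ineq)
    ultimately show "norm (r t - p t) < e" using \<delta> by simp
  qed
  have "P - [:x0 - \<delta>:] \<noteq> 0"
  proof
    assume "P - [:x0 - \<delta>:] = 0"
    then have "poly P 0 = x0 - \<delta>" by simp
    then show False using bad by (simp add: Bad_def)
  qed
  then have "finite {t. poly (P - [:x0 - \<delta>:]) t = 0}" by (rule poly_roots_finite)
  then have fin: "finite {t \<in> {0..1}. Re (r t) = x0}"
    by (rule rev_finite_subset) (auto simp: level)
  have start: "Re (pathstart r) \<noteq> x0"
    using bad by (auto simp: pathstart_def level Bad_def)
  have cross: "crosses_rightwards r t \<or> crosses_leftwards r t" if "Re (r t) = x0" for t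
  proof (rule crosses_regular[OF poly_DERIV])
    show "poly (pderiv P) t \<noteq> 0"
      using that bad unfolding level Bad_def by (metis (mono_tags) imageI insertCI mem_Collect_eq)
  qed (rule Re_r)
  show thesis
    by (rule that[OF r loop _ hom fin start cross]) (use homotopic_loops_imp_subset[OF hom] in auto)
qed

text \<open>Inside the disk the segment is the whole upward ray from the marked point, so the ray
  formula for winding numbers applies to it.\<close>

lemma mem_zeta_iff:
  assumes "w \<in> punctured_disk m \<epsilon> i j" "k \<in> {1..m} - {i, j}" "0 < \<epsilon>"
  shows "w \<in> \<zeta> m \<epsilon> i j k \<longleftrightarrow> Re w = Re (q m k) \<and> Im (q m k) \<le> Im w"
proof -
  have "Im w \<le> 1" using assms(1) by (simp add: punctured_disk_def D_def)
  moreover have "closed_segment (q m k) (Complex (real k / real (m + 1)) 1) =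
      {z. Re z = Re (q m k) \<and> Im z \<in> closed_segment (1 / 2) 1}"
    by (subst closed_segment_same_Re) (simp_all add: q_def)
  ultimately show ?thesis
    unfolding \<zeta>_def using assms(1) by (simp add: closed_segment_eq_real_ivl q_def)
qed

lemma signed_crossings_winding:
  assumes p: "path p" "pathfinish p = pathstart p" "path_image p \<subseteq> punctured_disk m \<epsilon> i j"
    and k: "k \<in> {1..m} - {i, j}" and \<epsilon>: "0 < \<epsilon>" and tr: "transverse p (\<zeta> m \<epsilon> i j k)"
  shows "winding_number p (q m k) = - of_int (signed_crossings p (\<zeta> m \<epsilon> i j k))"
proof -
  let ?A = "\<zeta> m \<epsilon> i j k"
  have pS: "p t \<in> punctured_disk m \<epsilon> i j" if "t \<in> {0..1}" for t
    using p(3) that unfolding path_image_def by blast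
  have A: "p t \<in> ?A \<longleftrightarrow> Re (p t) = Re (q m k) \<and> Im (q m k) \<le> Im (p t)" if "t \<in> {0..1}" for t
    by (rule mem_zeta_iff[OF pS[OF that] k \<epsilon>])
  let ?T = "{t \<in> {0..1}. Re (p t) = Re (q m k) \<and> Im (q m k) \<le> Im (p t)}"
  have T: "?T = {t \<in> {0..1}. p t \<in> ?A}" using A by blast
  have "winding_number p (q m k) = - of_int (int (card {t \<in> ?T. crosses_rightwards p t})
      - int (card {t \<in> ?T. crosses_leftwards p t}))"
  proof (rule winding_number_ray_crossings[OF p(1,2)])
    show "q m k \<notin> path_image p" using p(3) q_notin_punctured_disk[OF \<epsilon> k] by blast
    show "finite ?T" unfolding T using tr by (simp add: transverse_def)
    show "0 \<notin> ?T" "1 \<notin> ?T"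
      unfolding T using tr by (auto simp: transverse_def pathstart_def pathfinish_def)
    show "crosses_rightwards p t \<or> crosses_leftwards p t" if "t \<in> ?T" for t
      using that unfolding T using tr by (auto simp: transverse_def)
  qed
  then show ?thesis unfolding T signed_crossings_def by (simp add: conj_assoc Collect_conj_eq[symmetric])
qed

text \<open>With \<open>s = 1 - t\<close> the point lies \<open>s / 2\<close> below the marked line
  and at most \<open>s / 2\<close> sideways from \<open>q m i\<close>, which is at least
  \<open>2 * h\<close> away from \<open>q m k\<close>. So one coordinate differs from that of
  \<open>q m k\<close> by at least \<open>h\<close>, the bound imposed on \<epsilon>.\<close>

lemma spoke_avoids_cball:
  assumes "i \<in> {1..m}" "i \<noteq> k" "\<epsilon> < 1 / (2 * real (m + 1))"
  shows "path_image (linepath q0 (q m i)) \<inter> cball (q m k) \<epsilon> = {}"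
proof -
  define h where "h = 1 / (2 * real (m + 1))"
  have "norm (linepath q0 (q m i) t - q m k) \<ge> h" if t: "t \<in> {0..1}" for t
  proof -
    let ?w = "linepath q0 (q m i) t - q m k"
    define ci ck where "ci = real i / real (m + 1)" and "ck = real k / real (m + 1)"
    define s where "s = 1 - t"
    have s: "0 \<le> s" "s \<le> 1" using t by (auto simp: s_def)
    have ci: "0 \<le> ci" "ci \<le> 1" using assms(1) by (auto simp: ci_def)
    have Im: "\<bar>Im ?w\<bar> = s / 2"
      using s by (simp add: linepath_def q0_def q_def s_def algebra_simps abs_if)
    have Re: "Re ?w = (ci - ck) + s * (1 / 2 - ci)"
    proof -
      have "?w = (q m i - q m k) + of_real s * (q0 - q m i)"
        by (simp add: linepath_def s_def scaleR_conv_of_real algebra_simps)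
      then show ?thesis by (simp add: q_def q0_def ci_def ck_def)
    qed
    have "1 / real (m + 1) \<le> \<bar>real i - real k\<bar> / real (m + 1)"
      using assms(2) by (intro divide_right_mono) auto
    moreover have "2 * (1 / (2 * x)) = 1 / x" for x :: real by simp
    then have "2 * h = 1 / real (m + 1)" unfolding h_def .
    moreover have "\<bar>real i - real k\<bar> / real (m + 1) = \<bar>ci - ck\<bar>"
      unfolding ci_def ck_def diff_divide_distrib[symmetric] by simp
    ultimately have "2 * h \<le> \<bar>ci - ck\<bar>" by simp
    moreover have "\<bar>1 / 2 - ci\<bar> \<le> 1 / 2" unfolding abs_le_iff using ci by simp
    then have "\<bar>s * (1 / 2 - ci)\<bar> \<le> s * (1 / 2)"
      unfolding abs_mult using s by (intro mult_mono) auto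
    ultimately have "2 * h - s / 2 \<le> \<bar>Re ?w\<bar>" unfolding Re by linarith
    then show ?thesis
      using Im abs_Re_le_cmod[of ?w] abs_Im_le_cmod[of ?w] by linarith
  qed
  moreover have "\<epsilon> < h" using assms(3) by (simp add: h_def)
  ultimately show ?thesis
    by (force simp: path_image_def dist_norm norm_minus_commute)
qed

section \<open>The closed cord in the punctured disk\<close>

lemma interior_D: "interior D = {z. 0 < Re z \<and> Re z < 1 \<and> 0 < Im z \<and> Im z < 1}"
  by (auto simp: D_cbox interior_cbox in_box_complex_iff)

lemma spoke_in_disk:
  assumes "l \<in> {1..m}"
  shows "path_image (linepath q0 (q m l)) \<subseteq> {z. 0 < Re z \<and> Re z < 1 \<and> 0 \<le> Im z \<and> Im z < 1}"
proof -
  have "convex ({z. 0 < Re z} \<inter> {z. Re z < 1} \<inter> ({z. 0 \<le> Im z} \<inter> {z. Im z < 1}))"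
    by (intro convex_Int convex_halfspace_Re_gt convex_halfspace_Re_lt convex_halfspace_Im_ge convex_halfspace_Im_lt)
  moreover have "{z. 0 < Re z} \<inter> {z. Re z < 1} \<inter> ({z. 0 \<le> Im z} \<inter> {z. Im z < 1}) =
      {z. 0 < Re z \<and> Re z < 1 \<and> 0 \<le> Im z \<and> Im z < 1}" by auto
  ultimately have "convex {z. 0 < Re z \<and> Re z < 1 \<and> 0 \<le> Im z \<and> Im z < 1}" by simp
  then show ?thesis
    using assms unfolding path_image_linepath
    by (intro closed_segment_subset) (auto simp: q0_def q_def)
qed

context
  fixes m i j :: nat and \<gamma> :: "real \<Rightarrow> complex" and \<epsilon> :: real
  assumes ij: "i \<in> {1..m}" "j \<in> {1..m}" "i < j" and cord: "is_cord m i j \<gamma>"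
    and \<epsilon>: "0 < \<epsilon>" "\<epsilon> < 1 / (2 * real (m + 1))"
    and avoid: "\<forall>k\<in>{1..m} - {i, j}. path_image \<gamma> \<inter> cball (q m k) \<epsilon> = {}"
begin

lemma closed_cord_path:
  shows "path (closed_cord m i j \<gamma>)"
    and "pathfinish (closed_cord m i j \<gamma>) = pathstart (closed_cord m i j \<gamma>)"
    and "path_image (closed_cord m i j \<gamma>) = path_image (linepath q0 (q m i)) \<union> path_image \<gamma> \<union> path_image (linepath q0 (q m j))"
  using cord by (auto simp: closed_cord_def is_cord_def arc_def path_image_join closed_segment_commute)

lemma closed_cord_avoids:
  assumes "k \<in> {1..m} - {i, j}"
  shows "path_image (closed_cord m i j \<gamma>) \<inter> cball (q m k) \<epsilon> = {}"
proof -
  have "i \<noteq> k" "j \<noteq> k" using assms by auto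
  then show ?thesis
    unfolding closed_cord_path(3)
    using assms avoid spoke_avoids_cball[OF ij(1) _ \<epsilon>(2)] spoke_avoids_cball[OF ij(2) _ \<epsilon>(2)] by blast
qed

lemma closed_cord_in_disk:
  "path_image (closed_cord m i j \<gamma>) \<subseteq> {z. 0 < Re z \<and> Re z < 1 \<and> 0 \<le> Im z \<and> Im z < 1}"
proof -
  have "path_image \<gamma> \<subseteq> interior D"
    using cord Q_subset_interior[of m] q_in_Q[OF ij(1)] q_in_Q[OF ij(2)] unfolding is_cord_def by blast
  then show ?thesis
    unfolding closed_cord_path(3) using spoke_in_disk[OF ij(1)] spoke_in_disk[OF ij(2)]
    by (auto simp: interior_D)
qed

lemma closed_cord_in_punctured_disk:
  "path_image (closed_cord m i j \<gamma>) \<subseteq> punctured_disk m \<epsilon> i j"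
proof -
  have "path_image (closed_cord m i j \<gamma>) \<subseteq> D"
    using closed_cord_in_disk by (force simp: D_def)
  moreover have "path_image (closed_cord m i j \<gamma>) \<inter> ball (q m k) \<epsilon> = {}" if "k \<in> {1..m} - {i, j}" for k
    using closed_cord_avoids[OF that] ball_subset_cball by blast
  ultimately show ?thesis unfolding punctured_disk_def by blast
qed

text \<open>The closed cord touches the boundary of the disk only at \<^term>\<open>q0\<close>, so a small upward translation
  moves it into the open region where loops may be perturbed.\<close>

lemma transverse_representative:
  assumes k: "k \<in> {1..m} - {i, j}"
  obtains r where "path r" "pathfinish r = pathstart r" "path_image r \<subseteq> punctured_disk m \<epsilon> i j"
    "homologous (punctured_disk m \<epsilon> i j) (path_chain (closed_cord m i j \<gamma>)) (path_chain r)"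
    "transverse r (\<zeta> m \<epsilon> i j k)"
proof -
  let ?S = "punctured_disk m \<epsilon> i j" and ?p = "closed_cord m i j \<gamma>"
  \<comment> \<open>The half plane above the top edge is included so that the distance to
    \<open>C\<close> also keeps the upward translation inside the disk.\<close>
  define C where "C = (\<Union>k\<in>{1..m} - {i, j}. cball (q m k) \<epsilon>) \<union> {z. 1 \<le> Im z}"
  define U where "U = interior D - C"
  have closedC: "closed C"
    unfolding C_def by (intro closed_Un closed_UN closed_halfspace_Im_ge) auto
  then have openU: "open U" unfolding U_def by (intro open_Diff) auto
  have US: "U \<subseteq> ?S"
    unfolding U_def C_def punctured_disk_def using interior_subset[of D] ball_subset_cball by blast
  have disj: "path_image ?p \<inter> C = {}"
    using closed_cord_avoids closed_cord_in_disk unfolding C_def by force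
  obtain e where e: "0 < e" "\<And>x y. x \<in> path_image ?p \<Longrightarrow> y \<in> C \<Longrightarrow> e \<le> dist x y"
    using separate_compact_closed[OF compact_path_image[OF closed_cord_path(1)] closedC disj] by blast
  define \<eta> where "\<eta> = e / 2"
  have \<eta>: "0 < \<eta>" "\<eta> < e" using e(1) by (simp_all add: \<eta>_def)
  define p1 where "p1 = (\<lambda>t. ?p t + \<i> * of_real \<eta>)"
  have up: "x + \<i> * of_real u \<notin> C" if "x \<in> path_image ?p" "0 \<le> u" "u \<le> \<eta>" for x u
  proof
    assume "x + \<i> * of_real u \<in> C"
    then have "e \<le> dist x (x + \<i> * of_real u)" using e(2) that(1) by blast
    also have "\<dots> = u" using that(2) by (simp add: dist_norm norm_mult)
    finally show False using that(3) \<eta>(2) by simp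
  qed
  have Im1: "Im x + u < 1" if "x \<in> path_image ?p" "0 \<le> u" "u \<le> \<eta>" for x u
    using up[OF that] by (simp add: C_def not_le)
  have p1U: "path_image p1 \<subseteq> U"
  proof
    fix y assume "y \<in> path_image p1"
    then obtain t where t: "t \<in> {0..1}" "y = p1 t" by (auto simp: path_image_def)
    then have x: "?p t \<in> path_image ?p" by (simp add: path_image_def)
    then have "y \<notin> C" using up[of "?p t" \<eta>] \<eta> t by (simp add: p1_def)
    moreover have "y \<in> interior D"
      using closed_cord_in_disk x Im1[OF x, of \<eta>] \<eta> t by (auto simp: interior_D p1_def)
    ultimately show "y \<in> U" by (simp add: U_def)
  qed
  have p1: "path p1" "pathfinish p1 = pathstart p1"
    using closed_cord_path(1,2) unfolding p1_def path_def pathfinish_def pathstart_def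
    by (auto intro!: continuous_intros)
  have "homotopic_loops ?S ?p p1"
  proof (rule homotopic_loops_linear[OF closed_cord_path(1) p1(1) closed_cord_path(2) p1(2)], rule subsetI)
    fix t y assume t: "t \<in> {0..1}" and y: "y \<in> closed_segment (?p t) (p1 t)"
    then obtain s where s: "0 \<le> s" "s \<le> 1" "y = (1 - s) *\<^sub>R ?p t + s *\<^sub>R p1 t" by (auto simp: in_segment)
    have y: "y = ?p t + \<i> * of_real (s * \<eta>)"
      unfolding s(3) p1_def by (simp add: scaleR_conv_of_real algebra_simps)
    have x: "?p t \<in> path_image ?p" using t by (simp add: path_image_def)
    have u: "0 \<le> s * \<eta>" "s * \<eta> \<le> \<eta>" using s \<eta> by (simp_all add: mult_left_le_one_le)
    have "y \<in> D" using closed_cord_in_disk x Im1[OF x u] u unfolding y by (auto simp: D_def)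
    moreover have "y \<notin> ball (q m k) \<epsilon>" if "k \<in> {1..m} - {i, j}" for k
      using up[OF x u] that ball_subset_cball unfolding y C_def by blast
    ultimately show "y \<in> ?S" unfolding punctured_disk_def by blast
  qed
  then have hom1: "homologous ?S (path_chain ?p) (path_chain p1)" by (rule homologous_loops)
  obtain r where r: "path r" "pathfinish r = pathstart r" "path_image r \<subseteq> U" "homotopic_loops U p1 r"
    "finite {t \<in> {0..1}. Re (r t) = Re (q m k)}" "Re (pathstart r) \<noteq> Re (q m k)"
    "\<And>t. Re (r t) = Re (q m k) \<Longrightarrow> crosses_rightwards r t \<or> crosses_leftwards r t"
  proof (rule transverse_approximation[OF p1 openU p1U, where ?x0.0 = "Re (q m k)"], goal_cases)
    case (1 r)
    show ?case by (rule 1(1)[OF 1(2-8)])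
  qed
  have rS: "path_image r \<subseteq> ?S" using r(3) US by blast
  have hom2: "homologous ?S (path_chain p1) (path_chain r)"
    by (rule homologous_mono[OF homologous_loops[OF r(4)] US])
  have A: "Re w = Re (q m k)" if "w \<in> \<zeta> m \<epsilon> i j k" for w
  proof -
    have "w \<in> ?S" using that by (simp add: \<zeta>_def)
    then show ?thesis using that mem_zeta_iff[OF _ k \<epsilon>(1)] by blast
  qed
  have "finite {t \<in> {0..1}. r t \<in> \<zeta> m \<epsilon> i j k}"
    by (rule finite_subset[OF _ r(5)]) (use A in blast)
  then have "transverse r (\<zeta> m \<epsilon> i j k)"
    unfolding transverse_def using A r(2,6,7) by auto
  then show thesis
    using that[OF r(1,2) rS homologous_rel_trans[OF hom2 hom1]] by blast
qed

text \<open>Coordinates and intersection numbers are both negated winding numbers around the holes.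
  For \<open>intersection_number\<close> this requires that a transverse representative exists and
  that all of them give the same count.\<close>

lemma cord_homology:
  assumes v: "\<And>k. k \<in> {1..m} - {i, j} \<Longrightarrow> of_int (v k) = - winding_number (closed_cord m i j \<gamma>) (q m k)"
  shows "to_H m \<epsilon> i j (cord_class m \<epsilon> i j \<gamma>) = (\<Sum>k\<in>{1..m} - {i, j}. frag_cmul (v k) (X k))"
    and "k \<in> {1..m} - {i, j} \<Longrightarrow> intersection_number m \<epsilon> i j (cord_class m \<epsilon> i j \<gamma>) k = v k"
proof -
  let ?S = "punctured_disk m \<epsilon> i j" and ?p = "closed_cord m i j \<gamma>"
  have m: "1 \<le> m" using ij by simp
  show "to_H m \<epsilon> i j (cord_class m \<epsilon> i j \<gamma>) = (\<Sum>k\<in>{1..m} - {i, j}. frag_cmul (v k) (X k))"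
    unfolding cord_class_def
    by (rule to_H_loop[OF \<epsilon> m closed_cord_path(1,2) closed_cord_in_punctured_disk v])
  assume k: "k \<in> {1..m} - {i, j}"
  have count: "signed_crossings r (\<zeta> m \<epsilon> i j k) = v k"
    if r: "path r" "pathfinish r = pathstart r" "path_image r \<subseteq> ?S"
      "homologous ?S (path_chain ?p) (path_chain r)" "transverse r (\<zeta> m \<epsilon> i j k)" for r
  proof -
    have "winding_number r (q m k) = winding_number ?p (q m k)"
      using chain_winding_homologous[OF r(4) q_notin_punctured_disk[OF \<epsilon>(1) k]]
      by (simp add: chain_winding_path)
    then have "(of_int (signed_crossings r (\<zeta> m \<epsilon> i j k)) :: complex) = of_int (v k)"
      unfolding v[OF k] signed_crossings_winding[OF r(1-3) k \<epsilon>(1) r(5)] by (metis minus_minus)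
    then show ?thesis unfolding of_int_eq_iff .
  qed
  obtain r where r: "path r" "pathfinish r = pathstart r" "path_image r \<subseteq> ?S"
    "homologous ?S (path_chain ?p) (path_chain r)" "transverse r (\<zeta> m \<epsilon> i j k)"
  proof (rule transverse_representative[OF k], goal_cases)
    case (1 r)
    show ?case by (rule 1(1)[OF 1(2-6)])
  qed
  show "intersection_number m \<epsilon> i j (cord_class m \<epsilon> i j \<gamma>) k = v k"
    unfolding intersection_number_def cord_class_def homology_class_eq_iff
  proof (rule the_equality)
    show "\<exists>r. path r \<and> pathfinish r = pathstart r \<and> path_image r \<subseteq> ?S \<and>
        homologous ?S (path_chain ?p) (path_chain r) \<and> transverse r (\<zeta> m \<epsilon> i j k) \<and>
        v k = signed_crossings r (\<zeta> m \<epsilon> i j k)"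
      using r count[OF r] by metis
  next
    fix n assume "\<exists>r. path r \<and> pathfinish r = pathstart r \<and> path_image r \<subseteq> ?S \<and>
        homologous ?S (path_chain ?p) (path_chain r) \<and> transverse r (\<zeta> m \<epsilon> i j k) \<and>
        n = signed_crossings r (\<zeta> m \<epsilon> i j k)"
    then show "n = v k" using count by blast
  qed
qed

end

section \<open>The crossing matrix of a simple braid\<close>

theorem theorem5p2:
  fixes m i j :: nat and \<beta> :: braid and \<gamma> :: "real \<Rightarrow> complex" and \<epsilon> :: real
  assumes "2 \<le> m" and "i \<in> {1..m}" and "j \<in> {1..m}" and "i < j"
    and "\<beta> \<in> SB m i j"
    and "is_cord_of m i j \<beta> \<gamma>"
    and "0 < \<epsilon>" and "\<epsilon> < 1 / (2 * real (m + 1))"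
    and "\<forall>k\<in>{1..m} - {i, j}. path_image \<gamma> \<inter> cball (q m k) \<epsilon> = {}"
  shows "(positive_simple m \<beta> \<longrightarrow>
            crossing_vector m \<beta> i = to_H m \<epsilon> i j (cord_class m \<epsilon> i j \<gamma>) + X j \<and>
            crossing_vector m \<beta> j = - to_H m \<epsilon> i j (cord_class m \<epsilon> i j \<gamma>)) \<and>
         (negative_simple m \<beta> \<longrightarrow>
            crossing_vector m \<beta> i = to_H m \<epsilon> i j (cord_class m \<epsilon> i j \<gamma>) \<and>
            crossing_vector m \<beta> j = - to_H m \<epsilon> i j (cord_class m \<epsilon> i j \<gamma>) - X i) \<and>
         (\<forall>k\<in>{1..m}. k \<noteq> i \<and> k \<noteq> j \<longrightarrow>
            (i < k \<and> k < j \<longrightarrow> crossing_vector m \<beta> k =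
               frag_cmul (intersection_number m \<epsilon> i j (cord_class m \<epsilon> i j \<gamma>) k - 1) (X i - X j)) \<and>
            (k < i \<or> j < k \<longrightarrow> crossing_vector m \<beta> k =
               frag_cmul (intersection_number m \<epsilon> i j (cord_class m \<epsilon> i j \<gamma>) k) (X i - X j)))"
proof -
  note ij = assms(2-4)
  from assms(6) obtain s h where cord: "is_cord m i j \<gamma>" and h: "h \<in> mapping_class m \<beta>" "half_twist m s \<gamma> h"
    and sgn: "s \<and> positive_simple m \<beta> \<or> \<not> s \<and> negative_simple m \<beta>"
    unfolding is_cord_of_def by blast
  from h obtain w where w\<beta>: "w \<in> \<beta>" and wh: "word_homeo m w h"
    by (auto simp: mapping_class_def)
  interpret group "braid_group m" by (rule group_braid_group)
  \<comment> \<open>Membership in the carrier comes from simplicity. It makes \<open>\<beta>\<close>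
    the class of the word \<open>w\<close> found above, so that its matrix can be computed from
    \<open>w\<close>.\<close>
  have "\<beta> \<in> carrier (braid_group m)"
  proof -
    have \<sigma>: "\<sigma> m k \<in> carrier (braid_group m)" if "k \<in> {1..<m}" for k
      using that by (auto simp: \<sigma>_def carrier_braid_group)
    from sgn show ?thesis
      unfolding positive_simple_def negative_simple_def by (auto intro!: m_closed inv_closed \<sigma>)
  qed
  then obtain u where u: "u \<in> braid_words m" "\<beta> = braid_class m u"
    by (auto simp: carrier_braid_group)
  have "braid_eq m u w" using w\<beta> u by (auto simp: braid_class_def braid_rel_def)
  then have w: "w \<in> braid_words m" and \<beta>: "\<beta> = braid_class m w"
    using braid_eq_words u by (auto simp: braid_class_eq_iff)
  have perm: "word_perm w = transpose i j"
    using assms(5) braid_perm_class[OF w] by (simp add: SB_def \<beta>)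
  have C: "crossing_matrix \<beta> a b = word_crossings id w a b" for a b
    using crossing_matrix_class[OF w] by (simp add: \<beta>)
  have pos: "positive_simple m \<beta> \<longleftrightarrow> s" and neg: "negative_simple m \<beta> \<longleftrightarrow> \<not> s"
    using sgn not_positive_and_negative_simple[OF w] by (auto simp: \<beta>)
  note wc = simple_word_crossings[OF ij w perm wh h(2) cord]
  \<comment> \<open>Column \<open>i\<close> of the crossing matrix. Off \<open>i\<close> and
    \<open>j\<close> its entries are the negated winding numbers of the closed cord, so both the
    homology class and the intersection numbers are expressed by \<open>v\<close>.\<close>
  define v where "v = (\<lambda>k. word_crossings id w k i)"
  note hom = cord_homology[OF ij cord assms(7-9), of v]
  have to_H: "to_H m \<epsilon> i j (cord_class m \<epsilon> i j \<gamma>) = (\<Sum>k\<in>{1..m} - {i, j}. frag_cmul (v k) (X k))"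
    by (rule hom(1)) (use wc(4) in \<open>simp add: v_def\<close>)
  have int: "intersection_number m \<epsilon> i j (cord_class m \<epsilon> i j \<gamma>) k = v k" if "k \<in> {1..m} - {i, j}" for k
    by (rule hom(2)) (use wc(4) that in \<open>simp_all add: v_def\<close>)
  have kj: "word_crossings id w k j = - v k" if "k \<in> {1..m} - {i, j}" for k
  proof -
    have "(of_int (word_crossings id w k j) :: complex) = of_int (- v k)"
      using wc(4,5)[OF that] by (simp add: v_def)
    then show ?thesis unfolding of_int_eq_iff .
  qed
  have same: "word_crossings id w a a = 0" for a by (simp add: word_crossings_same)
  have fX: "Poly_Mapping.lookup (X a) l = (if a = l then 1 else 0)" for a l :: nat
    by (simp add: lookup_frag_of when_def)
  have vec: "Poly_Mapping.lookup (crossing_vector m \<beta> a) l = (if l \<in> {1..m} then word_crossings id w l a else 0)" for a l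
    unfolding crossing_vector_def C by (rule lookup_sum_frag) simp
  \<comment> \<open>The coefficient at \<open>j\<close> is the algebraic number of crossings of
    string \<open>j\<close> over string \<open>i\<close>: 1 for a positive and 0 for a negative
    braid.\<close>
  have vi: "crossing_vector m \<beta> i = (\<Sum>k\<in>{1..m} - {i, j}. frag_cmul (v k) (X k)) + (if s then X j else 0)"
  proof (rule poly_mapping_eqI)
    fix l
    consider "l = i" | "l = j" | "l \<in> {1..m} - {i, j}" | "l \<notin> {1..m}" by auto
    then show "Poly_Mapping.lookup (crossing_vector m \<beta> i) l =
      Poly_Mapping.lookup ((\<Sum>k\<in>{1..m} - {i, j}. frag_cmul (v k) (X k)) + (if s then X j else 0)) l"
      by cases (use ij in \<open>auto simp: vec lookup_add lookup_sum_frag fX v_def wc(1) same\<close>)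
  qed
  have vj: "crossing_vector m \<beta> j = - (\<Sum>k\<in>{1..m} - {i, j}. frag_cmul (v k) (X k)) - (if s then 0 else X i)"
  proof (rule poly_mapping_eqI)
    fix l
    consider "l = i" | "l = j" | "l \<in> {1..m} - {i, j}" | "l \<notin> {1..m}" by auto
    then show "Poly_Mapping.lookup (crossing_vector m \<beta> j) l =
      Poly_Mapping.lookup (- (\<Sum>k\<in>{1..m} - {i, j}. frag_cmul (v k) (X k)) - (if s then 0 else X i)) l"
      by cases (use ij in \<open>auto simp: vec lookup_minus lookup_sum_frag fX wc(2) same kj\<close>)
  qed
  have vk: "crossing_vector m \<beta> k = frag_cmul (v k - of_bool (i < k \<and> k < j)) (X i - X j)"
    if k: "k \<in> {1..m} - {i, j}" for k
  proof (rule poly_mapping_eqI)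
    fix l
    consider "l = i" | "l = j" | "l \<in> {1..m} - {i, j}" | "l \<notin> {1..m}" by auto
    then show "Poly_Mapping.lookup (crossing_vector m \<beta> k) l =
      Poly_Mapping.lookup (frag_cmul (v k - of_bool (i < k \<and> k < j)) (X i - X j)) l"
      by cases (use ij k in \<open>auto simp: vec lookup_minus lookup_frag_cmul fX v_def wc(6,7)[OF k] wc(3)[OF _ k]\<close>)
  qed
  show ?thesis
    using ij by (auto simp: pos neg vi vj vk to_H int)
qed

end
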